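(* Let $\overline M$ be a $7$-dimensional Riemannian manifold with a $G_2$-structure of type $\mathcal X_4$. Let $\iota:M\to\overline M$ be an orientable hypersurface with unit normal vector field $n$, with the induced $SU(3)$-structure determined by $n$ and a smooth function $\theta$ on $M$. Then $$3Id^*\omega=\iota^*pd^*\varphi=12\,Id\theta+36\,\eta.$$ Moreover, the $SU(3)$-structure on $M$ is of the type given on the left if and only if the condition on the right holds: 1. $\mathcal W_1^++\mathcal W_1^-+\mathcal W_2^++\mathcal W_2^-+\mathcal W_3+\mathcal W_4$: $\iota^*pd^*\varphi=12\,Id\theta$. 2. $\mathcal W_1^++\mathcal W_1^-+\mathcal W_2^++\mathcal W_2^-+\mathcal W_3+\mathcal W_5$: $p_\varphi$ is normal to $M$. 3. $\mathcal W_1^++\mathcal W_1^-+\mathcal W_2^++\mathcal W_2^-+\mathcal W_4+\mathcal W_5$: $IB=B$. 4. $\mathcal W_1^++\mathcal W_1^-+\mathcal W_2^++\mathcal W_3+\mathcal W_4+\mathcal W_5$: $2h\sin\theta\,\langle\cdot,\cdot\rangle=\sin\theta\,(1+I)B$. 5. $\mathcal W_1^++\mathcal W_1^-+\mathcal W_2^-+\mathcal W_3+\mathcal W_4+\mathcal W_5$: $2h\cos\theta\,\langle\cdot,\cdot\rangle=\cos\theta\,(1+I)B$. 6. $\mathcal W_1^++\mathcal W_2^++\mathcal W_2^-+\mathcal W_3+\mathcal W_4+\mathcal W_5$: $\sin\theta\,(pd^*\varphi(n)-12h)=0$. 7. $\mathcal W_1^-+\mathcal W_2^++\mathcal W_2^-+\mathcal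 W_3+\mathcal W_4+\mathcal W_5$: $\cos\theta\,(pd^*\varphi(n)-12h)=0$. 8. $\mathcal W_1^++\mathcal W_1^-+\mathcal W_3+\mathcal W_4+\mathcal W_5$: $(1+I)B=2h\langle\cdot,\cdot\rangle$. 9. $\mathcal W_2^++\mathcal W_2^-+\mathcal W_3+\mathcal W_4+\mathcal W_5$: $pd^*\varphi(n)=12h$. 10. $\mathcal W_1^++\mathcal W_1^-+\mathcal W_4+\mathcal W_5$: $M$ is totally umbilic.
   Context: $G_2$-structures: a $G_2$-structure on a Riemannian $7$-manifold $(\overline M,\langle\cdot,\cdot\rangle)$ is given by a global three-form $\varphi$ such that locally there is an orthonormal frame $\{e_0,\dots,e_6\}$ (indices in $\mathbb Z_7$) with $\varphi=\sum_ie_i\wedge e_{i+1}\wedge e_{i+3}$ (vectors are identified with one-forms via the metric). $\langle P(x,y),z\rangle=\varphi(x,y,z)$, and $*\varphi=-\sum_{i}e_{i+2}\wedge e_{i+4}\wedge e_{i+5}\wedge e_{i+6}$ (Hodge dual for the orientation $e_0\wedge\dots\wedge e_6$). $\overline\nabla$ is the Levi-Civita connection and $\overline r(\varphi)(x,y)=\frac14\langle\overline\nabla_x\varphi,y\lrcorner*\varphi\rangle$, where $\langle a,b\rangle=\frac1{p!}\sum a(e_{i_1},\dots)b(e_{i_1},\dots)$ for $p$-forms. The one-form $pd^*\varphi$ and the vector field $p_\varphi$ are given by $pd^*\varphi=*( *d\varphi\wedge\varphi)=\langle p_\varphi,\cdot\rangle$. Type $\mathcal X_4$ (locally conformal parallel):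 $\overline r(\varphi)=-\frac1{12}\,p_\varphi\lrcorner\varphi$. Induced structure on $M$: the induced metric, $Ix=P(n,x)$, and $\Psi=\psi_++i\psi_-$ with $\psi_+=\cos\theta\,\iota^*\varphi-\sin\theta\,\iota^*(n\lrcorner*\varphi)$, $\psi_-=\sin\theta\,\iota^*\varphi+\cos\theta\,\iota^*(n\lrcorner*\varphi)$. $B(x,y)=\langle II(x,y),n\rangle=\langle\overline\nabla_xy,n\rangle$ is the second fundamental form, $h=\frac16\mathrm{Tr}\,B$ (so $h=\langle H,n\rangle$, $H$ the mean curvature); totally umbilic means $B=h\langle\cdot,\cdot\rangle$. For a bilinear form $b$ on $M$, $(Ib)(x,y)=b(Ix,Iy)$; for a one-form $\mu$, $(I\mu)(x)=-\mu(Ix)$. "$p_\varphi$ is normal to $M$" means that its tangential part vanishes along $M$. Types of $SU(3)$-structure: $\nabla$ is the Levi-Civita connection of $M$, $\omega(x,y)=\langle x,Iy\rangle$, $d^*\omega=-\sum_ie_i\lrcorner\nabla_{e_i}\omega$. $\nabla\omega$ lies in $\{\alpha\mid\alpha(x,y,z)=-\alpha(x,z,y)=-\alpha(x,Iy,Iz)\}=\mathcal W_1\oplus\mathcal W_2\oplus\mathcal W_3\oplus\mathcal W_4$ (Gray–Hervella), where $\mathcal W_1$: $\alpha$ totally skew; $\mathcal W_2$: cyclic sum of $\alpha(x,y,z)$ is zero; $\mathcal W_3$: $\alpha(Ix,Iy,z)=\alpha(x,y,z)$ and $\sum_i\alpha(e_i,e_i,z)=0$; $\mathcal W_4$: $\alpha(x,y,z)=\langle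 x,y\rangle\tau(z)-\langle x,z\rangle\tau(y)-\langle x,Iy\rangle\tau(Iz)+\langle x,Iz\rangle\tau(Iy)$ for some one-form $\tau$. With $r(\alpha)(x,y)=\frac12\langle x\lrcorner\alpha,y\lrcorner\psi_+\rangle$, for $i=1,2$ one has $\mathcal W_i=\mathcal W_i^+\oplus\mathcal W_i^-$, where $\mathcal W_i^+$ (resp. $\mathcal W_i^-$) is the set of $\alpha\in\mathcal W_i$ with $r(\alpha)$ symmetric (resp. skew-symmetric). The $\mathcal W_5$-part of the torsion is the one-form $\eta$ determined by requiring that the metric connection $\nabla+\eta+\xi$, with $\eta_XY=(I\eta)(X)IY$ and $\xi_XY=-\frac12I(\nabla_XI)Y$, makes $\omega,\psi_+,\psi_-$ parallel; equivalently $(I\eta)(X)=-\frac1{12}\langle\nabla_X\psi_+,\psi_-\rangle$. $M$ is of type $\mathcal U$, a sum of some of $\mathcal W_1^\pm,\mathcal W_2^\pm,\mathcal W_3,\mathcal W_4,\mathcal W_5$, if the components of $\nabla\omega$ in the $\mathcal W$'s not occurring in $\mathcal U$ vanish everywhere and, when $\mathcal W_5$ does not occur, $\eta=0$. *)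

theory Defs
  imports "HOL-Analysis.Analysis"
begin

section \<open>Smooth manifolds\<close>

text \<open>A smooth manifold is a second countable Hausdorff space, given as a type, together with an
  atlas. A chart is a pair of a domain and a coordinate map; only the values of the coordinate map
  on the domain matter.\<close>

type_synonym ('m, 'e) chart = "'m set \<times> ('m \<Rightarrow> 'e)"

primrec Ck_on :: "nat \<Rightarrow> 'a::euclidean_space set \<Rightarrow> ('a \<Rightarrow> 'b::real_normed_vector) \<Rightarrow> bool" where
  "Ck_on 0 S f \<longleftrightarrow> continuous_on S f"
| "Ck_on (Suc k) S f \<longleftrightarrow> (\<forall>x\<in>S. f differentiable (at x)) \<and>
     (\<forall>b\<in>Basis. Ck_on k S (\<lambda>x. frechet_derivative f (at x) b))"

text \<open>Only used for open \<open>S\<close>.\<close>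

definition smooth_on :: "'a::euclidean_space set \<Rightarrow> ('a \<Rightarrow> 'b::real_normed_vector) \<Rightarrow> bool" where
  "smooth_on S f \<longleftrightarrow> (\<forall>k. Ck_on k S f)"

definition chart_inv :: "('m, 'e) chart \<Rightarrow> 'e \<Rightarrow> 'm" where
  "chart_inv c = inv_into (fst c) (snd c)"

definition smooth_manifold ::
  "('m::{t2_space,second_countable_topology}, 'e::euclidean_space) chart set \<Rightarrow> bool" where
  "smooth_manifold A \<longleftrightarrow>
     (\<forall>c\<in>A. open (fst c) \<and> open (snd c ` fst c) \<and>
        homeomorphism (fst c) (snd c ` fst c) (snd c) (chart_inv c)) \<and>
     (\<Union>c\<in>A. fst c) = UNIV \<and>
     (\<forall>c\<in>A. \<forall>c'\<in>A. smooth_on (snd c ` (fst c \<inter> fst c')) (snd c' \<circ> chart_inv c))"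

text \<open>The tangent space at \<open>p\<close> is the model space \<open>'e\<close>: a vector in \<open>'e\<close> stands for the tangent
  vector at \<open>p\<close> having these components in the preferred chart \<open>chart_at A p\<close>. The preferred chart
  may jump from point to point, so smoothness of fields and derivatives of tensor fields are always
  expressed after passing to one fixed chart, by means of the two coordinate changes below.\<close>

definition chart_at :: "('m, 'e) chart set \<Rightarrow> 'm \<Rightarrow> ('m, 'e) chart" where
  "chart_at A p = (SOME c. c \<in> A \<and> p \<in> fst c)"

definition to_tangent ::
  "('m, 'e::euclidean_space) chart set \<Rightarrow> ('m, 'e) chart \<Rightarrow> 'm \<Rightarrow> 'e \<Rightarrow> 'e" where
  "to_tangent A c q = frechet_derivative (snd (chart_at A q) \<circ> chart_inv c) (at (snd c q))"

definition from_tangent ::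
  "('m, 'e::euclidean_space) chart set \<Rightarrow> ('m, 'e) chart \<Rightarrow> 'm \<Rightarrow> 'e \<Rightarrow> 'e" where
  "from_tangent A c q =
     frechet_derivative (snd c \<circ> chart_inv (chart_at A q)) (at (snd (chart_at A q) q))"

definition smooth_map ::
  "('m::topological_space, 'e::euclidean_space) chart set \<Rightarrow>
   ('n::topological_space, 'f::euclidean_space) chart set \<Rightarrow> ('m \<Rightarrow> 'n) \<Rightarrow> bool" where
  "smooth_map A A' F \<longleftrightarrow> continuous_on UNIV F \<and>
     (\<forall>c\<in>A. \<forall>c'\<in>A'. smooth_on (snd c ` (fst c \<inter> F -` fst c')) (snd c' \<circ> F \<circ> chart_inv c))"

definition smooth_function ::
  "('m, 'e::euclidean_space) chart set \<Rightarrow> ('m \<Rightarrow> real) \<Rightarrow> bool" where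
  "smooth_function A f \<longleftrightarrow> (\<forall>c\<in>A. smooth_on (snd c ` fst c) (f \<circ> chart_inv c))"

definition local_rep ::
  "('m, 'e) chart set \<Rightarrow> ('n, 'f) chart set \<Rightarrow> ('m \<Rightarrow> 'n) \<Rightarrow> 'm \<Rightarrow> 'e \<Rightarrow> 'f" where
  "local_rep A A' F p = snd (chart_at A' (F p)) \<circ> F \<circ> chart_inv (chart_at A p)"

definition tangent_map ::
  "('m, 'e::euclidean_space) chart set \<Rightarrow> ('n, 'f::euclidean_space) chart set \<Rightarrow>
   ('m \<Rightarrow> 'n) \<Rightarrow> 'm \<Rightarrow> 'e \<Rightarrow> 'f" where
  "tangent_map A A' F p = frechet_derivative (local_rep A A' F p) (at (snd (chart_at A p) p))"

definition differential ::
  "('m, 'e::euclidean_space) chart set \<Rightarrow> ('m \<Rightarrow> real) \<Rightarrow> 'm \<Rightarrow> 'e \<Rightarrow> real" where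
  "differential A f p =
     frechet_derivative (f \<circ> chart_inv (chart_at A p)) (at (snd (chart_at A p) p))"

text \<open>\<open>X\<close> is a vector field along \<open>F\<close>, i.e. \<open>X q\<close> is tangent at \<open>F q\<close>; smoothness is required on the
  open set \<open>V\<close>. For \<open>F = id\<close> these are the smooth vector fields on \<open>V\<close>.\<close>

definition smooth_along ::
  "('m, 'e::euclidean_space) chart set \<Rightarrow> ('n, 'f::euclidean_space) chart set \<Rightarrow>
   'm set \<Rightarrow> ('m \<Rightarrow> 'n) \<Rightarrow> ('m \<Rightarrow> 'f) \<Rightarrow> bool" where
  "smooth_along A A' V F X \<longleftrightarrow>
     (\<forall>c\<in>A. \<forall>c'\<in>A'. smooth_on (snd c ` (fst c \<inter> V \<inter> F -` fst c'))
        (\<lambda>z. from_tangent A' c' (F (chart_inv c z)) (X (chart_inv c z))))"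


section \<open>Tensor fields and the Levi-Civita connection\<close>

text \<open>A covariant \<open>k\<close>-tensor is a function on lists of vectors, of which only the values on lists
  of length \<open>k\<close> matter. Metrics, bilinear forms and one-forms are curried instead.\<close>

type_synonym 'e tensor = "'e list \<Rightarrow> real"

definition tensor2 :: "('m \<Rightarrow> 'e \<Rightarrow> 'e \<Rightarrow> real) \<Rightarrow> 'm \<Rightarrow> 'e tensor" where
  "tensor2 b p vs = b p (vs ! 0) (vs ! 1)"

definition chart_rep ::
  "('m, 'e::euclidean_space) chart set \<Rightarrow> ('m \<Rightarrow> 'e tensor) \<Rightarrow> ('m, 'e) chart \<Rightarrow> 'e \<Rightarrow> 'e tensor" where
  "chart_rep A T c z vs = T (chart_inv c z) (map (to_tangent A c (chart_inv c z)) vs)"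

definition smooth_tensor ::
  "('m, 'e::euclidean_space) chart set \<Rightarrow> nat \<Rightarrow> ('m \<Rightarrow> 'e tensor) \<Rightarrow> bool" where
  "smooth_tensor A k T \<longleftrightarrow>
     (\<forall>c\<in>A. \<forall>vs. length vs = k \<longrightarrow> smooth_on (snd c ` fst c) (\<lambda>z. chart_rep A T c z vs))"

text \<open>Derivative at \<open>p\<close> in direction \<open>u\<close> of the components of \<open>T\<close> in the chart \<open>chart_at A p\<close>.\<close>

definition component_deriv ::
  "('m, 'e::euclidean_space) chart set \<Rightarrow> ('m \<Rightarrow> 'e tensor) \<Rightarrow> 'm \<Rightarrow> 'e \<Rightarrow> 'e tensor" where
  "component_deriv A T p u vs =
     frechet_derivative (\<lambda>z. chart_rep A T (chart_at A p) z vs) (at (snd (chart_at A p) p)) u"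

definition riemannian_metric ::
  "('m, 'e::euclidean_space) chart set \<Rightarrow> ('m \<Rightarrow> 'e \<Rightarrow> 'e \<Rightarrow> real) \<Rightarrow> bool" where
  "riemannian_metric A g \<longleftrightarrow>
     (\<forall>p. bilinear (g p) \<and> (\<forall>x y. g p x y = g p y x) \<and> (\<forall>x. x \<noteq> 0 \<longrightarrow> g p x x > 0)) \<and>
     smooth_tensor A 2 (tensor2 g)"

text \<open>The Levi-Civita connection, through its Christoffel map in the chart \<open>chart_at A p\<close>: the
  covariant derivative at \<open>p\<close> of the \<open>v\<close>-th coordinate field in direction \<open>u\<close>. Symmetry is
  vanishing of the torsion, the last condition is \<open>\<nabla>g = 0\<close>.\<close>

definition christoffel ::
  "('m, 'e::euclidean_space) chart set \<Rightarrow> ('m \<Rightarrow> 'e \<Rightarrow> 'e \<Rightarrow> real) \<Rightarrow> 'm \<Rightarrow> 'e \<Rightarrow> 'e \<Rightarrow> 'e" where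
  "christoffel A g p = (THE \<Gamma>. bilinear \<Gamma> \<and> (\<forall>u v. \<Gamma> u v = \<Gamma> v u) \<and>
     (\<forall>u v w. component_deriv A (tensor2 g) p u [v, w] = g p (\<Gamma> u v) w + g p v (\<Gamma> u w)))"

definition covd ::
  "('m, 'e::euclidean_space) chart set \<Rightarrow> ('m \<Rightarrow> 'e \<Rightarrow> 'e \<Rightarrow> real) \<Rightarrow> ('m \<Rightarrow> 'e tensor) \<Rightarrow>
   'm \<Rightarrow> 'e \<Rightarrow> 'e tensor" where
  "covd A g T p u vs = component_deriv A T p u vs -
     (\<Sum>i<length vs. T p (vs[i := christoffel A g p u (vs ! i)]))"

definition ext_deriv ::
  "('m, 'e::euclidean_space) chart set \<Rightarrow> ('m \<Rightarrow> 'e tensor) \<Rightarrow> 'm \<Rightarrow> 'e tensor" where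
  "ext_deriv A T p vs =
     (\<Sum>i<length vs. (- 1) ^ i * component_deriv A T p (vs ! i) (take i vs @ drop (Suc i) vs))"

definition pullback ::
  "('m, 'e::euclidean_space) chart set \<Rightarrow> ('n, 'f::euclidean_space) chart set \<Rightarrow> ('m \<Rightarrow> 'n) \<Rightarrow>
   ('n \<Rightarrow> 'f tensor) \<Rightarrow> 'm \<Rightarrow> 'e tensor" where
  "pullback A A' F T x vs = T (F x) (map (tangent_map A A' F x) vs)"


section \<open>Exterior algebra of a Euclidean vector space\<close>

text \<open>Wedge products follow the determinant convention, so that \<open>e\<^sub>1 \<and> \<dots> \<and> e\<^sub>k\<close> takes the value 1
  on \<open>(e\<^sub>1, \<dots>, e\<^sub>k)\<close>.\<close>

definition wedge1 :: "('e \<Rightarrow> real) list \<Rightarrow> 'e tensor" where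
  "wedge1 \<mu>s vs = (\<Sum>\<sigma> | \<sigma> permutes {..<length \<mu>s}.
     of_int (sign \<sigma>) * (\<Prod>i<length \<mu>s. (\<mu>s ! i) (vs ! \<sigma> i)))"

definition wedge :: "nat \<Rightarrow> nat \<Rightarrow> 'e tensor \<Rightarrow> 'e tensor \<Rightarrow> 'e tensor" where
  "wedge p q \<alpha> \<beta> vs = (\<Sum>\<sigma> | \<sigma> permutes {..<p + q}. of_int (sign \<sigma>) *
     \<alpha> (map (\<lambda>i. vs ! \<sigma> i) [0..<p]) * \<beta> (map (\<lambda>i. vs ! \<sigma> i) [p..<p + q])) / (fact p * fact q)"

definition interior :: "'e \<Rightarrow> 'e tensor \<Rightarrow> 'e tensor" where
  "interior x \<alpha> vs = \<alpha> (x # vs)"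

text \<open>The vector corresponding to a one-form under the metric.\<close>

definition sharp :: "('e \<Rightarrow> 'e \<Rightarrow> real) \<Rightarrow> ('e \<Rightarrow> real) \<Rightarrow> 'e" where
  "sharp g \<mu> = (THE v. \<forall>x. g v x = \<mu> x)"

text \<open>Traces and inner products do not depend on the orthonormal basis chosen here.\<close>

definition onb :: "('e::euclidean_space \<Rightarrow> 'e \<Rightarrow> real) \<Rightarrow> 'e set" where
  "onb g = (SOME E. finite E \<and> card E = DIM('e) \<and>
     (\<forall>x\<in>E. \<forall>y\<in>E. g x y = (if x = y then 1 else 0)))"

definition form_inner ::
  "('e::euclidean_space \<Rightarrow> 'e \<Rightarrow> real) \<Rightarrow> nat \<Rightarrow> 'e tensor \<Rightarrow> 'e tensor \<Rightarrow> real" where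
  "form_inner g p \<alpha> \<beta> = (\<Sum>vs | set vs \<subseteq> onb g \<and> length vs = p. \<alpha> vs * \<beta> vs) / fact p"

definition metric_trace ::
  "('e::euclidean_space \<Rightarrow> 'e \<Rightarrow> real) \<Rightarrow> ('e \<Rightarrow> 'e \<Rightarrow> real) \<Rightarrow> real" where
  "metric_trace g b = (\<Sum>e\<in>onb g. b e e)"


section \<open>G2-structures\<close>

text \<open>The type \<open>7\<close> of integers modulo 7 indexes the frames, so \<open>i + 1\<close> and \<open>i + 3\<close> are modulo 7.\<close>

definition adapted_frame ::
  "(real^7 \<Rightarrow> real^7 \<Rightarrow> real) \<Rightarrow> (real^7) tensor \<Rightarrow> (7 \<Rightarrow> real^7) \<Rightarrow> bool" where
  "adapted_frame g \<phi> e \<longleftrightarrow>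
     (\<forall>i j. g (e i) (e j) = (if i = j then 1 else 0)) \<and>
     (\<forall>x y z. \<phi> [x, y, z] = (\<Sum>i\<in>UNIV. wedge1 [g (e i), g (e (i + 1)), g (e (i + 3))] [x, y, z]))"

definition G2_structure ::
  "('n::topological_space, real^7) chart set \<Rightarrow> ('n \<Rightarrow> real^7 \<Rightarrow> real^7 \<Rightarrow> real) \<Rightarrow>
   ('n \<Rightarrow> (real^7) tensor) \<Rightarrow> bool" where
  "G2_structure A g \<phi> \<longleftrightarrow>
     (\<forall>p. \<exists>V e. open V \<and> p \<in> V \<and> (\<forall>i. smooth_along A A V id (e i)) \<and>
        (\<forall>q\<in>V. adapted_frame (g q) (\<phi> q) (\<lambda>i. e i q)))"

text \<open>The Hodge star on \<open>k\<close>-forms for the metric \<open>g\<close> and the orientation \<open>e\<^sub>0 \<and> \<dots> \<and> e\<^sub>6\<close> of a frame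
  adapted to \<open>\<phi>\<close>; it does not depend on the adapted frame.\<close>

definition star ::
  "(real^7 \<Rightarrow> real^7 \<Rightarrow> real) \<Rightarrow> (real^7) tensor \<Rightarrow> nat \<Rightarrow> (real^7) tensor \<Rightarrow> (real^7) tensor" where
  "star g \<phi> k \<alpha> ws = (let e = (SOME e. adapted_frame g \<phi> e) in
     (\<Sum>is | length is = k. \<alpha> (map e is) *
        wedge1 (map (\<lambda>i. g (e i)) [0, 1, 2, 3, 4, 5, 6]) (map e is @ ws)) / fact k)"

definition star_phi ::
  "('n \<Rightarrow> real^7 \<Rightarrow> real^7 \<Rightarrow> real) \<Rightarrow> ('n \<Rightarrow> (real^7) tensor) \<Rightarrow> 'n \<Rightarrow> (real^7) tensor" where
  "star_phi g \<phi> p = star (g p) (\<phi> p) 3 (\<phi> p)"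

definition cross ::
  "('n \<Rightarrow> real^7 \<Rightarrow> real^7 \<Rightarrow> real) \<Rightarrow> ('n \<Rightarrow> (real^7) tensor) \<Rightarrow> 'n \<Rightarrow> real^7 \<Rightarrow> real^7 \<Rightarrow> real^7" where
  "cross g \<phi> p x y = sharp (g p) (\<lambda>z. \<phi> p [x, y, z])"

definition pd_star ::
  "('n, real^7) chart set \<Rightarrow> ('n \<Rightarrow> real^7 \<Rightarrow> real^7 \<Rightarrow> real) \<Rightarrow> ('n \<Rightarrow> (real^7) tensor) \<Rightarrow>
   'n \<Rightarrow> real^7 \<Rightarrow> real" where
  "pd_star A g \<phi> p x =
     star (g p) (\<phi> p) 6 (wedge 3 3 (star (g p) (\<phi> p) 4 (ext_deriv A \<phi> p)) (\<phi> p)) [x]"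

definition p_vec ::
  "('n, real^7) chart set \<Rightarrow> ('n \<Rightarrow> real^7 \<Rightarrow> real^7 \<Rightarrow> real) \<Rightarrow> ('n \<Rightarrow> (real^7) tensor) \<Rightarrow>
   'n \<Rightarrow> real^7" where
  "p_vec A g \<phi> p = sharp (g p) (pd_star A g \<phi> p)"

definition r_bar ::
  "('n, real^7) chart set \<Rightarrow> ('n \<Rightarrow> real^7 \<Rightarrow> real^7 \<Rightarrow> real) \<Rightarrow> ('n \<Rightarrow> (real^7) tensor) \<Rightarrow>
   'n \<Rightarrow> real^7 \<Rightarrow> real^7 \<Rightarrow> real" where
  "r_bar A g \<phi> p x y = 1 / 4 * form_inner (g p) 3 (covd A g \<phi> p x) (interior y (star_phi g \<phi> p))"

definition type_X4 ::
  "('n, real^7) chart set \<Rightarrow> ('n \<Rightarrow> real^7 \<Rightarrow> real^7 \<Rightarrow> real) \<Rightarrow> ('n \<Rightarrow> (real^7) tensor) \<Rightarrow> bool" where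
  "type_X4 A g \<phi> \<longleftrightarrow>
     (\<forall>p x y. r_bar A g \<phi> p x y = - 1 / 12 * interior (p_vec A g \<phi> p) (\<phi> p) [x, y])"


section \<open>Hypersurfaces and their induced structure\<close>

text \<open>Hypersurfaces are immersed. Throughout, \<open>A\<close> is the atlas of the hypersurface and \<open>A'\<close> that of
  the ambient manifold. The unit normal field \<open>n\<close> is a field along \<open>\<iota>\<close>.\<close>

definition hypersurface_with_normal ::
  "('m::topological_space, real^6) chart set \<Rightarrow> ('n::topological_space, real^7) chart set \<Rightarrow>
   ('n \<Rightarrow> real^7 \<Rightarrow> real^7 \<Rightarrow> real) \<Rightarrow> ('m \<Rightarrow> 'n) \<Rightarrow> ('m \<Rightarrow> real^7) \<Rightarrow> bool" where
  "hypersurface_with_normal A A' g \<iota> n \<longleftrightarrow>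
     smooth_map A A' \<iota> \<and> (\<forall>x. inj (tangent_map A A' \<iota> x)) \<and>
     smooth_along A A' UNIV \<iota> n \<and>
     (\<forall>x. g (\<iota> x) (n x) (n x) = 1 \<and> (\<forall>u. g (\<iota> x) (n x) (tangent_map A A' \<iota> x u) = 0))"

definition induced_metric ::
  "('m, real^6) chart set \<Rightarrow> ('n, real^7) chart set \<Rightarrow> ('n \<Rightarrow> real^7 \<Rightarrow> real^7 \<Rightarrow> real) \<Rightarrow>
   ('m \<Rightarrow> 'n) \<Rightarrow> 'm \<Rightarrow> real^6 \<Rightarrow> real^6 \<Rightarrow> real" where
  "induced_metric A A' g \<iota> x u v =
     g (\<iota> x) (tangent_map A A' \<iota> x u) (tangent_map A A' \<iota> x v)"

definition induced_I ::
  "('m, real^6) chart set \<Rightarrow> ('n, real^7) chart set \<Rightarrow> ('n \<Rightarrow> real^7 \<Rightarrow> real^7 \<Rightarrow> real) \<Rightarrow>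
   ('n \<Rightarrow> (real^7) tensor) \<Rightarrow> ('m \<Rightarrow> 'n) \<Rightarrow> ('m \<Rightarrow> real^7) \<Rightarrow> 'm \<Rightarrow> real^6 \<Rightarrow> real^6" where
  "induced_I A A' g \<phi> \<iota> n x u = (THE v.
     tangent_map A A' \<iota> x v = cross g \<phi> (\<iota> x) (n x) (tangent_map A A' \<iota> x u))"

definition pullback_n_star_phi ::
  "('m, real^6) chart set \<Rightarrow> ('n, real^7) chart set \<Rightarrow> ('n \<Rightarrow> real^7 \<Rightarrow> real^7 \<Rightarrow> real) \<Rightarrow>
   ('n \<Rightarrow> (real^7) tensor) \<Rightarrow> ('m \<Rightarrow> 'n) \<Rightarrow> ('m \<Rightarrow> real^7) \<Rightarrow> 'm \<Rightarrow> (real^6) tensor" where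
  "pullback_n_star_phi A A' g \<phi> \<iota> n x vs =
     interior (n x) (star_phi g \<phi> (\<iota> x)) (map (tangent_map A A' \<iota> x) vs)"

definition psi_plus ::
  "('m, real^6) chart set \<Rightarrow> ('n, real^7) chart set \<Rightarrow> ('n \<Rightarrow> real^7 \<Rightarrow> real^7 \<Rightarrow> real) \<Rightarrow>
   ('n \<Rightarrow> (real^7) tensor) \<Rightarrow> ('m \<Rightarrow> 'n) \<Rightarrow> ('m \<Rightarrow> real^7) \<Rightarrow> ('m \<Rightarrow> real) \<Rightarrow> 'm \<Rightarrow> (real^6) tensor" where
  "psi_plus A A' g \<phi> \<iota> n \<theta> x vs =
     cos (\<theta> x) * pullback A A' \<iota> \<phi> x vs - sin (\<theta> x) * pullback_n_star_phi A A' g \<phi> \<iota> n x vs"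

definition psi_minus ::
  "('m, real^6) chart set \<Rightarrow> ('n, real^7) chart set \<Rightarrow> ('n \<Rightarrow> real^7 \<Rightarrow> real^7 \<Rightarrow> real) \<Rightarrow>
   ('n \<Rightarrow> (real^7) tensor) \<Rightarrow> ('m \<Rightarrow> 'n) \<Rightarrow> ('m \<Rightarrow> real^7) \<Rightarrow> ('m \<Rightarrow> real) \<Rightarrow> 'm \<Rightarrow> (real^6) tensor" where
  "psi_minus A A' g \<phi> \<iota> n \<theta> x vs =
     sin (\<theta> x) * pullback A A' \<iota> \<phi> x vs + cos (\<theta> x) * pullback_n_star_phi A A' g \<phi> \<iota> n x vs"

text \<open>\<open>B(u,v) = \<langle>\<nabla>\<^sub>u v, n\<rangle>\<close> with the ambient Levi-Civita connection, where \<open>v\<close> is extended with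
  constant components in \<open>chart_at A x\<close>. In the ambient chart \<open>chart_at A' (\<iota> x)\<close> the field
  \<open>d\<iota>(v)\<close> along \<open>\<iota>\<close> then has the components \<open>frechet_derivative f (at z) v\<close> with
  \<open>f = local_rep A A' \<iota> x\<close>.\<close>

definition second_fundamental_form ::
  "('m, real^6) chart set \<Rightarrow> ('n, real^7) chart set \<Rightarrow> ('n \<Rightarrow> real^7 \<Rightarrow> real^7 \<Rightarrow> real) \<Rightarrow>
   ('m \<Rightarrow> 'n) \<Rightarrow> ('m \<Rightarrow> real^7) \<Rightarrow> 'm \<Rightarrow> real^6 \<Rightarrow> real^6 \<Rightarrow> real" where
  "second_fundamental_form A A' g \<iota> n x u v =
     g (\<iota> x)
       (frechet_derivative (\<lambda>z. frechet_derivative (local_rep A A' \<iota> x) (at z) v)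
          (at (snd (chart_at A x) x)) u
        + christoffel A' g (\<iota> x) (tangent_map A A' \<iota> x u) (tangent_map A A' \<iota> x v))
       (n x)"


section \<open>SU(3)-structures and their types\<close>

text \<open>An SU(3)-structure is given by a metric \<open>g\<close>, an almost complex structure \<open>I\<close> and the real
  and imaginary parts of the complex volume form.\<close>

definition act1 :: "('e \<Rightarrow> 'e) \<Rightarrow> ('e \<Rightarrow> real) \<Rightarrow> 'e \<Rightarrow> real" where
  "act1 I \<mu> x = - \<mu> (I x)"

definition act2 :: "('e \<Rightarrow> 'e) \<Rightarrow> ('e \<Rightarrow> 'e \<Rightarrow> real) \<Rightarrow> 'e \<Rightarrow> 'e \<Rightarrow> real" where
  "act2 I b x y = b (I x) (I y)"

definition omega ::
  "('m \<Rightarrow> 'e \<Rightarrow> 'e \<Rightarrow> real) \<Rightarrow> ('m \<Rightarrow> 'e \<Rightarrow> 'e) \<Rightarrow> 'm \<Rightarrow> 'e \<Rightarrow> 'e \<Rightarrow> real" where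
  "omega g I p x y = g p x (I p y)"

definition nabla_omega ::
  "('m, real^6) chart set \<Rightarrow> ('m \<Rightarrow> real^6 \<Rightarrow> real^6 \<Rightarrow> real) \<Rightarrow> ('m \<Rightarrow> real^6 \<Rightarrow> real^6) \<Rightarrow>
   'm \<Rightarrow> real^6 \<Rightarrow> real^6 \<Rightarrow> real^6 \<Rightarrow> real" where
  "nabla_omega A g I p x y z = covd A g (tensor2 (omega g I)) p x [y, z]"

definition codiff_omega ::
  "('m, real^6) chart set \<Rightarrow> ('m \<Rightarrow> real^6 \<Rightarrow> real^6 \<Rightarrow> real) \<Rightarrow> ('m \<Rightarrow> real^6 \<Rightarrow> real^6) \<Rightarrow>
   'm \<Rightarrow> real^6 \<Rightarrow> real" where
  "codiff_omega A g I p y = - metric_trace (g p) (\<lambda>e e'. nabla_omega A g I p e e' y)"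

text \<open>\<open>(I\<eta>)(x) = - 1/12 \<langle>\<nabla>\<^sub>x \<psi>\<^sub>+, \<psi>\<^sub>-\<rangle>\<close>; this is the one-form for which the metric connection
  \<open>\<nabla> + \<eta> + \<xi>\<close>, with \<open>\<eta>\<^sub>x y = (I\<eta>)(x) I y\<close> and \<open>\<xi>\<^sub>x y = - 1/2 I (\<nabla>\<^sub>x I) y\<close>, makes \<open>\<omega>\<close> and
  \<open>\<psi>\<^sub>+, \<psi>\<^sub>-\<close> parallel.\<close>

definition eta ::
  "('m, real^6) chart set \<Rightarrow> ('m \<Rightarrow> real^6 \<Rightarrow> real^6 \<Rightarrow> real) \<Rightarrow> ('m \<Rightarrow> real^6 \<Rightarrow> real^6) \<Rightarrow>
   ('m \<Rightarrow> (real^6) tensor) \<Rightarrow> ('m \<Rightarrow> (real^6) tensor) \<Rightarrow> 'm \<Rightarrow> real^6 \<Rightarrow> real" where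
  "eta A g I \<psi>p \<psi>m p = (THE \<mu>. \<forall>x.
     act1 (I p) \<mu> x = - 1 / 12 * form_inner (g p) 3 (covd A g \<psi>p p x) (\<psi>m p))"

text \<open>Pointwise, for \<open>g\<close>, \<open>I\<close> and \<open>\<psi>\<^sub>+\<close> on a single tangent space.\<close>

definition r_map ::
  "(real^6 \<Rightarrow> real^6 \<Rightarrow> real) \<Rightarrow> (real^6) tensor \<Rightarrow> (real^6 \<Rightarrow> real^6 \<Rightarrow> real^6 \<Rightarrow> real) \<Rightarrow>
   real^6 \<Rightarrow> real^6 \<Rightarrow> real" where
  "r_map g \<psi>p \<alpha> x y = 1 / 2 * form_inner g 2 (\<lambda>vs. \<alpha> x (vs ! 0) (vs ! 1)) (interior y \<psi>p)"

definition gray_hervella :: "(real^6 \<Rightarrow> real^6) \<Rightarrow> (real^6 \<Rightarrow> real^6 \<Rightarrow> real^6 \<Rightarrow> real) set" where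
  "gray_hervella I = {\<alpha>.
     (\<forall>y z. linear (\<lambda>x. \<alpha> x y z)) \<and> (\<forall>x z. linear (\<lambda>y. \<alpha> x y z)) \<and> (\<forall>x y. linear (\<alpha> x y)) \<and>
     (\<forall>x y z. \<alpha> x y z = - \<alpha> x z y \<and> \<alpha> x y z = - \<alpha> x (I y) (I z))}"

datatype torsion_class = W1p | W1m | W2p | W2m | W3 | W4 | W5

definition space_W1 :: "(real^6 \<Rightarrow> real^6) \<Rightarrow> (real^6 \<Rightarrow> real^6 \<Rightarrow> real^6 \<Rightarrow> real) set" where
  "space_W1 I = {\<alpha> \<in> gray_hervella I. \<forall>x y z. \<alpha> x y z = - \<alpha> y x z}"

definition space_W2 :: "(real^6 \<Rightarrow> real^6) \<Rightarrow> (real^6 \<Rightarrow> real^6 \<Rightarrow> real^6 \<Rightarrow> real) set" where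
  "space_W2 I = {\<alpha> \<in> gray_hervella I. \<forall>x y z. \<alpha> x y z + \<alpha> y z x + \<alpha> z x y = 0}"

definition space_W3 ::
  "(real^6 \<Rightarrow> real^6 \<Rightarrow> real) \<Rightarrow> (real^6 \<Rightarrow> real^6) \<Rightarrow> (real^6 \<Rightarrow> real^6 \<Rightarrow> real^6 \<Rightarrow> real) set" where
  "space_W3 g I = {\<alpha> \<in> gray_hervella I.
     (\<forall>x y z. \<alpha> (I x) (I y) z = \<alpha> x y z) \<and> (\<forall>z. metric_trace g (\<lambda>e e'. \<alpha> e e' z) = 0)}"

definition space_W4 ::
  "(real^6 \<Rightarrow> real^6 \<Rightarrow> real) \<Rightarrow> (real^6 \<Rightarrow> real^6) \<Rightarrow> (real^6 \<Rightarrow> real^6 \<Rightarrow> real^6 \<Rightarrow> real) set" where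
  "space_W4 g I = {\<alpha> \<in> gray_hervella I. \<exists>\<tau>. linear \<tau> \<and> (\<forall>x y z.
     \<alpha> x y z = g x y * \<tau> z - g x z * \<tau> y - g x (I y) * \<tau> (I z) + g x (I z) * \<tau> (I y))}"

definition symmetric_form :: "('e \<Rightarrow> 'e \<Rightarrow> real) \<Rightarrow> bool" where
  "symmetric_form b \<longleftrightarrow> (\<forall>x y. b x y = b y x)"

definition skew_form :: "('e \<Rightarrow> 'e \<Rightarrow> real) \<Rightarrow> bool" where
  "skew_form b \<longleftrightarrow> (\<forall>x y. b x y = - b y x)"

text \<open>The class \<open>W5\<close> does not concern \<open>\<nabla>\<omega>\<close>; it is a condition on \<open>\<eta>\<close> and has no equation here.\<close>

primrec (nonexhaustive) torsion_space ::
  "torsion_class \<Rightarrow> (real^6 \<Rightarrow> real^6 \<Rightarrow> real) \<Rightarrow> (real^6 \<Rightarrow> real^6) \<Rightarrow> (real^6) tensor \<Rightarrow>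
   (real^6 \<Rightarrow> real^6 \<Rightarrow> real^6 \<Rightarrow> real) set" where
  "torsion_space W1p g I \<psi>p = {\<alpha> \<in> space_W1 I. symmetric_form (r_map g \<psi>p \<alpha>)}"
| "torsion_space W1m g I \<psi>p = {\<alpha> \<in> space_W1 I. skew_form (r_map g \<psi>p \<alpha>)}"
| "torsion_space W2p g I \<psi>p = {\<alpha> \<in> space_W2 I. symmetric_form (r_map g \<psi>p \<alpha>)}"
| "torsion_space W2m g I \<psi>p = {\<alpha> \<in> space_W2 I. skew_form (r_map g \<psi>p \<alpha>)}"
| "torsion_space W3 g I \<psi>p = space_W3 g I"
| "torsion_space W4 g I \<psi>p = space_W4 g I"

definition torsion_component ::
  "(real^6 \<Rightarrow> real^6 \<Rightarrow> real) \<Rightarrow> (real^6 \<Rightarrow> real^6) \<Rightarrow> (real^6) tensor \<Rightarrow>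
   (real^6 \<Rightarrow> real^6 \<Rightarrow> real^6 \<Rightarrow> real) \<Rightarrow> torsion_class \<Rightarrow> real^6 \<Rightarrow> real^6 \<Rightarrow> real^6 \<Rightarrow> real" where
  "torsion_component g I \<psi>p \<alpha> w = (THE \<beta>. \<exists>part.
     (\<forall>v\<in>-{W5}. part v \<in> torsion_space v g I \<psi>p) \<and>
     (\<forall>x y z. \<alpha> x y z = (\<Sum>v\<in>-{W5}. part v x y z)) \<and> \<beta> = part w)"

definition of_type ::
  "('m, real^6) chart set \<Rightarrow> ('m \<Rightarrow> real^6 \<Rightarrow> real^6 \<Rightarrow> real) \<Rightarrow> ('m \<Rightarrow> real^6 \<Rightarrow> real^6) \<Rightarrow>
   ('m \<Rightarrow> (real^6) tensor) \<Rightarrow> ('m \<Rightarrow> (real^6) tensor) \<Rightarrow> torsion_class set \<Rightarrow> bool" where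
  "of_type A g I \<psi>p \<psi>m U \<longleftrightarrow>
     (\<forall>p. \<forall>w\<in>-{W5} - U. \<forall>x y z.
        torsion_component (g p) (I p) (\<psi>p p) (nabla_omega A g I p) w x y z = 0) \<and>
     (W5 \<notin> U \<longrightarrow> (\<forall>p x. eta A g I \<psi>p \<psi>m p x = 0))"

end

theory Submission
  imports Defs "HOL-Library.Numeral_Type" "Jordan_Normal_Form.Determinant"
begin

no_notation vec_index (infixl "$" 100)
no_notation scalar_prod (infix "\<bullet>" 70)

text \<open>Everything is computed in the components of a local adapted frame of the ambient manifold. There the
  Levi-Civita connection becomes \<open>d - \<kappa>\<close> with skew endomorphisms \<open>\<kappa>\<^sub>X\<close> of \<open>\<real>\<^sup>7\<close>, so
  \<open>\<nabla>\<^sub>X\<phi> = \<phi>(\<kappa>\<^sub>X \<cdot>, \<cdot>, \<cdot>) + \<phi>(\<cdot>, \<kappa>\<^sub>X \<cdot>, \<cdot>) + \<phi>(\<cdot>, \<cdot>, \<kappa>\<^sub>X \<cdot>)\<close>; contracting this with \<open>*\<phi>\<close> turns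
  type \<open>\<X>\<^sub>4\<close> into \<open>\<nabla>\<^sub>X\<phi> = - 1/12 *\<phi>(P(p\<^sub>\<phi>, X), \<cdot>, \<cdot>, \<cdot>)\<close>. The
  Gauss and Weingarten formulas then express \<open>\<nabla>\<omega>\<close> by the shape operator \<open>\<beta>\<close> and \<open>p\<^sub>\<phi>\<close>:
  with \<open>\<Phi> = \<iota>\<^sup>*\<phi>\<close> and \<open>k = pd\<^sup>*\<phi>(n)/12\<close>,
  \<open>\<nabla>\<omega>(x, y, z) = \<Phi>(\<beta> x, y, z) - k \<Phi>(x, y, z) + (a form in \<W>\<^sub>4 given by the tangential part of p\<^sub>\<phi>)\<close>.
  Splitting \<open>\<beta>\<close> into \<open>h\<close> times the identity, its trace-free part commuting with \<open>I\<close>, and its part anticommuting with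
  \<open>I\<close> gives the components in \<open>\<W>\<^sub>1\<close>, \<open>\<W>\<^sub>2\<close> and \<open>\<W>\<^sub>3\<close>; since
  \<open>\<Phi> = cos \<theta> \<psi>\<^sub>+ + sin \<theta> \<psi>\<^sub>-\<close>, the first two split further with factors \<open>cos \<theta>\<close> and \<open>sin \<theta>\<close>.
  The form \<open>\<eta>\<close> comes from the same computation for \<open>\<langle>\<nabla>\<psi>\<^sub>+, \<psi>\<^sub>-\<rangle>\<close>, in which the derivative of \<open>*\<phi>\<close> is never
  needed because \<open>\<kappa>\<^sub>X\<close> is skew.\<close>

section \<open>The cross product on \<open>\<real>\<^sup>7\<close>\<close>

text \<open>The adapted frame is an arbitrary local one, and neither \<open>onb\<close> nor the
  frame chosen inside \<open>star\<close> has to agree with it. Pointwise objects are therefore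
  rewritten through the inner product and \<open>cross7\<close> on frame components: these have
  constant coefficients and do not depend on the adapted frame, so a derivative falls only on the
  arguments of \<open>phi7\<close> and \<open>psi7\<close>. The main algebraic input is the value of
  *\<phi> on a cross product: it describes how so(7) moves \<phi>, restricts *\<phi> to a
  hyperplane, and produces the W4 part.

  The derivative of *\<phi> disappears for this reason: in the pairing of \<nabla>\<psi>_+ with
  \<psi>_-, the tangential block A of \<kappa> enters only through its trace against J, with a
  coefficient that is the same for every angle. At angle 0 the pairing involves \<phi> alone, so the
  equation for \<nabla>\<phi> determines that trace.

  As \<open>torsion_component\<close> is a definite description, exhibiting the pieces of
  \<nabla>\<omega> is not enough: the sum of the six classes must be shown to be direct, which rests
  on the injectivity of \<open>r_map\<close> on Gray-Hervella forms.\<close>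

lemma UNIV_7: "UNIV = {0,1,2,3,4,5,6::7}"
proof -
  have "x \<in> {0,1,2,3,4,5,6}" for x :: 7
  proof (cases x)
    case (of_int z)
    then have "z \<in> {0,1,2,3,4,5,6}" by auto
    then show ?thesis using of_int by auto
  qed
  then show ?thesis by blast
qed

lemma sum_7: "sum f (UNIV::7 set) = f 0 + f 1 + f 2 + f 3 + f 4 + f 5 + f 6"
  unfolding UNIV_7 by (simp add: ac_simps)

lemma numeral_7_simps: "(7::7) = 0" "(8::7) = 1" "(9::7) = 2" "(10::7) = 3" "(11::7) = 4" "(12::7) = 5"
  by simp_all

lemma forall_7: "(\<forall>i::7. P i) \<longleftrightarrow> P 0 \<and> P 1 \<and> P 2 \<and> P 3 \<and> P 4 \<and> P 5 \<and> P 6"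
  by (metis UNIV_7 UNIV_I empty_iff insert_iff)

text \<open>The three index pairs are the rotations of (i, i+1, i+3) that end in k: letting k be i,
  i+1 or i+3 gives (k+1, k+3), (k+2, k+6) and (k+4, k+5).\<close>

definition cross7 :: "real^7 \<Rightarrow> real^7 \<Rightarrow> real^7" where
  "cross7 x y = (\<chi> k. (x$(k+1) * y$(k+3) - x$(k+3) * y$(k+1)) +
     (x$(k+2) * y$(k+6) - x$(k+6) * y$(k+2)) + (x$(k+4) * y$(k+5) - x$(k+5) * y$(k+4)))"

definition phi7 :: "real^7 \<Rightarrow> real^7 \<Rightarrow> real^7 \<Rightarrow> real" where
  "phi7 x y z = cross7 x y \<bullet> z"

text \<open>\<open>*\<phi>\<close>, written through the double cross product instead of its seven monomials.\<close>

definition psi7 :: "real^7 \<Rightarrow> real^7 \<Rightarrow> real^7 \<Rightarrow> real^7 \<Rightarrow> real" where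
  "psi7 x y z w = (x \<bullet> z) * (y \<bullet> w) - (x \<bullet> w) * (y \<bullet> z) - cross7 x y \<bullet> cross7 z w"

lemma bilinear_cross7: "bilinear cross7"
  unfolding bilinear_def cross7_def
  by (auto intro!: linearI simp: Finite_Cartesian_Product.vec_eq_iff algebra_simps)

lemma bounded_bilinear_cross7: "bounded_bilinear cross7"
  using bilinear_cross7 bilinear_conv_bounded_bilinear by blast

lemmas cross7_bilinear_simps =
  bounded_bilinear.add_left[OF bounded_bilinear_cross7] bounded_bilinear.add_right[OF bounded_bilinear_cross7]
  bounded_bilinear.diff_left[OF bounded_bilinear_cross7] bounded_bilinear.diff_right[OF bounded_bilinear_cross7]
  bounded_bilinear.minus_left[OF bounded_bilinear_cross7] bounded_bilinear.minus_right[OF bounded_bilinear_cross7]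
  bounded_bilinear.scaleR_left[OF bounded_bilinear_cross7] bounded_bilinear.scaleR_right[OF bounded_bilinear_cross7]
  bounded_bilinear.zero_left[OF bounded_bilinear_cross7] bounded_bilinear.zero_right[OF bounded_bilinear_cross7]

lemma cross7_skew: "cross7 x y = - cross7 y x"
  by (simp add: cross7_def Finite_Cartesian_Product.vec_eq_iff)

lemma inner_7: "(x::real^7) \<bullet> y = x$0*y$0 + x$1*y$1 + x$2*y$2 + x$3*y$3 + x$4*y$4 + x$5*y$5 + x$6*y$6"
  by (simp add: inner_vec_def sum_7)

lemma phi7_cycle: "phi7 x y z = phi7 y z x"
  unfolding phi7_def inner_7 by (simp add: cross7_def numeral_7_simps algebra_simps)

lemma phi7_skew12: "phi7 x y z = - phi7 y x z"
  unfolding phi7_def by (subst cross7_skew) simp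

lemma phi7_skew23: "phi7 x y z = - phi7 x z y"
  by (metis phi7_cycle phi7_skew12)

lemma cross7_cross7: "cross7 x (cross7 x y) = (x \<bullet> y) *\<^sub>R x - (x \<bullet> x) *\<^sub>R y"
  unfolding Finite_Cartesian_Product.vec_eq_iff forall_7
  by (intro conjI; simp add: inner_7 cross7_def numeral_7_simps algebra_simps)

text \<open>Only x and y are placed on axes, which leaves 49 polynomial identities in which a, b and
  c stay arbitrary.\<close>

lemma psi7_cross7_axis:
  "psi7 a b c (cross7 (axis s 1) (axis t 1)) =
     (axis s 1 \<bullet> a) * phi7 (axis t 1) b c + (axis s 1 \<bullet> b) * phi7 a (axis t 1) c
   + (axis s 1 \<bullet> c) * phi7 a b (axis t 1) - (axis t 1 \<bullet> a) * phi7 (axis s 1) b c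
   - (axis t 1 \<bullet> b) * phi7 a (axis s 1) c - (axis t 1 \<bullet> c) * phi7 a b (axis s 1)"
proof -
  have "\<forall>s t. psi7 a b c (cross7 (axis s 1) (axis t 1)) =
     a$s * phi7 (axis t 1) b c + b$s * phi7 a (axis t 1) c + c$s * phi7 a b (axis t 1)
   - a$t * phi7 (axis s 1) b c - b$t * phi7 a (axis s 1) c - c$t * phi7 a b (axis s 1)"
    unfolding forall_7
    by (intro conjI; simp add: psi7_def phi7_def inner_7 cross7_def axis_def numeral_7_simps;
        simp add: algebra_simps)
  then show ?thesis by (simp add: inner_axis')
qed

text \<open>The right-hand side is the action on \<open>phi7\<close> of the skew endomorphism a
  \<mapsto> (x \<bullet> a) y - (y \<bullet> a) x. So such an infinitesimal rotation moves \<phi>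
  only through the vector \<open>cross7 x y\<close>.\<close>

lemma psi7_cross7:
  "psi7 a b c (cross7 x y) =
     (x \<bullet> a) * phi7 y b c + (x \<bullet> b) * phi7 a y c + (x \<bullet> c) * phi7 a b y
   - (y \<bullet> a) * phi7 x b c - (y \<bullet> b) * phi7 a x c - (y \<bullet> c) * phi7 a b x"
proof -
  let ?f = "\<lambda>x y. psi7 a b c (cross7 x y)"
  let ?g = "\<lambda>x y. (x \<bullet> a) * phi7 y b c + (x \<bullet> b) * phi7 a y c + (x \<bullet> c) * phi7 a b y
   - (y \<bullet> a) * phi7 x b c - (y \<bullet> b) * phi7 a x c - (y \<bullet> c) * phi7 a b x"
  have "?f = ?g"
  proof (rule bilinear_eq_stdbasis)
    show "bilinear ?f"
      unfolding bilinear_def psi7_def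
      by (auto intro!: linearI simp: cross7_bilinear_simps inner_simps algebra_simps)
    show "bilinear ?g"
      unfolding bilinear_def phi7_def
      by (auto intro!: linearI simp: cross7_bilinear_simps inner_simps algebra_simps)
  qed (auto simp: Basis_vec_def psi7_cross7_axis)
  then show ?thesis by metis
qed

section \<open>Inner products and their orthonormal bases\<close>

locale inner_form =
  fixes g :: "'e::euclidean_space \<Rightarrow> 'e \<Rightarrow> real"
  assumes bilinear: "bilinear g" and sym: "g x y = g y x" and pos: "x \<noteq> 0 \<Longrightarrow> g x x > 0"
begin

lemma bounded_bilinear: "bounded_bilinear g"
  using bilinear bilinear_conv_bounded_bilinear by blast

lemmas simps =
  bounded_bilinear.add_left[OF bounded_bilinear] bounded_bilinear.add_right[OF bounded_bilinear]
  bounded_bilinear.diff_left[OF bounded_bilinear] bounded_bilinear.diff_right[OF bounded_bilinear]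
  bounded_bilinear.minus_left[OF bounded_bilinear] bounded_bilinear.minus_right[OF bounded_bilinear]
  bounded_bilinear.scaleR_left[OF bounded_bilinear] bounded_bilinear.scaleR_right[OF bounded_bilinear]
  bounded_bilinear.zero_left[OF bounded_bilinear] bounded_bilinear.zero_right[OF bounded_bilinear]
  bounded_bilinear.sum_left[OF bounded_bilinear] bounded_bilinear.sum_right[OF bounded_bilinear]

lemma linear_left: "linear (\<lambda>x. g x y)" and linear_right: "linear (g x)"
  using bilinear by (auto simp: bilinear_def)

lemma eq_zero_iff: "g x x = 0 \<longleftrightarrow> x = 0"
  using pos[of x] by (cases "x = 0") (auto simp: simps)

lemma eqI: "x = y" if "\<And>z. g x z = g y z"
proof -
  have "g (x - y) (x - y) = 0" using that[of "x - y"] by (simp add: simps)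
  then show ?thesis by (simp add: eq_zero_iff)
qed

definition orthonormal :: "'e set \<Rightarrow> bool" where
  "orthonormal E \<longleftrightarrow> finite E \<and> (\<forall>x\<in>E. \<forall>y\<in>E. g x y = (if x = y then 1 else 0))"

lemma orthonormal_sum:
  assumes "orthonormal E" "x \<in> E"
  shows "(\<Sum>e\<in>E. c e * g e x) = c x"
proof -
  have "(\<Sum>e\<in>E. c e * g e x) = (\<Sum>e\<in>E. if e = x then c e else 0)"
    using assms by (intro sum.cong) (auto simp: orthonormal_def)
  then show ?thesis using assms by (simp add: orthonormal_def)
qed

lemma orthonormal_independent:
  assumes "orthonormal E"
  shows "independent E"
proof
  assume "dependent E"
  then obtain u v where uv: "v \<in> E" "u v \<noteq> 0" "(\<Sum>v\<in>E. u v *\<^sub>R v) = 0"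
    using assms dependent_finite[of E] by (auto simp: orthonormal_def)
  have "u v = (\<Sum>e\<in>E. u e * g e v)"
    using orthonormal_sum[OF assms uv(1)] by metis
  also have "\<dots> = g (\<Sum>e\<in>E. u e *\<^sub>R e) v" by (simp add: simps)
  finally show False using uv by (simp add: simps)
qed

text \<open>One Gram-Schmidt step: a vector outside the span, minus its projection,
  normalised.\<close>

lemma orthonormal_extend:
  assumes E: "orthonormal E" and lt: "card E < DIM('e)"
  obtains y where "orthonormal (insert y E)" "y \<notin> E"
proof -
  have "span E \<noteq> UNIV"
  proof
    assume "span E = UNIV"
    then have "DIM('e) \<le> card E"
      using E by (metis dim_UNIV dim_le_card orthonormal_def dual_order.refl dim_span)
    then show False using lt by simp
  qed
  then obtain x where x: "x \<notin> span E" by blast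
  define w where "w = x - (\<Sum>e\<in>E. g x e *\<^sub>R e)"
  have "w \<noteq> 0"
  proof
    assume "w = 0"
    then have "x = (\<Sum>e\<in>E. g x e *\<^sub>R e)" by (simp add: w_def)
    moreover have "\<dots> \<in> span E" by (intro span_sum span_scale span_base)
    ultimately show False using x by simp
  qed
  have orth: "g w e = 0" if "e \<in> E" for e
    using orthonormal_sum[OF E that, of "g x"] by (simp add: w_def simps)
  define y where "y = (1 / sqrt (g w w)) *\<^sub>R w"
  have "g w w > 0" by (rule pos) fact
  then have yy: "g y y = 1" by (simp add: y_def simps field_simps)
  have ye: "g y e = 0" "g e y = 0" if "e \<in> E" for e
    using orth[OF that] sym[of w e] by (auto simp: y_def simps)
  have "y \<notin> E" using ye yy by force
  moreover have "orthonormal (insert y E)"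
    using E yy ye \<open>y \<notin> E\<close> by (auto simp: orthonormal_def)
  ultimately show ?thesis using that by blast
qed

text \<open>\<open>onb\<close> is a choice, so it says nothing until an orthonormal basis is known
  to exist for every inner product.\<close>

lemma orthonormal_exists: "\<exists>E. orthonormal E \<and> card E = DIM('e)"
proof -
  have "\<exists>E. orthonormal E \<and> card E = k" if "k \<le> DIM('e)" for k
    using that
  proof (induction k)
    case 0
    show ?case by (rule exI[of _ "{}"]) (simp add: orthonormal_def)
  next
    case (Suc k)
    then obtain E where E: "orthonormal E" "card E = k" by auto
    have "card E < DIM('e)" using E Suc.prems by simp
    with E obtain y where "orthonormal (insert y E)" "y \<notin> E"
      using orthonormal_extend by blast
    then show ?case using E by (intro exI[of _ "insert y E"]) (auto simp: orthonormal_def)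
  qed
  then show ?thesis by blast
qed

lemma onb: "orthonormal (onb g)" "card (onb g) = DIM('e)"
proof -
  have "\<exists>E. finite E \<and> card E = DIM('e) \<and> (\<forall>x\<in>E. \<forall>y\<in>E. g x y = (if x = y then 1 else 0))"
    using orthonormal_exists by (auto simp: orthonormal_def)
  from someI_ex[OF this]
  have "finite (onb g) \<and> card (onb g) = DIM('e) \<and>
      (\<forall>x\<in>onb g. \<forall>y\<in>onb g. g x y = (if x = y then 1 else 0))"
    unfolding onb_def .
  then show "orthonormal (onb g)" "card (onb g) = DIM('e)"
    unfolding orthonormal_def by blast+
qed

lemma finite_onb: "finite (onb g)"
  using onb(1) by (simp add: orthonormal_def)

lemma orthonormal_expansion:
  assumes E: "orthonormal E" "card E = DIM('e)"
  shows "(\<Sum>e\<in>E. g x e *\<^sub>R e) = x"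
proof -
  have fin: "finite E" using E(1) by (simp add: orthonormal_def)
  have "UNIV \<subseteq> span E"
    by (rule card_ge_dim_independent)
       (use orthonormal_independent[OF E(1)] E in \<open>auto simp: dim_UNIV\<close>)
  then have "x \<in> range (\<lambda>c. \<Sum>e\<in>E. c e *\<^sub>R e)"
    unfolding span_finite[OF fin] by blast
  then obtain c where c: "x = (\<Sum>e\<in>E. c e *\<^sub>R e)" by blast
  have coeff: "g x f = c f" if "f \<in> E" for f
  proof -
    have "g x f = (\<Sum>e\<in>E. c e * g e f)"
      unfolding c by (simp add: simps)
    also have "\<dots> = c f" by (rule orthonormal_sum[OF E(1) that])
    finally show ?thesis .
  qed
  have "(\<Sum>e\<in>E. g x e *\<^sub>R e) = (\<Sum>e\<in>E. c e *\<^sub>R e)"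
    by (rule sum.cong) (simp_all only: coeff)
  also have "\<dots> = x" by (rule c[symmetric])
  finally show ?thesis .
qed

lemma orthonormal_parseval:
  assumes E: "orthonormal E" "card E = DIM('e)"
  shows "(\<Sum>e\<in>E. g x e * g y e) = g x y"
proof -
  have "g x y = g (\<Sum>e\<in>E. g x e *\<^sub>R e) y" by (simp add: orthonormal_expansion[OF E])
  then show ?thesis by (simp add: simps sym)
qed

lemmas onb_expansion = orthonormal_expansion[OF onb]

lemmas onb_parseval = orthonormal_parseval[OF onb]

lemma linear_onb_sum:
  assumes "linear f"
  shows "(\<Sum>e\<in>onb g. g x e * f e) = f x"
proof -
  have "f x = f (\<Sum>e\<in>onb g. g x e *\<^sub>R e)" by (simp add: onb_expansion)
  also have "\<dots> = (\<Sum>e\<in>onb g. g x e * f e)"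
    using assms by (simp add: linear_sum linear_scale)
  finally show ?thesis by simp
qed

lemma representation:
  assumes "linear f"
  obtains v where "\<And>x. g v x = f x"
proof
  fix x
  show "g (\<Sum>e\<in>onb g. f e *\<^sub>R e) x = f x"
    using linear_onb_sum[OF assms, of x] by (simp add: simps sym mult.commute)
qed

lemma sharp: 
  assumes "linear f"
  shows "g (sharp g f) x = f x"
proof -
  obtain v where v: "\<And>x. g v x = f x" using representation[OF assms] by blast
  have "\<exists>!v. \<forall>x. g v x = f x"
  proof (rule ex1I[of _ v])
    fix w assume w: "\<forall>x. g w x = f x"
    show "w = v" by (rule eqI) (simp add: v w)
  qed (simp add: v)
  from theI'[OF this] show ?thesis unfolding sharp_def by blast
qed

end

text \<open>Splits off the first vector, which turns the sum over lists in \<open>form_inner\<close>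
  into nested sums over a basis.\<close>

lemma sum_lists_Suc:
  fixes E :: "'a set" and F :: "'a list \<Rightarrow> real"
  assumes "finite E"
  shows "(\<Sum>vs | set vs \<subseteq> E \<and> length vs = Suc k. F vs) =
    (\<Sum>e\<in>E. \<Sum>vs | set vs \<subseteq> E \<and> length vs = k. F (e # vs))"
proof -
  let ?L = "\<lambda>k. {vs. set vs \<subseteq> E \<and> length vs = k}"
  have "(\<Sum>e\<in>E. \<Sum>vs\<in>?L k. F (e # vs)) = (\<Sum>(e, vs)\<in>E \<times> ?L k. F (e # vs))"
    by (rule sum.cartesian_product)
  also have "\<dots> = sum F ((\<lambda>(e, vs). e # vs) ` (E \<times> ?L k))"
    by (subst sum.reindex) (auto simp: inj_on_def case_prod_unfold)
  also have "(\<lambda>(e, vs). e # vs) ` (E \<times> ?L k) = ?L (Suc k)"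
  proof (intro equalityI subsetI)
    fix us assume "us \<in> ?L (Suc k)"
    then show "us \<in> (\<lambda>(e, vs). e # vs) ` (E \<times> ?L k)"
      by (cases us) auto
  qed auto
  finally show ?thesis by (rule HOL.sym)
qed

lemma sum_lists_0: "(\<Sum>vs | set vs \<subseteq> E \<and> length vs = 0. F vs) = F []"
proof -
  have *: "{vs. set vs \<subseteq> E \<and> length vs = 0} = {[]}" by auto
  show ?thesis unfolding * by simp
qed

lemma form_inner_2:
  assumes "finite (onb g)"
  shows "form_inner g 2 \<alpha> \<beta> = (\<Sum>e\<in>onb g. \<Sum>f\<in>onb g. \<alpha> [e, f] * \<beta> [e, f]) / 2"
  unfolding form_inner_def numeral_2_eq_2 sum_lists_Suc[OF assms] sum_lists_0 by simp

lemma form_inner_3: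
  assumes "finite (onb g)"
  shows "form_inner g 3 \<alpha> \<beta> = (\<Sum>e\<in>onb g. \<Sum>f\<in>onb g. \<Sum>k\<in>onb g. \<alpha> [e, f, k] * \<beta> [e, f, k]) / 6"
  unfolding form_inner_def numeral_3_eq_3 sum_lists_Suc[OF assms] sum_lists_0 by (simp add: fact_numeral)

section \<open>The torsion classes on a six-dimensional Hermitian vector space\<close>

text \<open>An abstract SU(3)-structure. With skewness, \<open>\<Phi>_J\<close> says that \<Phi> is
  the real part of a complex trilinear form, that is, of type (3,0)+(0,3);
  \<open>\<Phi>_contract\<close> fixes its size.\<close>

locale su3 = inner_form G for G :: "real^6 \<Rightarrow> real^6 \<Rightarrow> real" +
  fixes J :: "real^6 \<Rightarrow> real^6" and \<Phi> :: "real^6 \<Rightarrow> real^6 \<Rightarrow> real^6 \<Rightarrow> real"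
  assumes linear_J: "linear J" and JJ: "J (J x) = - x" and GJJ: "G (J x) (J y) = G x y"
    and linear_\<Phi>: "linear (\<Phi> x y)"
    and \<Phi>_cycle: "\<Phi> x y z = \<Phi> y z x" and \<Phi>_skew: "\<Phi> x y z = - \<Phi> y x z"
    and \<Phi>_J: "\<Phi> (J x) y z = \<Phi> x (J y) z"
    and \<Phi>_contract: "(\<Sum>e\<in>onb G. \<Phi> x y e * \<Phi> z w e) =
      G x z * G y w - G x w * G y z - G x (J z) * G y (J w) + G x (J w) * G y (J z)"
begin

lemmas J_simps = linear_add[OF linear_J] linear_diff[OF linear_J] linear_scale[OF linear_J]
  linear_neg[OF linear_J] linear_0[OF linear_J]

lemma linear_\<Phi>1: "linear (\<lambda>x. \<Phi> x y z)"
proof -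
  have "(\<lambda>x. \<Phi> x y z) = \<Phi> y z" using \<Phi>_cycle by fastforce
  then show ?thesis by (simp add: linear_\<Phi>)
qed

lemma linear_\<Phi>2: "linear (\<lambda>y. \<Phi> x y z)"
proof -
  have "(\<lambda>y. \<Phi> x y z) = (\<lambda>y. \<Phi> y z x)" using \<Phi>_cycle by fastforce
  then show ?thesis by (simp add: linear_\<Phi>1)
qed

lemmas \<Phi>_simps =
  linear_add[OF linear_\<Phi>] linear_diff[OF linear_\<Phi>] linear_scale[OF linear_\<Phi>]
  linear_neg[OF linear_\<Phi>] linear_0[OF linear_\<Phi>]
  linear_add[OF linear_\<Phi>1] linear_diff[OF linear_\<Phi>1] linear_scale[OF linear_\<Phi>1]
  linear_neg[OF linear_\<Phi>1] linear_0[OF linear_\<Phi>1]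
  linear_add[OF linear_\<Phi>2] linear_diff[OF linear_\<Phi>2] linear_scale[OF linear_\<Phi>2]
  linear_neg[OF linear_\<Phi>2] linear_0[OF linear_\<Phi>2]

lemma \<Phi>_skew23: "\<Phi> x y z = - \<Phi> x z y"
  by (metis \<Phi>_cycle \<Phi>_skew)

lemma GJ: "G x (J y) = - G (J x) y"
proof -
  have "G (J x) y = - G (J x) (J (J y))" by (simp add: JJ simps)
  then show ?thesis by (simp add: GJJ)
qed

lemma GJ_self: "G x (J x) = 0"
  using GJ[of x x] sym[of x "J x"] by simp

lemma \<Phi>_J13: "\<Phi> (J x) y z = \<Phi> x y (J z)"
  by (metis \<Phi>_J \<Phi>_cycle)

lemma \<Phi>_JJ: "\<Phi> x (J y) (J z) = - \<Phi> x y z"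
  by (metis \<Phi>_J \<Phi>_J13 JJ \<Phi>_simps(4))

lemma double_onb_sum:
  assumes "\<And>y. linear (\<lambda>x. \<beta> x y)" "\<And>x. linear (\<beta> x)"
  shows "(\<Sum>e\<in>onb G. \<Sum>f\<in>onb G. \<beta> e f * (G e v * G f w)) = \<beta> v w"
proof -
  have "(\<Sum>e\<in>onb G. \<Sum>f\<in>onb G. \<beta> e f * (G e v * G f w)) =
    (\<Sum>e\<in>onb G. G v e * (\<Sum>f\<in>onb G. G w f * \<beta> e f))"
    by (simp add: sum_distrib_left sym[of _ v] sym[of _ w] mult_ac)
  also have "\<dots> = \<beta> v w"
    by (simp add: linear_onb_sum assms)
  finally show ?thesis .
qed

lemma \<Phi>_contract2: "(\<Sum>e\<in>onb G. \<Sum>f\<in>onb G. \<Phi> x e f * \<Phi> y e f) = 4 * G x y"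
proof -
  have *: "G e e = 1" if "e \<in> onb G" for e
    using onb(1) that by (auto simp: orthonormal_def)
  have "(\<Sum>e\<in>onb G. \<Sum>f\<in>onb G. \<Phi> x e f * \<Phi> y e f) =
    (\<Sum>e\<in>onb G. G x y * G e e - G x e * G y e - G (J x) e * G (J y) e)"
    unfolding \<Phi>_contract
  proof (rule sum.cong[OF refl])
    fix e
    show "G x y * G e e - G x e * G e y - G x (J y) * G e (J e) + G x (J e) * G e (J y) =
      G x y * G e e - G x e * G y e - G (J x) e * G (J y) e"
      unfolding GJ_self GJ[of x e] sym[of e y] sym[of e "J y"] by simp
  qed
  \<comment> \<open>The norms of the six basis vectors add up to 6, and each of the two Parseval
    sums removes 1.\<close>
  also have "\<dots> = 4 * G x y"
    by (simp add: sum_subtractf onb_parseval GJJ * onb)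
  finally show ?thesis .
qed

lemma \<Phi>_eq_zeroD:
  assumes "\<And>y z. \<Phi> x y z = 0"
  shows "x = 0"
  using \<Phi>_contract2[of x x] by (simp add: assms eq_zero_iff)

text \<open>On skew forms that change sign under J, pairing with \<Phi> and then contracting with
  \<Phi> again is multiplication by 4, because the four terms of \<open>\<Phi>_contract\<close> all
  become \<beta>(v, w). A form with zero pairing therefore vanishes.\<close>

lemma \<Phi>_skew_pairing_inj:
  assumes "\<And>y. linear (\<lambda>x. \<beta> x y)" "\<And>x. linear (\<beta> x)"
    and skew: "\<And>x y. \<beta> x y = - \<beta> y x" and J: "\<And>x y. \<beta> (J x) (J y) = - \<beta> x y"
    and zero: "\<And>y. (\<Sum>e\<in>onb G. \<Sum>f\<in>onb G. \<beta> e f * \<Phi> y e f) = 0"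
  shows "\<beta> v w = 0"
proof -
  let ?S = "\<lambda>h. \<Sum>e\<in>onb G. \<Sum>f\<in>onb G. \<beta> e f * h e f"
  have "0 = (\<Sum>k\<in>onb G. \<Phi> k v w * ?S (\<Phi> k))"
    by (simp add: zero)
  also have "\<dots> = (\<Sum>k\<in>onb G. \<Sum>e\<in>onb G. \<Sum>f\<in>onb G. \<beta> e f * (\<Phi> e f k * \<Phi> v w k))"
    by (simp add: sum_distrib_left mult_ac \<Phi>_cycle[symmetric])
  also have "\<dots> = (\<Sum>e\<in>onb G. \<Sum>k\<in>onb G. \<Sum>f\<in>onb G. \<beta> e f * (\<Phi> e f k * \<Phi> v w k))"
    by (rule sum.swap)
  also have "\<dots> = (\<Sum>e\<in>onb G. \<Sum>f\<in>onb G. \<Sum>k\<in>onb G. \<beta> e f * (\<Phi> e f k * \<Phi> v w k))"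
    by (intro sum.cong refl sum.swap)
  also have "\<dots> = ?S (\<lambda>e f. \<Sum>k\<in>onb G. \<Phi> e f k * \<Phi> v w k)"
    by (simp add: sum_distrib_left)
  also have "\<dots> = ?S (\<lambda>e f. G e v * G f w) - ?S (\<lambda>e f. G e w * G f v)
      - ?S (\<lambda>e f. G e (J v) * G f (J w)) + ?S (\<lambda>e f. G e (J w) * G f (J v))"
    unfolding \<Phi>_contract by (simp add: algebra_simps sum.distrib sum_subtractf)
  also have "\<dots> = \<beta> v w - \<beta> w v - \<beta> (J v) (J w) + \<beta> (J w) (J v)"
    by (simp add: double_onb_sum assms(1,2))
  also have "\<dots> = 4 * \<beta> v w"
    using skew[of v w] by (simp add: J)
  finally show ?thesis by simp
qed

section \<open>The Gray-Hervella classes and their behaviour under J\<close>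

lemma gray_hervellaD:
  assumes "\<alpha> \<in> gray_hervella J"
  shows "linear (\<lambda>x. \<alpha> x y z)" "linear (\<lambda>y. \<alpha> x y z)" "linear (\<alpha> x y)"
    "\<alpha> x y z = - \<alpha> x z y" "\<alpha> x (J y) (J z) = - \<alpha> x y z"
proof -
  have "\<alpha> x y z = - \<alpha> x (J y) (J z)" "\<alpha> x y z = - \<alpha> x z y"
    using assms unfolding gray_hervella_def mem_Collect_eq by blast+
  then show "\<alpha> x y z = - \<alpha> x z y" "\<alpha> x (J y) (J z) = - \<alpha> x y z" by linarith+
qed (use assms in \<open>unfold gray_hervella_def mem_Collect_eq, blast+\<close>)

lemma gray_hervella_shift:
  assumes "\<alpha> \<in> gray_hervella J"
  shows "\<alpha> x (J y) z = \<alpha> x y (J z)"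
proof -
  have "\<alpha> x (J (J y)) (J z) = - \<alpha> x (J y) z"
    by (rule gray_hervellaD(5)[OF assms])
  then show ?thesis
    using linear_neg[OF gray_hervellaD(2)[OF assms, of x "J z"], of y] by (simp add: JJ)
qed

lemma gray_hervella_diff:
  assumes "\<alpha> \<in> gray_hervella J" "\<beta> \<in> gray_hervella J"
  shows "(\<lambda>x y z. \<alpha> x y z - \<beta> x y z) \<in> gray_hervella J"
proof -
  have "\<alpha> x y z - \<beta> x y z = - (\<alpha> x z y - \<beta> x z y)"
    "\<alpha> x y z - \<beta> x y z = - (\<alpha> x (J y) (J z) - \<beta> x (J y) (J z))" for x y z
    using assms[THEN gray_hervellaD(4), of x y z] assms[THEN gray_hervellaD(5), of x y z] by linarith+
  then show ?thesis
    unfolding gray_hervella_def mem_Collect_eq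
    by (intro conjI allI) (rule linear_compose_sub assms[THEN gray_hervellaD(1)]
          assms[THEN gray_hervellaD(2)] assms[THEN gray_hervellaD(3)] | blast)+
qed

text \<open>The sign of \<alpha> under J in the first two slots is -1 on W1 and W2 and +1 on W3 and
  W4; this separates the two halves of the decomposition.\<close>

lemma W1_J:
  assumes "\<alpha> \<in> space_W1 J"
  shows "\<alpha> (J x) (J y) z = - \<alpha> x y z"
proof -
  have gh: "\<alpha> \<in> gray_hervella J" and sk: "\<And>x y z. \<alpha> x y z = - \<alpha> y x z"
    using assms unfolding space_W1_def by blast+
  have "\<alpha> (J x) (J y) z = \<alpha> z (J x) (J y)"
    using sk[of "J x" z "J y"] gray_hervellaD(4)[OF gh, of "J x" "J y" z] by linarith
  also have "\<dots> = - \<alpha> z x y" by (rule gray_hervellaD(5)[OF gh])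
  also have "\<dots> = - \<alpha> x y z"
    using sk[of x z y] gray_hervellaD(4)[OF gh, of x y z] by linarith
  finally show ?thesis .
qed

lemma W2_J:
  assumes "\<alpha> \<in> space_W2 J"
  shows "\<alpha> (J x) (J y) z = - \<alpha> x y z"
proof -
  have gh: "\<alpha> \<in> gray_hervella J" and cyc: "\<And>x y z. \<alpha> x y z + \<alpha> y z x + \<alpha> z x y = 0"
    using assms unfolding space_W2_def by blast+
  \<comment> \<open>The cyclic sum at (J x, J y, z) gives this relation. Its three rotations form a
    linear system for \<alpha>(J x, J y, z) and its rotations, solved below with the cyclic sum at
    (x, y, z).\<close>
  have "\<alpha> (J x) (J y) z + \<alpha> (J y) (J z) x = \<alpha> z x y" for x y z
    using cyc[of "J x" "J y" z] gray_hervellaD(5)[OF gh, of z x y]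
      gray_hervella_shift[OF gh, of "J y" z x] by linarith
  from this[of x y z] this[of y z x] this[of z x y] show ?thesis
    using cyc[of x y z] by linarith
qed

lemma W3_J: "\<alpha> \<in> space_W3 G J \<Longrightarrow> \<alpha> (J x) (J y) z = \<alpha> x y z"
  by (simp add: space_W3_def)

definition W4_form :: "(real^6 \<Rightarrow> real) \<Rightarrow> real^6 \<Rightarrow> real^6 \<Rightarrow> real^6 \<Rightarrow> real" where
  "W4_form \<tau> x y z = G x y * \<tau> z - G x z * \<tau> y - G x (J y) * \<tau> (J z) + G x (J z) * \<tau> (J y)"

lemma W4_form_J:
  assumes "linear \<tau>"
  shows "W4_form \<tau> (J x) (J y) z = W4_form \<tau> x y z"
proof -
  have *: "G (J x) (J (J y)) = G x (J y)" "G (J x) z = - G x (J z)"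
    by (rule GJJ) (simp only: GJ minus_minus)
  show ?thesis
    unfolding W4_form_def * unfolding GJJ JJ linear_neg[OF assms] by simp
qed

text \<open>The trace recovers \<tau>: the first term gives 6, the two Parseval sums take away 1
  each. This separates W4 from the trace-free class W3.\<close>

lemma W4_form_trace:
  assumes "linear \<tau>"
  shows "(\<Sum>e\<in>onb G. W4_form \<tau> e e z) = 4 * \<tau> z"
proof -
  have *: "G e e = 1" if "e \<in> onb G" for e
    using onb(1) that by (auto simp: orthonormal_def)
  have "linear (\<lambda>e. \<tau> (J e))"
    using linear_compose[OF linear_J assms] by (simp add: o_def)
  note L = linear_onb_sum[OF assms] linear_onb_sum[OF this]
  have "(\<Sum>e\<in>onb G. W4_form \<tau> e e z) =
    (\<Sum>e\<in>onb G. G e e * \<tau> z - G z e * \<tau> e + G (J z) e * \<tau> (J e))"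
    by (intro sum.cong refl) (simp add: W4_form_def GJ_self sym[of _ z] sym[of _ "J z"])
  also have "\<dots> = 4 * \<tau> z"
    by (simp add: sum.distrib sum_subtractf L * onb JJ linear_neg[OF assms])
  finally show ?thesis .
qed

lemma W4_form_in_W4:
  assumes "linear \<tau>"
  shows "W4_form \<tau> \<in> space_W4 G J"
proof -
  have \<tau>J: "linear (\<lambda>e. \<tau> (J e))" and GJ': "linear (\<lambda>e. G x (J e))" for x
    using linear_compose[OF linear_J assms] linear_compose[OF linear_J linear_right[of x]]
    by (simp_all add: o_def)
  have "linear (\<lambda>x. W4_form \<tau> x y z)" "linear (\<lambda>y. W4_form \<tau> x y z)" "linear (W4_form \<tau> x y)" for x y z
    unfolding W4_form_def
    by (auto intro!: linearI simp: simps J_simps linear_add[OF assms] linear_scale[OF assms] algebra_simps)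
  moreover have "W4_form \<tau> x y z = - W4_form \<tau> x z y \<and> W4_form \<tau> x y z = - W4_form \<tau> x (J y) (J z)" for x y z
    unfolding W4_form_def by (simp add: JJ simps linear_neg[OF assms])
  ultimately show ?thesis
    unfolding space_W4_def gray_hervella_def mem_Collect_eq using assms
    unfolding W4_form_def by blast
qed

lemma W4_E:
  assumes "\<alpha> \<in> space_W4 G J"
  obtains \<tau> where "linear \<tau>" "\<alpha> = W4_form \<tau>"
proof -
  from assms obtain \<tau> where "linear \<tau>" "\<forall>x y z. \<alpha> x y z = W4_form \<tau> x y z"
    unfolding space_W4_def W4_form_def by blast
  then show ?thesis using that by blast
qed

lemma metric_trace_diff:
  "metric_trace G (\<lambda>e e'. b e e' - c e e') = metric_trace G b - metric_trace G c"
  by (simp add: metric_trace_def sum_subtractf)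

lemma r_map_diff:
  "r_map G \<psi> (\<lambda>x y z. \<alpha> x y z - \<beta> x y z) u v = r_map G \<psi> \<alpha> u v - r_map G \<psi> \<beta> u v"
  by (simp add: r_map_def form_inner_def left_diff_distrib sum_subtractf diff_divide_distrib)

lemma space_W1_diff:
  assumes "\<alpha> \<in> space_W1 J" "\<beta> \<in> space_W1 J"
  shows "(\<lambda>x y z. \<alpha> x y z - \<beta> x y z) \<in> space_W1 J"
proof -
  have "\<alpha> x y z - \<beta> x y z = - (\<alpha> y x z - \<beta> y x z)" for x y z
    using assms unfolding space_W1_def mem_Collect_eq by (metis minus_diff_commute minus_diff_minus)
  then show ?thesis
    using assms gray_hervella_diff[of \<alpha> \<beta>] unfolding space_W1_def mem_Collect_eq by blast
qed

lemma space_W2_diff: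
  assumes "\<alpha> \<in> space_W2 J" "\<beta> \<in> space_W2 J"
  shows "(\<lambda>x y z. \<alpha> x y z - \<beta> x y z) \<in> space_W2 J"
proof -
  have "\<alpha> x y z + \<alpha> y z x + \<alpha> z x y = 0" "\<beta> x y z + \<beta> y z x + \<beta> z x y = 0" for x y z
    using assms unfolding space_W2_def mem_Collect_eq by blast+
  then have "(\<alpha> x y z - \<beta> x y z) + (\<alpha> y z x - \<beta> y z x) + (\<alpha> z x y - \<beta> z x y) = 0" for x y z
    by (smt (verit))
  then show ?thesis
    using assms gray_hervella_diff[of \<alpha> \<beta>] unfolding space_W2_def mem_Collect_eq by blast
qed

lemma space_W3_diff:
  assumes "\<alpha> \<in> space_W3 G J" "\<beta> \<in> space_W3 G J"
  shows "(\<lambda>x y z. \<alpha> x y z - \<beta> x y z) \<in> space_W3 G J"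
  using assms gray_hervella_diff[of \<alpha> \<beta>] unfolding space_W3_def mem_Collect_eq
  by (simp add: metric_trace_diff)

lemma space_W4_diff:
  assumes "\<alpha> \<in> space_W4 G J" "\<beta> \<in> space_W4 G J"
  shows "(\<lambda>x y z. \<alpha> x y z - \<beta> x y z) \<in> space_W4 G J"
proof -
  obtain \<tau> \<tau>' where *: "linear \<tau>" "linear \<tau>'" "\<alpha> = W4_form \<tau>" "\<beta> = W4_form \<tau>'"
    using assms by (auto elim!: W4_E)
  then have "(\<lambda>x y z. \<alpha> x y z - \<beta> x y z) = W4_form (\<lambda>z. \<tau> z - \<tau>' z)"
    unfolding *(3,4) by (intro ext) (simp add: W4_form_def algebra_simps)
  moreover have "linear (\<lambda>z. \<tau> z - \<tau>' z)" using * by (intro linear_compose_sub)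
  ultimately show ?thesis using W4_form_in_W4 by simp
qed

text \<open>Closure under differences reduces uniqueness of the decomposition to that of the zero
  form.\<close>

lemma torsion_space_diff:
  assumes "w \<noteq> W5" "\<alpha> \<in> torsion_space w G J \<psi>" "\<beta> \<in> torsion_space w G J \<psi>"
  shows "(\<lambda>x y z. \<alpha> x y z - \<beta> x y z) \<in> torsion_space w G J \<psi>"
proof -
  have sym: "symmetric_form (r_map G \<psi> (\<lambda>x y z. \<alpha> x y z - \<beta> x y z))"
    if "symmetric_form (r_map G \<psi> \<alpha>)" "symmetric_form (r_map G \<psi> \<beta>)"
    using that unfolding symmetric_form_def r_map_diff by metis
  have skew: "skew_form (r_map G \<psi> (\<lambda>x y z. \<alpha> x y z - \<beta> x y z))"
    if "skew_form (r_map G \<psi> \<alpha>)" "skew_form (r_map G \<psi> \<beta>)"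
    using that unfolding skew_form_def r_map_diff by (metis minus_diff_commute minus_diff_minus)
  show ?thesis
    using assms space_W1_diff[of \<alpha> \<beta>] space_W2_diff[of \<alpha> \<beta>] space_W3_diff[of \<alpha> \<beta>]
      space_W4_diff[of \<alpha> \<beta>] sym skew
    by (cases w) simp_all
qed

end

text \<open>Changing the phase of the complex volume form amounts to rotating one argument in the
  plane of x and J x. Here \<psi> is \<psi>_+, and c and s stand for the cosine and sine of the
  angle.\<close>

locale su3_angle = su3 G J \<Phi> for G J \<Phi> +
  fixes c s :: real and \<psi> :: "(real^6) tensor"
  assumes cs: "c\<^sup>2 + s\<^sup>2 = 1" and \<psi>: "\<psi> [x, y, z] = \<Phi> (c *\<^sub>R x + s *\<^sub>R J x) y z"
begin

abbreviation rot :: "real^6 \<Rightarrow> real^6" where "rot x \<equiv> c *\<^sub>R x + s *\<^sub>R J x"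

lemma rot_inverse: "rot (c *\<^sub>R x - s *\<^sub>R J x) = x"
proof -
  have "rot (c *\<^sub>R x - s *\<^sub>R J x) = (c\<^sup>2 + s\<^sup>2) *\<^sub>R x"
    by (simp add: J_simps JJ algebra_simps power2_eq_square)
  then show ?thesis by (simp add: cs)
qed

lemma G_rot: "G (rot x) (rot y) = G x y"
proof -
  have "G (rot x) (rot y) = (c\<^sup>2 + s\<^sup>2) * G x y"
    using GJ[of x y] by (simp add: simps GJJ algebra_simps power2_eq_square)
  then show ?thesis by (simp add: cs)
qed

lemma r_map_eq:
  "r_map G \<psi> \<alpha> x y = (\<Sum>e\<in>onb G. \<Sum>f\<in>onb G. \<alpha> x e f * \<Phi> (rot y) e f) / 4"
  by (simp add: r_map_def form_inner_2[OF finite_onb] interior_def \<psi>)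

text \<open>\<open>rot\<close> is invertible, so r pairs \<alpha> x with \<Phi> u for every u, and
  \<open>\<Phi>_skew_pairing_inj\<close> applies.\<close>

lemma r_map_inj:
  assumes "\<alpha> \<in> gray_hervella J" "\<And>x y. r_map G \<psi> \<alpha> x y = 0"
  shows "\<alpha> x y z = 0"
proof (rule \<Phi>_skew_pairing_inj)
  fix u
  have "(\<Sum>e\<in>onb G. \<Sum>f\<in>onb G. \<alpha> x e f * \<Phi> u e f) = 4 * r_map G \<psi> \<alpha> x (c *\<^sub>R u - s *\<^sub>R J u)"
    unfolding r_map_eq rot_inverse by simp
  then show "(\<Sum>e\<in>onb G. \<Sum>f\<in>onb G. \<alpha> x e f * \<Phi> u e f) = 0" by (simp add: assms(2))
qed (rule gray_hervellaD[OF assms(1)])+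

text \<open>Four tests separate the six summands: the sign under J in the first two slots (W1, W2
  against W3, W4), the cyclic sum (W1 against W2), the trace (W3 against W4), and the symmetry of r
  (plus against minus).\<close>

lemma torsion_decomposition_zero:
  assumes part: "\<And>w. w \<noteq> W5 \<Longrightarrow> d w \<in> torsion_space w G J \<psi>"
    and sum: "\<And>x y z. d W1p x y z + d W1m x y z + d W2p x y z + d W2m x y z + d W3 x y z + d W4 x y z = 0"
    and "w \<noteq> W5"
  shows "d w x y z = 0"
proof -
  have p1: "d W1p \<in> space_W1 J" "symmetric_form (r_map G \<psi> (d W1p))"
    and m1: "d W1m \<in> space_W1 J" "skew_form (r_map G \<psi> (d W1m))"
    and p2: "d W2p \<in> space_W2 J" "symmetric_form (r_map G \<psi> (d W2p))"
    and m2: "d W2m \<in> space_W2 J" "skew_form (r_map G \<psi> (d W2m))"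
    and w3: "d W3 \<in> space_W3 G J" and w4: "d W4 \<in> space_W4 G J"
    using part[of W1p] part[of W1m] part[of W2p] part[of W2m] part[of W3] part[of W4] by simp_all
  have gh: "d W1p \<in> gray_hervella J" "d W1m \<in> gray_hervella J" "d W2p \<in> gray_hervella J"
    "d W2m \<in> gray_hervella J"
    using p1 m1 p2 m2 unfolding space_W1_def space_W2_def by blast+
  obtain \<tau> where \<tau>: "linear \<tau>" "d W4 = W4_form \<tau>" using w4 by (rule W4_E)
  \<comment> \<open>Passing to J x, J y changes the sign of the first four summands and preserves
    the last two.\<close>
  have 34: "d W3 x y z + d W4 x y z = 0" and 12: "d W1p x y z + d W1m x y z + d W2p x y z + d W2m x y z = 0"
    for x y z
    using sum[of "J x" "J y" z] sum[of x y z]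
    unfolding W1_J[OF p1(1)] W1_J[OF m1(1)] W2_J[OF p2(1)] W2_J[OF m2(1)] W3_J[OF w3] \<tau>(2) W4_form_J[OF \<tau>(1)]
    by linarith+
  have cyc: "\<alpha> x y z + \<alpha> y z x + \<alpha> z x y = 3 * \<alpha> x y z" if "\<alpha> \<in> space_W1 J" for \<alpha> x y z
  proof -
    have gh: "\<alpha> \<in> gray_hervella J" and sk: "\<And>x y z. \<alpha> x y z = - \<alpha> y x z"
      using that unfolding space_W1_def by blast+
    show ?thesis
      using sk[of x z y] sk[of y z x] sk[of z x y] sk[of x y z]
        gray_hervellaD(4)[OF gh, of x y z] gray_hervellaD(4)[OF gh, of y z x] by linarith
  qed
  have cyc2: "\<alpha> x y z + \<alpha> y z x + \<alpha> z x y = 0" if "\<alpha> \<in> space_W2 J" for \<alpha> x y z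
    using that unfolding space_W2_def by blast
  have 1: "d W1p x y z + d W1m x y z = 0" for x y z
    using 12[of x y z] 12[of y z x] 12[of z x y] cyc[OF p1(1), of x y z] cyc[OF m1(1), of x y z]
      cyc2[OF p2(1), of x y z] cyc2[OF m2(1), of x y z] by linarith
  have 2: "d W2p x y z + d W2m x y z = 0" for x y z
    using 1[of x y z] 12[of x y z] by linarith
  \<comment> \<open>Opposite forms have opposite images under r, so the image of \<alpha> is both
    symmetric and skew.\<close>
  have opposite: "\<alpha> x y z = 0 \<and> \<beta> x y z = 0"
    if "\<alpha> \<in> gray_hervella J" "symmetric_form (r_map G \<psi> \<alpha>)" "skew_form (r_map G \<psi> \<beta>)"
      and sum: "\<And>x y z. \<alpha> x y z + \<beta> x y z = 0" for \<alpha> \<beta> x y z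
  proof -
    have \<beta>: "\<beta> = (\<lambda>x y z. - \<alpha> x y z)" using sum by (simp add: fun_eq_iff eq_neg_iff_add_eq_0 add.commute)
    have "r_map G \<psi> \<beta> x y = - r_map G \<psi> \<alpha> x y" for x y
      unfolding \<beta> r_map_eq by (simp add: sum_negf)
    then have "r_map G \<psi> \<alpha> x y = 0" for x y
      using that(2,3) unfolding symmetric_form_def skew_form_def by (smt (verit))
    then show ?thesis using r_map_inj[OF that(1)] \<beta> by simp
  qed
  have tr3: "(\<Sum>e\<in>onb G. d W3 e e z) = 0" for z
    using w3 unfolding space_W3_def metric_trace_def by blast
  have "\<tau> z = 0" for z
  proof -
    have "(\<Sum>e\<in>onb G. d W3 e e z) + (\<Sum>e\<in>onb G. d W4 e e z) = 0"
      by (simp add: 34 flip: sum.distrib)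
    then show ?thesis
      unfolding \<tau>(2) W4_form_trace[OF \<tau>(1)] tr3 by simp
  qed
  then have 4: "d W4 x y z = 0" for x y z by (simp add: \<tau>(2) W4_form_def)
  then have 3: "d W3 x y z = 0" for x y z using 34[of x y z] by simp
  show ?thesis
    using opposite[OF gh(1) p1(2) m1(2) 1] opposite[OF gh(3) p2(2) m2(2) 2] 3 4 \<open>w \<noteq> W5\<close>
    by (cases w) simp_all
qed

lemma sum_torsion_classes:
  "(\<Sum>w\<in>-{W5}. f w) = (f W1p + f W1m + f W2p + f W2m + f W3 + f W4 :: real)"
proof -
  have "-{W5} = {W1p, W1m, W2p, W2m, W3, W4}"
    by (auto intro: torsion_class.exhaust)
  then show ?thesis by simp
qed

text \<open>Evaluates the definite description: any admissible family of pieces summing to \<alpha>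
  is the family of components.\<close>

lemma torsion_component_eq:
  fixes pt :: "torsion_class \<Rightarrow> real^6 \<Rightarrow> real^6 \<Rightarrow> real^6 \<Rightarrow> real"
  assumes part: "\<And>w. w \<noteq> W5 \<Longrightarrow> pt w \<in> torsion_space w G J \<psi>"
    and sum: "\<And>x y z. \<alpha> x y z = (\<Sum>w\<in>-{W5}. pt w x y z)" and "w \<noteq> W5"
  shows "torsion_component G J \<psi> \<alpha> w = pt w"
  unfolding torsion_component_def
proof (rule the_equality)
  fix \<beta>
  assume "\<exists>part. (\<forall>v\<in>- {W5}. part v \<in> torsion_space v G J \<psi>) \<and>
    (\<forall>x y z. \<alpha> x y z = (\<Sum>v\<in>- {W5}. part v x y z)) \<and> \<beta> = part w"
  then obtain q where q: "\<And>w. w \<noteq> W5 \<Longrightarrow> q w \<in> torsion_space w G J \<psi>"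
    "\<And>x y z. \<alpha> x y z = (\<Sum>w\<in>-{W5}. q w x y z)" "\<beta> = q w"
    by auto
  define d where "d = (\<lambda>w x y z. q w x y z - pt w x y z)"
  have "d v x y z = 0" if "v \<noteq> W5" for v x y z
  proof (rule torsion_decomposition_zero[OF _ _ that])
    fix x y z
    show "d W1p x y z + d W1m x y z + d W2p x y z + d W2m x y z + d W3 x y z + d W4 x y z = 0"
      using sum[of x y z] q(2)[of x y z] unfolding sum_torsion_classes d_def by linarith
  qed (unfold d_def, intro torsion_space_diff part q)
  then show "\<beta> = pt w" using q(3) \<open>w \<noteq> W5\<close> by (simp add: d_def fun_eq_iff)
qed (use assms in blast)

end

section \<open>Forms \<Phi>(\<rho> x, y, z) and the classes that contain them\<close>

context su3 begin

lemma twist_gray_hervella: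
  assumes "linear \<rho>"
  shows "(\<lambda>x y z. \<Phi> (\<rho> x) y z) \<in> gray_hervella J"
proof -
  have "linear (\<lambda>x. \<Phi> (\<rho> x) y z)" for y z
    using linear_compose[OF assms linear_\<Phi>1] by (simp add: o_def)
  moreover have "\<Phi> (\<rho> x) y z = - \<Phi> (\<rho> x) z y \<and> \<Phi> (\<rho> x) y z = - \<Phi> (\<rho> x) (J y) (J z)" for x y z
    using \<Phi>_skew23[of "\<rho> x" y z] \<Phi>_JJ[of "\<rho> x" y z] by linarith
  ultimately show ?thesis
    unfolding gray_hervella_def mem_Collect_eq using linear_\<Phi> linear_\<Phi>2 by blast
qed

text \<open>Here \<rho> is multiplication by a complex scalar, and a scalar multiple of a complex
  volume form is again totally skew.\<close>

lemma twist_W1: "(\<lambda>x y z. \<Phi> (a *\<^sub>R x + b *\<^sub>R J x) y z) \<in> space_W1 J"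
proof -
  have lin: "linear (\<lambda>x. a *\<^sub>R x + b *\<^sub>R J x)"
    by (intro linearI) (simp_all add: J_simps algebra_simps)
  have "\<Phi> (a *\<^sub>R x + b *\<^sub>R J x) y z = - \<Phi> (a *\<^sub>R y + b *\<^sub>R J y) x z" for x y z
    using \<Phi>_skew[of x y z] \<Phi>_skew[of x "J y" z] \<Phi>_J[of x y z] by (simp add: \<Phi>_simps)
  then show ?thesis
    unfolding space_W1_def mem_Collect_eq using twist_gray_hervella[OF lin] by (intro conjI allI)
qed

text \<open>The cyclic sum is the derivation S applied to the complex volume form, hence a multiple
  by the complex trace of S; for S Hermitian that is half the real trace, which is zero. The proof
  stays real and pairs the sum with \<Phi>.\<close>

lemma trace_free_cyclic_zero:
  assumes S: "linear S" and S_sym: "\<And>x y. G (S x) y = G x (S y)" and SJ: "\<And>x. S (J x) = J (S x)"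
    and tr: "(\<Sum>e\<in>onb G. G (S e) e) = 0"
  shows "\<Phi> (S x) y z + \<Phi> (S y) z x + \<Phi> (S z) x y = 0"
proof (rule \<Phi>_skew_pairing_inj[where \<beta> = "\<lambda>u v. \<Phi> (S x) u v + \<Phi> (S u) v x + \<Phi> (S v) x u"])
  fix u
  note S_simps = linear_add[OF S] linear_scale[OF S]
  show "linear (\<lambda>u. \<Phi> (S x) u v + \<Phi> (S u) v x + \<Phi> (S v) x u)"
    "linear (\<lambda>v. \<Phi> (S x) u v + \<Phi> (S u) v x + \<Phi> (S v) x u)" for u v
    by (auto intro!: linearI simp: S_simps \<Phi>_simps algebra_simps)
  show "\<Phi> (S x) u v + \<Phi> (S u) v x + \<Phi> (S v) x u = - (\<Phi> (S x) v u + \<Phi> (S v) u x + \<Phi> (S u) x v)" for u v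
    using \<Phi>_skew23[of "S x" u v] \<Phi>_skew23[of "S u" v x] \<Phi>_skew23[of "S v" x u] by linarith
  show "\<Phi> (S x) (J u) (J v) + \<Phi> (S (J u)) (J v) x + \<Phi> (S (J v)) x (J u) =
    - (\<Phi> (S x) u v + \<Phi> (S u) v x + \<Phi> (S v) x u)" for u v
    using \<Phi>_JJ[of "S x" u v] \<Phi>_JJ[of x "S u" v] \<Phi>_JJ[of x u "S v"]
      \<Phi>_cycle[of x "S u" v] \<Phi>_cycle[of x "J (S u)" "J v"]
      \<Phi>_cycle[of "S v" x u] \<Phi>_cycle[of "J (S v)" x "J u"] by (simp add: SJ)
  define s where "s = (\<Sum>e\<in>onb G. \<Sum>f\<in>onb G. \<Phi> (S e) f x * \<Phi> u e f)"
  have "s = (\<Sum>e\<in>onb G. \<Sum>f\<in>onb G. \<Phi> x (S e) f * \<Phi> u e f)"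
    unfolding s_def by (intro sum.cong refl) (simp only: \<Phi>_cycle[of x])
  also have "\<dots> = (\<Sum>e\<in>onb G. G x u * G (S e) e - G x e * G (S u) e - G (J x) e * G (S (J u)) e)"
    unfolding \<Phi>_contract
  proof (rule sum.cong[OF refl])
    fix e
    have "G (S e) (J e) = - G (S e) (J e)"
      \<comment> \<open>S is symmetric and commutes with J, so J S is skew and has no diagonal
        entries.\<close>
      using GJ[of "S e" e] S_sym[of "J e" e] sym[of "S e" "J e"] SJ[of e] by simp
    then have "G (S e) (J e) = 0" by simp
    moreover have "G (S e) u = G (S u) e" "G (S e) (J u) = G (S (J u)) e" "G x (J e) = - G (J x) e"
      by (simp_all add: S_sym[of e] sym[of e] GJ[of x e])
    ultimately show "G x u * G (S e) e - G x e * G (S e) u - G x (J u) * G (S e) (J e) + G x (J e) * G (S e) (J u)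
      = G x u * G (S e) e - G x e * G (S u) e - G (J x) e * G (S (J u)) e" by simp
  qed
  also have "\<dots> = - 2 * G (S x) u"
    unfolding sum_subtractf sum_distrib_left[symmetric] tr onb_parseval SJ GJJ
    unfolding S_sym by simp
  finally have s: "s = - 2 * G (S x) u" .
  have "(\<Sum>e\<in>onb G. \<Sum>f\<in>onb G. \<Phi> (S f) x e * \<Phi> u e f) =
    (\<Sum>f\<in>onb G. \<Sum>e\<in>onb G. \<Phi> (S f) x e * \<Phi> u e f)"
    by (rule sum.swap)
  also have "\<dots> = s"
    unfolding s_def
  proof (intro sum.cong refl)
    fix e f
    show "\<Phi> (S f) x e * \<Phi> u e f = \<Phi> (S f) e x * \<Phi> u f e"
      using \<Phi>_skew23[of "S f" x e] \<Phi>_skew23[of u e f] by simp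
  qed
  \<comment> \<open>The second and third terms agree after exchanging e and f, and each contributes
    -2 against the 4 of \<open>\<Phi>_contract2\<close>.\<close>
  finally show "(\<Sum>e\<in>onb G. \<Sum>f\<in>onb G. (\<Phi> (S x) e f + \<Phi> (S e) f x + \<Phi> (S f) x e) * \<Phi> u e f) = 0"
    using s \<Phi>_contract2[of "S x" u] s_def by (simp add: distrib_right sum.distrib)
qed

lemma twist_W2:
  assumes S: "linear S" and S_sym: "\<And>x y. G (S x) y = G x (S y)" and SJ: "\<And>x. S (J x) = J (S x)"
    and tr: "(\<Sum>e\<in>onb G. G (S e) e) = 0"
  shows "(\<lambda>x y z. \<Phi> (a *\<^sub>R S x + b *\<^sub>R J (S x)) y z) \<in> space_W2 J"
proof -
  have lin: "linear (\<lambda>x. a *\<^sub>R S x + b *\<^sub>R J (S x))"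
    by (intro linearI) (simp_all add: J_simps linear_add[OF S] linear_scale[OF S] algebra_simps)
  have "\<Phi> (a *\<^sub>R S x + b *\<^sub>R J (S x)) y z + \<Phi> (a *\<^sub>R S y + b *\<^sub>R J (S y)) z x
    + \<Phi> (a *\<^sub>R S z + b *\<^sub>R J (S z)) x y = 0" for x y z
  proof -
    note cyc = trace_free_cyclic_zero[OF assms]
    have "\<Phi> (J (S x)) y z + \<Phi> (J (S y)) z x + \<Phi> (J (S z)) x y = 0"
      using cyc[of "J x" y z] \<Phi>_J13[of "S y" z x] \<Phi>_J[of "S z" x y] by (simp add: SJ)
    then have "b * (\<Phi> (J (S x)) y z + \<Phi> (J (S y)) z x + \<Phi> (J (S z)) x y) = 0" by simp
    moreover have "a * (\<Phi> (S x) y z + \<Phi> (S y) z x + \<Phi> (S z) x y) = 0" by (simp add: cyc)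
    ultimately show ?thesis by (simp add: \<Phi>_simps algebra_simps)
  qed
  then show ?thesis
    unfolding space_W2_def mem_Collect_eq using twist_gray_hervella[OF lin] by (intro conjI allI)
qed

text \<open>A symmetric bilinear form is contracted with two skew slots. This is the trace condition
  of W3, and it also removes the shape operator from the codifferential of \<omega>.\<close>

lemma sym_trace_zero:
  assumes T: "linear T" and T_sym: "\<And>x y. G (T x) y = G x (T y)"
  shows "(\<Sum>e\<in>onb G. \<Phi> (T e) e z) = 0"
proof -
  define s where "s = (\<Sum>e\<in>onb G. \<Sum>f\<in>onb G. G (T e) f * \<Phi> f e z)"
  have "s = (\<Sum>e\<in>onb G. \<Sum>f\<in>onb G. G (T f) e * \<Phi> e f z)"
    unfolding s_def by (rule sum.swap)
  also have "\<dots> = - s"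
    unfolding s_def sum_negf[symmetric]
  proof (intro sum.cong refl)
    fix e f
    show "G (T f) e * \<Phi> e f z = - (G (T e) f * \<Phi> f e z)"
      using \<Phi>_skew[of e f z] T_sym[of f e] sym[of f "T e"] by simp
  qed
  finally have "s = 0" by simp
  then show ?thesis
    unfolding s_def by (simp add: linear_onb_sum[OF linear_\<Phi>1])
qed

lemma twist_W3:
  assumes T: "linear T" and T_sym: "\<And>x y. G (T x) y = G x (T y)" and TJ: "\<And>x. T (J x) = - J (T x)"
  shows "(\<lambda>x y z. \<Phi> (T x) y z) \<in> space_W3 G J"
proof -
  have "\<Phi> (T (J x)) (J y) z = \<Phi> (T x) y z" for x y z
    using \<Phi>_J[of "T x" "J y" z] by (simp add: TJ JJ \<Phi>_simps)
  then show ?thesis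
    unfolding space_W3_def mem_Collect_eq metric_trace_def
    using twist_gray_hervella[OF T] sym_trace_zero[OF T T_sym] by blast
qed

end

context su3_angle begin

text \<open>Makes the sign of a class visible: since \<open>rot\<close> is an isometry, \<rho> =
  \<open>rot\<close> S has a symmetric image and \<rho> = J \<open>rot\<close> S a skew one when S
  is symmetric and commutes with J.\<close>

lemma r_twist: "r_map G \<psi> (\<lambda>x y z. \<Phi> (\<rho> x) y z) x y = G (\<rho> x) (rot y)"
  by (simp add: r_map_eq \<Phi>_contract2)

lemma J_rot: "J (rot x) = rot (J x)"
  by (simp add: J_simps)

end

section \<open>Torsion components determined by a symmetric endomorphism, a scalar and a
  one-form\<close>

locale su3_torsion = su3_angle G J \<Phi> c s \<psi> for G J \<Phi> c s \<psi> +
  fixes \<beta> :: "real^6 \<Rightarrow> real^6" and h k :: real and \<tau> :: "real^6 \<Rightarrow> real"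
    and \<alpha> :: "real^6 \<Rightarrow> real^6 \<Rightarrow> real^6 \<Rightarrow> real"
  assumes \<beta>: "linear \<beta>" and \<beta>_sym: "G (\<beta> x) y = G x (\<beta> y)"
    and trace_\<beta>: "metric_trace G (\<lambda>x y. G (\<beta> x) y) = 6 * h" and \<tau>: "linear \<tau>"
    and \<alpha>: "\<alpha> x y z = \<Phi> (\<beta> x) y z - k * \<Phi> x y z + W4_form \<tau> x y z"
begin

text \<open>As the inverse of J is -J, the average of \<beta> with its conjugate by J is (\<beta> -
  J \<beta> J)/2, the part commuting with J. Its trace is that of \<beta>, so subtracting h times
  the identity makes it trace-free.\<close>

definition S where "S x = (1/2) *\<^sub>R (\<beta> x - J (\<beta> (J x))) - h *\<^sub>R x"

definition T where "T x = (1/2) *\<^sub>R (\<beta> x + J (\<beta> (J x)))"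

lemmas \<beta>_simps = linear_add[OF \<beta>] linear_scale[OF \<beta>] linear_neg[OF \<beta>]

lemma linear_S: "linear S" and linear_T: "linear T"
  unfolding S_def T_def by (auto intro!: linearI simp: J_simps \<beta>_simps algebra_simps)

lemma J\<beta>J_sym: "G (J (\<beta> (J x))) y = G x (J (\<beta> (J y)))"
  using GJ[of "\<beta> (J x)" y] GJ[of x "\<beta> (J y)"] \<beta>_sym[of "J x" "J y"] by simp

lemma S_sym: "G (S x) y = G x (S y)" and T_sym: "G (T x) y = G x (T y)"
  unfolding S_def T_def by (simp_all add: simps \<beta>_sym J\<beta>J_sym)

lemma SJ: "S (J x) = J (S x)" and TJ: "T (J x) = - J (T x)"
  unfolding S_def T_def by (simp_all add: J_simps JJ \<beta>_simps algebra_simps)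

lemma onb_norm: "e \<in> onb G \<Longrightarrow> G e e = 1"
  using onb(1) by (auto simp: orthonormal_def)

text \<open>Conjugation by J preserves the trace. J need not permute \<open>onb G\<close>, so the
  basis vectors are expanded again and the sums exchanged.\<close>

lemma trace_J\<beta>J: "(\<Sum>e\<in>onb G. G (J (\<beta> (J e))) e) = - (\<Sum>e\<in>onb G. G (\<beta> e) e)"
proof -
  have "(\<Sum>e\<in>onb G. G (\<beta> (J e)) (J e)) = (\<Sum>e\<in>onb G. \<Sum>f\<in>onb G. G (J e) f * G (\<beta> f) (J e))"
    using linear_onb_sum[of "\<lambda>x. G (\<beta> x) y" for y] linear_compose[OF \<beta> linear_left] by (simp add: o_def)
  also have "\<dots> = (\<Sum>f\<in>onb G. \<Sum>e\<in>onb G. G (J e) f * G (\<beta> f) (J e))"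
    by (rule sum.swap)
  also have "\<dots> = (\<Sum>f\<in>onb G. \<Sum>e\<in>onb G. G (J f) e * G (J (\<beta> f)) e)"
  proof (intro sum.cong refl)
    fix e f
    show "G (J e) f * G (\<beta> f) (J e) = G (J f) e * G (J (\<beta> f)) e"
      using GJ[of f e] GJ[of "\<beta> f" e] sym[of f "J e"] by simp
  qed
  also have "\<dots> = (\<Sum>f\<in>onb G. G (\<beta> f) f)"
    unfolding onb_parseval GJJ by (simp add: sym)
  finally show ?thesis
    using GJ[of "\<beta> (J e)" e for e] by (simp add: sum_negf)
qed

lemma trace_S: "(\<Sum>e\<in>onb G. G (S e) e) = 0"
proof -
  have "(\<Sum>e\<in>onb G. G (S e) e) =
    (\<Sum>e\<in>onb G. (1/2) * G (\<beta> e) e - (1/2) * G (J (\<beta> (J e))) e - h)"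
    by (intro sum.cong refl) (simp add: S_def simps onb_norm)
  also have "\<dots> = (1/2) * (6 * h) + (1/2) * (6 * h) - 6 * h"
    using trace_\<beta> by (simp add: sum_subtractf trace_J\<beta>J metric_trace_def onb flip: sum_distrib_left sum_divide_distrib)
  finally show ?thesis by simp
qed

lemma \<beta>_eq: "\<beta> x = h *\<^sub>R x + S x + T x"
proof -
  have "S x + T x = (1/2) *\<^sub>R \<beta> x + (1/2) *\<^sub>R \<beta> x - h *\<^sub>R x"
    unfolding S_def T_def by (simp add: algebra_simps)
  then have "S x + T x = \<beta> x - h *\<^sub>R x" by (simp flip: scaleR_add_left)
  then show ?thesis by (simp add: add.assoc)
qed

text \<open>From c^2 + s^2 = 1 one has u = c \<open>rot\<close> u - s J (\<open>rot\<close> u),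
  whose two terms give the plus and the minus class by \<open>r_twist\<close>. The value at
  \<open>W4\<close> is a placeholder: that component is \<open>W4_form \<tau>\<close> and not a
  twist of \<Phi>.\<close>

primrec component :: "torsion_class \<Rightarrow> real^6 \<Rightarrow> real^6" where
  "component W1p = (\<lambda>x. ((h - k) * c) *\<^sub>R rot x)"
| "component W1m = (\<lambda>x. - ((h - k) * s) *\<^sub>R J (rot x))"
| "component W2p = (\<lambda>x. c *\<^sub>R rot (S x))"
| "component W2m = (\<lambda>x. - s *\<^sub>R J (rot (S x)))"
| "component W3 = T"
| "component W4 = (\<lambda>x. 0)"
| "component W5 = (\<lambda>x. 0)"

lemma torsion_component:
  assumes "w \<noteq> W5"
  shows "torsion_component G J \<psi> \<alpha> w =
    (if w = W4 then W4_form \<tau> else (\<lambda>x y z. \<Phi> (component w x) y z))"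
proof (rule torsion_component_eq[OF _ _ assms])
  fix w assume "w \<noteq> W5"
  \<comment> \<open>Multiplied out into the form a u + b J u that \<open>twist_W1\<close> and
    \<open>twist_W2\<close> expect.\<close>
  have rot_scale: "(a * c) *\<^sub>R rot u = (a * c * c) *\<^sub>R u + (a * c * s) *\<^sub>R J u"
    and J_rot_scale: "- (a * s) *\<^sub>R J (rot u) = (a * s * s) *\<^sub>R u + (- (a * s * c)) *\<^sub>R J u" for a u
    by (simp_all add: J_simps JJ algebra_simps)
  have "(\<lambda>x y z. \<Phi> (component W1p x) y z) \<in> space_W1 J"
    unfolding component.simps rot_scale by (rule twist_W1)
  moreover have "(\<lambda>x y z. \<Phi> (component W1m x) y z) \<in> space_W1 J"
    unfolding component.simps J_rot_scale by (rule twist_W1)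
  moreover have "(\<lambda>x y z. \<Phi> (component W2p x) y z) \<in> space_W2 J"
    unfolding component.simps using rot_scale[of 1] twist_W2[OF linear_S S_sym SJ trace_S] by simp
  moreover have "(\<lambda>x y z. \<Phi> (component W2m x) y z) \<in> space_W2 J"
    unfolding component.simps using J_rot_scale[of 1]
      twist_W2[OF linear_S S_sym SJ trace_S, of "s * s" "- (s * c)"] by simp
  moreover have "symmetric_form (r_map G \<psi> (\<lambda>x y z. \<Phi> (component W1p x) y z))"
    unfolding symmetric_form_def r_twist component.simps simps(7,8) real_scaleR_def G_rot
    by (intro allI arg_cong[where f = "times _"] sym)
  moreover have "symmetric_form (r_map G \<psi> (\<lambda>x y z. \<Phi> (component W2p x) y z))"
    unfolding symmetric_form_def r_twist component.simps simps(7,8) real_scaleR_def G_rot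
  proof (intro allI)
    fix x y
    show "c * G (S x) y = c * G (S y) x"
      using S_sym[of x y] sym[of x "S y"] by simp
  qed
  moreover have "skew_form (r_map G \<psi> (\<lambda>x y z. \<Phi> (component W1m x) y z))"
    unfolding skew_form_def r_twist component.simps simps(7,8) real_scaleR_def J_rot G_rot
  proof (intro allI)
    fix x y
    have "G (J x) y = - G (J y) x"
      using GJ[of x y] sym[of x "J y"] by simp
    then show "- ((h - k) * s) * G (J x) y = - (- ((h - k) * s) * G (J y) x)" by simp
  qed
  moreover have "skew_form (r_map G \<psi> (\<lambda>x y z. \<Phi> (component W2m x) y z))"
    unfolding skew_form_def r_twist component.simps simps(7,8) real_scaleR_def J_rot G_rot
  proof (intro allI)
    fix x y
    have "G (J (S x)) y = - G (J (S y)) x"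
      using GJ[of "S x" y] S_sym[of x "J y"] SJ[of y] sym[of x "J (S y)"] by simp
    then show "- s * G (J (S x)) y = - (- s * G (J (S y)) x)" by simp
  qed
  ultimately show "(if w = W4 then W4_form \<tau> else (\<lambda>x y z. \<Phi> (component w x) y z)) \<in> torsion_space w G J \<psi>"
    using \<open>w \<noteq> W5\<close> W4_form_in_W4[OF \<tau>] twist_W3[OF linear_T T_sym TJ] by (cases w) simp_all
next
  fix x y z
  have combine: "(a * c) *\<^sub>R rot u - (a * s) *\<^sub>R J (rot u) = a *\<^sub>R u" for a u
  proof -
    have "(a * c) *\<^sub>R rot u - (a * s) *\<^sub>R J (rot u) = (a * (c\<^sup>2 + s\<^sup>2)) *\<^sub>R u"
      by (simp add: J_simps JJ algebra_simps power2_eq_square)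
    then show ?thesis by (simp add: cs)
  qed
  have "component W1p x + component W1m x + component W2p x + component W2m x + component W3 x
    = ((h - k) * c) *\<^sub>R rot x - ((h - k) * s) *\<^sub>R J (rot x)
      + ((1 * c) *\<^sub>R rot (S x) - (1 * s) *\<^sub>R J (rot (S x))) + T x" by simp
  also have "\<dots> = (h - k) *\<^sub>R x + S x + T x" unfolding combine by simp
  also have "\<dots> = \<beta> x - k *\<^sub>R x" by (simp add: \<beta>_eq algebra_simps)
  finally have "\<Phi> (component W1p x + component W1m x + component W2p x + component W2m x + component W3 x) y z
    = \<Phi> (\<beta> x) y z - k * \<Phi> x y z" by (simp add: \<Phi>_simps)
  then show "\<alpha> x y z = (\<Sum>w\<in>- {W5}. (if w = W4 then W4_form \<tau> else (\<lambda>x y z. \<Phi> (component w x) y z)) x y z)"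
    unfolding sum_torsion_classes \<alpha> by (simp add: \<Phi>_simps del: component.simps)
qed

abbreviation vanishes :: "torsion_class \<Rightarrow> bool" where
  "vanishes w \<equiv> \<forall>x y z. torsion_component G J \<psi> \<alpha> w x y z = 0"

lemma vanishes_iff:
  assumes "w \<noteq> W5" "w \<noteq> W4"
  shows "vanishes w \<longleftrightarrow> (\<forall>x. component w x = 0)"
proof -
  have "torsion_component G J \<psi> \<alpha> w x y z = \<Phi> (component w x) y z" for x y z
    using torsion_component[OF assms(1)] assms(2) by simp
  then show ?thesis using \<Phi>_eq_zeroD \<Phi>_simps(10) by metis
qed

lemma J_eq_zero: "J x = 0 \<longleftrightarrow> x = 0"
  using JJ[of x] linear_0[OF linear_J] by force

lemma rot_eq_zero: "rot x = 0 \<longleftrightarrow> x = 0"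
  using G_rot[of x x] eq_zero_iff[of "rot x"] eq_zero_iff[of x] by simp

lemma vanishes_W1p: "vanishes W1p \<longleftrightarrow> c * (h - k) = 0"
  and vanishes_W1m: "vanishes W1m \<longleftrightarrow> s * (h - k) = 0"
proof -
  \<comment> \<open>A nonzero vector is needed to conclude from the vanishing of a multiple of an
    isometry that the scalar factor vanishes.\<close>
  have "(axis 1 1 :: real^6) \<noteq> 0" by (simp add: axis_eq_0_iff)
  then have "\<exists>x :: real^6. x \<noteq> 0" by blast
  then show "vanishes W1p \<longleftrightarrow> c * (h - k) = 0" "vanishes W1m \<longleftrightarrow> s * (h - k) = 0"
    by (auto simp: vanishes_iff rot_eq_zero J_eq_zero)
qed

lemma G_S: "2 * G (S x) y = G (\<beta> x) y + G (\<beta> (J x)) (J y) - 2 * h * G x y"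
  using GJ[of "\<beta> (J x)" y] by (simp add: S_def simps)

lemma G_T: "2 * G (T x) y = G (\<beta> x) y - G (\<beta> (J x)) (J y)"
  using GJ[of "\<beta> (J x)" y] by (simp add: T_def simps)

lemma scaled_S_eq_zero:
  "(\<forall>x. a *\<^sub>R S x = 0) \<longleftrightarrow>
    (\<forall>x y. 2 * h * a * G x y = a * (G (\<beta> x) y + G (\<beta> (J x)) (J y)))"
proof -
  have A: "(\<forall>x. a *\<^sub>R S x = 0) \<longleftrightarrow> (\<forall>x y. a * (2 * G (S x) y) = 0)"
    using eqI[of "S x" 0 for x] by (auto simp: simps)
  have B: "a * (2 * G (S x) y) = 0 \<longleftrightarrow>
    2 * h * a * G x y = a * (G (\<beta> x) y + G (\<beta> (J x)) (J y))" for x y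
  proof -
    have "a * (2 * G (S x) y) = a * (G (\<beta> x) y + G (\<beta> (J x)) (J y)) - 2 * h * a * G x y"
      unfolding G_S by (simp add: algebra_simps)
    then show ?thesis by auto
  qed
  show ?thesis unfolding A B ..
qed

lemma vanishes_W2p: "vanishes W2p \<longleftrightarrow>
    (\<forall>x y. 2 * h * c * G x y = c * (G (\<beta> x) y + G (\<beta> (J x)) (J y)))"
  and vanishes_W2m: "vanishes W2m \<longleftrightarrow>
    (\<forall>x y. 2 * h * s * G x y = s * (G (\<beta> x) y + G (\<beta> (J x)) (J y)))"
  unfolding scaled_S_eq_zero[symmetric] by (auto simp: vanishes_iff rot_eq_zero J_eq_zero)

text \<open>The cosine and the sine do not vanish together, so the two weighted conditions combine
  to the unweighted one.\<close>

lemma vanishes_W1: "vanishes W1p \<and> vanishes W1m \<longleftrightarrow> k = h"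
  using cs unfolding vanishes_W1p vanishes_W1m by auto

lemma vanishes_W2: "vanishes W2p \<and> vanishes W2m \<longleftrightarrow>
    (\<forall>x y. G (\<beta> x) y + G (\<beta> (J x)) (J y) = 2 * h * G x y)"
proof -
  have "vanishes W2p \<and> vanishes W2m \<longleftrightarrow> (\<forall>x. 1 *\<^sub>R S x = 0)"
    using cs by (auto simp: vanishes_iff rot_eq_zero J_eq_zero)
  then show ?thesis unfolding scaled_S_eq_zero by auto
qed

lemma vanishes_W3: "vanishes W3 \<longleftrightarrow> (\<forall>x y. G (\<beta> (J x)) (J y) = G (\<beta> x) y)"
proof -
  have "vanishes W3 \<longleftrightarrow> (\<forall>x y. 2 * G (T x) y = 0)"
    using eqI[of "T x" 0 for x] by (auto simp: vanishes_iff simps)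
  then show ?thesis unfolding G_T by auto
qed

lemma vanishes_W4: "vanishes W4 \<longleftrightarrow> (\<forall>z. \<tau> z = 0)"
proof
  assume "vanishes W4"
  then have "W4_form \<tau> x y z = 0" for x y z by (simp add: torsion_component)
  then show "\<forall>z. \<tau> z = 0" using W4_form_trace[OF \<tau>] by simp
qed (simp add: torsion_component W4_form_def)

lemma vanishes_W2_W3: "vanishes W2p \<and> vanishes W2m \<and> vanishes W3 \<longleftrightarrow> (\<forall>x y. G (\<beta> x) y = h * G x y)"
proof -
  have "(\<forall>x y. G (\<beta> x) y + G (\<beta> (J x)) (J y) = 2 * h * G x y) \<and>
      (\<forall>x y. G (\<beta> (J x)) (J y) = G (\<beta> x) y) \<longleftrightarrow> (\<forall>x y. G (\<beta> x) y = h * G x y)"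
    (is "?L \<longleftrightarrow> ?R")
  proof
    assume ?L
    then have "G (\<beta> x) y + G (\<beta> x) y = 2 * h * G x y" for x y by metis
    then show ?R by simp
  qed (simp add: GJJ)
  then show ?thesis using vanishes_W2 vanishes_W3 by blast
qed

end

section \<open>Adapted frames\<close>

text \<open>Makes Laplace expansion available in place of sums over permutations.\<close>

lemma wedge1_eq_det:
  assumes "length \<mu>s = n"
  shows "wedge1 \<mu>s vs = Determinant.det (mat n n (\<lambda>(i, j). (\<mu>s ! i) (vs ! j)))"
proof -
  have "(\<Prod>i<n. (\<mu>s ! i) (vs ! \<sigma> i)) =
    (\<Prod>i = 0..<n. mat n n (\<lambda>(i, j). (\<mu>s ! i) (vs ! j)) $$ (i, \<sigma> i))"
    if "\<sigma> permutes {0..<n}" for \<sigma>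
    unfolding lessThan_atLeast0 by (intro prod.cong refl) (use that permutes_in_image in fastforce)
  then show ?thesis
    unfolding wedge1_def Determinant.det_def by (auto simp: assms lessThan_atLeast0 intro!: sum.cong)
qed

lemma wedge1_Nil: "wedge1 [] vs = 1"
  by (simp add: wedge1_def)

text \<open>Laplace expansion along the column of the first vector; explicit wedge products are
  evaluated by iterating it.\<close>

lemma wedge1_Cons:
  assumes "\<mu>s \<noteq> []"
  shows "wedge1 \<mu>s (v # vs) =
    (\<Sum>i<length \<mu>s. (- 1) ^ i * (\<mu>s ! i) v * wedge1 (take i \<mu>s @ drop (Suc i) \<mu>s) vs)"
proof -
  define n where "n = length \<mu>s"
  define A where "A = mat n n (\<lambda>(i, j). (\<mu>s ! i) ((v # vs) ! j))"
  have n: "0 < n" and A: "A \<in> carrier_mat n n"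
    using assms by (auto simp: n_def A_def)
  have "mat_delete A i 0 = mat (n - 1) (n - 1)
      (\<lambda>(k, j). ((take i \<mu>s @ drop (Suc i) \<mu>s) ! k) (vs ! j))" if "i < n" for i
    using that n by (intro eq_matI) (auto simp: mat_delete_def A_def nth_append n_def min_def)
  then have "Determinant.det (mat_delete A i 0) = wedge1 (take i \<mu>s @ drop (Suc i) \<mu>s) vs" if "i < n" for i
    using that by (subst wedge1_eq_det[where n = "n - 1"]) (auto simp: n_def)
  then have "Determinant.det A =
      (\<Sum>i<n. (- 1) ^ i * (\<mu>s ! i) v * wedge1 (take i \<mu>s @ drop (Suc i) \<mu>s) vs)"
    unfolding laplace_expansion_column[OF A n]
    by (intro sum.cong refl) (use n in \<open>auto simp: cofactor_def A_def\<close>)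
  then show ?thesis
    by (simp add: wedge1_eq_det[where n = n] n_def[symmetric] A_def)
qed

locale frame = inner_form g for g :: "real^7 \<Rightarrow> real^7 \<Rightarrow> real" +
  fixes \<phi> :: "(real^7) tensor" and e :: "7 \<Rightarrow> real^7"
  assumes adapted: "adapted_frame g \<phi> e"
begin

definition coords :: "real^7 \<Rightarrow> real^7" where
  "coords v = (\<chi> i. g (e i) v)"

lemma linear_coords: "linear coords"
  unfolding coords_def by (intro linearI) (simp_all add: Finite_Cartesian_Product.vec_eq_iff simps)

lemma g_frame: "g (e i) (e j) = (if i = j then 1 else 0)"
  using adapted by (auto simp: adapted_frame_def)

lemma coords_frame: "coords (e i) = axis i 1"
  by (simp add: coords_def g_frame axis_def Finite_Cartesian_Product.vec_eq_iff)

lemma inj_frame: "inj e"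
  by (rule injI) (metis g_frame zero_neq_one)

lemma orthonormal_frame: "orthonormal (range e)" "card (range e) = DIM(real^7)"
proof -
  show "orthonormal (range e)"
    using inj_frame by (auto simp: orthonormal_def g_frame inj_eq)
  have "card (range e) = 7" "DIM(real^7) = 7"
    using card_image[OF inj_frame] by simp_all
  then show "card (range e) = DIM(real^7)" by (rule trans[OF _ HOL.sym])
qed

lemma inner_coords: "coords x \<bullet> coords y = g x y"
proof -
  have "coords x \<bullet> coords y = (\<Sum>v\<in>range e. g x v * g y v)"
    by (simp add: sum.reindex[OF inj_frame] inner_vec_def coords_def sym[of x] sym[of y])
  then show ?thesis by (simp add: orthonormal_parseval[OF orthonormal_frame])
qed

lemma inj_coords: "inj coords"
proof (rule injI)
  fix x y assume "coords x = coords y"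
  then show "x = y" by (intro eqI) (metis inner_coords)
qed

lemma surj_coords: "surj coords"
  using linear_injective_imp_surjective[OF linear_coords inj_coords refl] .

lemma phi_coords: "\<phi> [x, y, z] = phi7 (coords x) (coords y) (coords z)"
proof -
  have "\<phi> [x, y, z] = (\<Sum>i\<in>UNIV. wedge1 [g (e i), g (e (i + 1)), g (e (i + 3))] [x, y, z])"
    using adapted by (simp add: adapted_frame_def)
  then show ?thesis
    by (simp add: wedge1_Cons wedge1_Nil sum_7 phi7_def cross7_def inner_7 coords_def numeral_7_simps
        lessThan_Suc algebra_simps)
qed

text \<open>On a frame vector only one term of the Laplace expansion survives, and its sign is given
  by the position of a in the index list.\<close>

lemma wedge1_frame_Cons:
  assumes "distinct js" "a \<in> set js"
  shows "wedge1 (map (\<lambda>i. g (e i)) js) (e a # vs) =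
    (- 1) ^ length (takeWhile (\<lambda>j. j \<noteq> a) js) * wedge1 (map (\<lambda>i. g (e i)) (removeAll a js)) vs"
proof -
  obtain ks ls where js: "js = ks @ a # ls" "a \<notin> set ks"
    using split_list_first[OF assms(2)] by blast
  have "a \<notin> set ls" using assms(1) js by simp
  let ?n = "length ks"
  let ?\<mu>s = "map (\<lambda>i. g (e i)) js"
  let ?F = "\<lambda>i. (- 1) ^ i * wedge1 (take i ?\<mu>s @ drop (Suc i) ?\<mu>s) vs"
  have "(?\<mu>s ! i) (e a) = (if i = ?n then 1 else 0)" if "i < length js" for i
  proof -
    have "js ! i = a \<longleftrightarrow> i = ?n"
      using nth_eq_iff_index_eq[of js i ?n] that assms(1) by (simp add: js(1))
    then show ?thesis using that by (simp add: g_frame)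
  qed
  then have "wedge1 ?\<mu>s (e a # vs) =
    (\<Sum>i<length js. if i = ?n then ?F i else 0)"
    using assms(2) by (subst wedge1_Cons) (force, rule sum.cong, auto)
  also have "\<dots> = ?F ?n" by (simp add: js(1))
  moreover have "takeWhile (\<lambda>j. j \<noteq> a) js = ks"
    using js by (auto simp: takeWhile_append)
  ultimately show ?thesis
    using js \<open>a \<notin> set ls\<close> by simp
qed

lemma axis_sum_pick:
  "(\<Sum>a\<in>UNIV. \<Sum>b\<in>UNIV. axis a (1::real) $ p * axis b 1 $ q * H a b) = (H p q :: real)"
proof -
  have "(\<Sum>b\<in>UNIV. axis a (1::real) $ p * axis b 1 $ q * H a b) = axis a 1 $ p * H a q" for a
    by (simp add: axis_def if_distrib[of "\<lambda>t. t * _"] if_distrib[of "\<lambda>t. _ * t"] cong: if_cong)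
  then show ?thesis
    by (simp add: axis_def if_distrib[of "\<lambda>t. t * _"] cong: if_cong)
qed

text \<open>Of the 343 index triples only the 6 orderings of each of the seven triples (i, i+1, i+3)
  contribute.\<close>

lemma sum_phi_frame:
  "(\<Sum>a\<in>UNIV. \<Sum>b\<in>UNIV. \<Sum>c\<in>UNIV. \<phi> [e a, e b, e c] * F a b c) =
    (\<Sum>c\<in>UNIV. F (c+1) (c+3) c - F (c+3) (c+1) c + F (c+2) (c+6) c - F (c+6) (c+2) c
      + F (c+4) (c+5) c - F (c+5) (c+4) c)"
proof -
  have "(\<Sum>a\<in>UNIV. \<Sum>b\<in>UNIV. \<Sum>c\<in>UNIV. \<phi> [e a, e b, e c] * F a b c) =
    (\<Sum>c\<in>UNIV. \<Sum>a\<in>UNIV. \<Sum>b\<in>UNIV. \<phi> [e a, e b, e c] * F a b c)"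
    by (subst sum.swap[of _ UNIV UNIV], rule sum.cong[OF refl], rule sum.swap)
  moreover have "(\<Sum>a\<in>UNIV. \<Sum>b\<in>UNIV. \<phi> [e a, e b, e c] * F a b c) =
    F (c+1) (c+3) c - F (c+3) (c+1) c + F (c+2) (c+6) c - F (c+6) (c+2) c
      + F (c+4) (c+5) c - F (c+5) (c+4) c" for c
  proof -
    have "phi7 (axis a 1) (axis b 1) (axis c 1) =
      (axis a 1 $ (c+1) * axis b 1 $ (c+3) - axis a 1 $ (c+3) * axis b 1 $ (c+1))
      + (axis a 1 $ (c+2) * axis b 1 $ (c+6) - axis a 1 $ (c+6) * axis b 1 $ (c+2))
      + (axis a 1 $ (c+4) * axis b 1 $ (c+5) - axis a 1 $ (c+5) * axis b 1 $ (c+4))" for a b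
      unfolding phi7_def inner_axis by (simp add: cross7_def)
    then show ?thesis
      unfolding phi_coords coords_frame
      by (simp only: distrib_right left_diff_distrib sum.distrib sum_subtractf axis_sum_pick add_diff_eq)
  qed
  ultimately show ?thesis by simp
qed

definition W :: "7 list \<Rightarrow> (real^7) tensor" where
  "W js = wedge1 (map (\<lambda>i. g (e i)) js)"

lemma W_frame_Cons:
  assumes "distinct js" "a \<in> set js"
  shows "W js (e a # vs) = (- 1) ^ length (takeWhile (\<lambda>j. j \<noteq> a) js) * W (removeAll a js) vs"
  unfolding W_def by (rule wedge1_frame_Cons[OF assms])

end

text \<open>Pluecker coordinates of x \<and> y. Taken as atoms for (x, y) and for (z, w), they turn
  the comparison of the two expressions for *\<phi> into a bilinear identity.\<close>

definition minor :: "real^7 \<Rightarrow> real^7 \<Rightarrow> 7 \<Rightarrow> 7 \<Rightarrow> real" where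
  "minor x y i j = x$i * y$j - x$j * y$i"

text \<open>The Lagrange identity, with its 21 products of minors written out.\<close>

lemma inner_minors:
  "(x \<bullet> z) * (y \<bullet> w) - (x \<bullet> w) * (y \<bullet> z) =
    minor x y 0 1 * minor z w 0 1 + minor x y 0 2 * minor z w 0 2 + minor x y 0 3 * minor z w 0 3 + minor x y 0 4 * minor z w 0 4 + minor x y 0 5 * minor z w 0 5 + minor x y 0 6 * minor z w 0 6 + minor x y 1 2 * minor z w 1 2 + minor x y 1 3 * minor z w 1 3 + minor x y 1 4 * minor z w 1 4 + minor x y 1 5 * minor z w 1 5 + minor x y 1 6 * minor z w 1 6 + minor x y 2 3 * minor z w 2 3 + minor x y 2 4 * minor z w 2 4 + minor x y 2 5 * minor z w 2 5 + minor x y 2 6 * minor z w 2 6 + minor x y 3 4 * minor z w 3 4 + minor x y 3 5 * minor z w 3 5 + minor x y 3 6 * minor z w 3 6 + minor x y 4 5 * minor z w 4 5 + minor x y 4 6 * minor z w 4 6 + minor x y 5 6 * minor z w 5 6"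
  unfolding inner_7 minor_def by (simp add: algebra_simps)

lemma wedge1_4:
  "wedge1 [a, b, c, d] [x, y, z, w] =
    (a x * b y - b x * a y) * (c z * d w - d z * c w) - (a x * c y - c x * a y) * (b z * d w - d z * b w)
    + (a x * d y - d x * a y) * (b z * c w - c z * b w) + (b x * c y - c x * b y) * (a z * d w - d z * a w)
    - (b x * d y - d x * b y) * (a z * c w - c z * a w) + (c x * d y - d x * c y) * (a z * b w - b z * a w)"
  by (simp add: wedge1_Cons wedge1_Nil lessThan_Suc algebra_simps)

context frame begin

text \<open>The complement of each triple of \<phi> is hit by the six orderings of that triple with
  equal contributions, which cancels the 3! in \<open>star\<close>.\<close>

lemma star_frame:
  assumes e: "e = (SOME e. adapted_frame g \<phi> e)"
  shows "star g \<phi> 3 \<phi> ws = - W [2,4,5,6] ws + W [0,3,5,6] ws - W [0,1,4,6] ws + W [0,1,2,5] ws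
    + W [1,2,3,6] ws - W [0,2,3,4] ws - W [1,3,4,5] ws"
proof -
  define F where "F a b c = W [0,1,2,3,4,5,6] (e a # e b # e c # ws)" for a b c
  have "star g \<phi> 3 \<phi> ws = (\<Sum>is | set is \<subseteq> UNIV \<and> length is = 3. \<phi> (map e is) *
      W [0,1,2,3,4,5,6] (map e is @ ws)) / 6"
    unfolding star_def e[symmetric] Let_def W_def by (simp add: fact_numeral)
  also have "\<dots> = (\<Sum>a\<in>UNIV. \<Sum>b\<in>UNIV. \<Sum>c\<in>UNIV. \<phi> [e a, e b, e c] * F a b c) / 6"
    unfolding numeral_3_eq_3 sum_lists_Suc[OF finite] sum_lists_0 F_def by simp
  also have "(\<Sum>a\<in>UNIV. \<Sum>b\<in>UNIV. \<Sum>c\<in>UNIV. \<phi> [e a, e b, e c] * F a b c) =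
    6 * (- W [2,4,5,6] ws + W [0,3,5,6] ws - W [0,1,4,6] ws + W [0,1,2,5] ws + W [1,2,3,6] ws
      - W [0,2,3,4] ws - W [1,3,4,5] ws)"
  proof -
    have
    "F 1 3 0 = - W [2,4,5,6] ws" "F 3 1 0 = W [2,4,5,6] ws" "F 2 6 0 = - W [1,3,4,5] ws"
    "F 6 2 0 = W [1,3,4,5] ws" "F 4 5 0 = W [1,2,3,6] ws" "F 5 4 0 = - W [1,2,3,6] ws"
    "F 2 4 1 = W [0,3,5,6] ws" "F 4 2 1 = - W [0,3,5,6] ws" "F 3 0 1 = - W [2,4,5,6] ws"
    "F 0 3 1 = W [2,4,5,6] ws" "F 5 6 1 = - W [0,2,3,4] ws" "F 6 5 1 = W [0,2,3,4] ws"
    "F 3 5 2 = - W [0,1,4,6] ws" "F 5 3 2 = W [0,1,4,6] ws" "F 4 1 2 = W [0,3,5,6] ws"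
    "F 1 4 2 = - W [0,3,5,6] ws" "F 6 0 2 = - W [1,3,4,5] ws" "F 0 6 2 = W [1,3,4,5] ws"
    "F 4 6 3 = W [0,1,2,5] ws" "F 6 4 3 = - W [0,1,2,5] ws" "F 5 2 3 = - W [0,1,4,6] ws"
    "F 2 5 3 = W [0,1,4,6] ws" "F 0 1 3 = - W [2,4,5,6] ws" "F 1 0 3 = W [2,4,5,6] ws"
    "F 5 0 4 = W [1,2,3,6] ws" "F 0 5 4 = - W [1,2,3,6] ws" "F 6 3 4 = W [0,1,2,5] ws"
    "F 3 6 4 = - W [0,1,2,5] ws" "F 1 2 4 = W [0,3,5,6] ws" "F 2 1 4 = - W [0,3,5,6] ws"
    "F 6 1 5 = - W [0,2,3,4] ws" "F 1 6 5 = W [0,2,3,4] ws" "F 0 4 5 = W [1,2,3,6] ws"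
    "F 4 0 5 = - W [1,2,3,6] ws" "F 2 3 5 = - W [0,1,4,6] ws" "F 3 2 5 = W [0,1,4,6] ws"
    "F 0 2 6 = - W [1,3,4,5] ws" "F 2 0 6 = W [1,3,4,5] ws" "F 1 5 6 = - W [0,2,3,4] ws"
    "F 5 1 6 = W [0,2,3,4] ws" "F 3 4 6 = W [0,1,2,5] ws" "F 4 3 6 = - W [0,1,2,5] ws"
      by (simp_all add: F_def W_frame_Cons)
    note F = this
    show ?thesis
      unfolding sum_phi_frame unfolding sum_7 by (simp add: numeral_7_simps F)
  qed
  finally show ?thesis by simp
qed

lemma linear_phi: "linear (\<lambda>z. \<phi> [x, y, z])"
  unfolding phi_coords phi7_def
  by (intro linearI) (simp_all add: linear_add[OF linear_coords] linear_scale[OF linear_coords] inner_simps)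

lemma coords_cross: "coords (sharp g (\<lambda>z. \<phi> [x, y, z])) = cross7 (coords x) (coords y)"
proof (rule vector_eq_rdot[THEN iffD1], rule allI)
  fix u
  obtain z where u: "u = coords z" using surjD[OF surj_coords] by blast
  show "coords (sharp g (\<lambda>z. \<phi> [x, y, z])) \<bullet> u = cross7 (coords x) (coords y) \<bullet> u"
    unfolding u inner_coords sharp[OF linear_phi] unfolding phi_coords phi7_def ..
qed

text \<open>Both sides are sums of products of a minor of (x, y) and a minor of (z, w); once
  skewness has ordered the indices the coefficients agree.\<close>

lemma star_coords_SOME:
  assumes "e = (SOME e. adapted_frame g \<phi> e)"
  shows "star g \<phi> 3 \<phi> [x, y, z, w] = psi7 (coords x) (coords y) (coords z) (coords w)"
proof -
  define m where "m = minor (coords x) (coords y)"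
  define n where "n = minor (coords z) (coords w)"
  have skew: "m i j = - m j i" "n i j = - n j i" for i j
    by (simp_all add: m_def n_def minor_def)
  have W: "W [i, j, k, l] [x, y, z, w] =
    m i j * n k l - m i k * n j l + m i l * n j k + m j k * n i l - m j l * n i k + m k l * n i j" for i j k l
    by (simp add: W_def wedge1_4 m_def n_def minor_def coords_def)
  have c: "cross7 (coords x) (coords y) $ k = m (k+1) (k+3) + m (k+2) (k+6) + m (k+4) (k+5)"
    "cross7 (coords z) (coords w) $ k = n (k+1) (k+3) + n (k+2) (k+6) + n (k+4) (k+5)" for k
    by (simp_all add: cross7_def m_def n_def minor_def)
  show ?thesis
    unfolding star_frame[OF assms] W psi7_def inner_minors m_def[symmetric] n_def[symmetric]
    unfolding inner_7[of "cross7 _ _"] c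
    by (simp add: numeral_7_simps skew[of 1 0] skew[of 2 0] skew[of 3 0] skew[of 4 0] skew[of 5 0] skew[of 6 0] skew[of 2 1] skew[of 3 1] skew[of 4 1] skew[of 5 1] skew[of 6 1]
        skew[of 3 2] skew[of 4 2] skew[of 5 2] skew[of 6 2] skew[of 4 3] skew[of 5 3] skew[of 6 3]
        skew[of 5 4] skew[of 6 4] skew[of 6 5] algebra_simps)
qed

end

text \<open>\<open>star\<close> is evaluated in a chosen adapted frame that may differ from e. But
  \<open>psi7\<close> is built from inner products and the cross product, and both are fixed by g
  and \<phi>.\<close>

lemma (in frame) star_coords:
  "star g \<phi> 3 \<phi> [x, y, z, w] = psi7 (coords x) (coords y) (coords z) (coords w)"
proof -
  define e' where "e' = (SOME e. adapted_frame g \<phi> e)"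
  have "adapted_frame g \<phi> e'" unfolding e'_def by (rule someI[of "adapted_frame g \<phi>", OF adapted])
  then interpret f: frame g \<phi> e' by unfold_locales
  have *: "cross7 (f.coords x) (f.coords y) \<bullet> cross7 (f.coords z) (f.coords w) =
      cross7 (coords x) (coords y) \<bullet> cross7 (coords z) (coords w)"
    unfolding f.coords_cross[symmetric] coords_cross[symmetric] f.inner_coords inner_coords ..
  show ?thesis
    unfolding f.star_coords_SOME[OF e'_def] psi7_def * f.inner_coords inner_coords ..
qed

section \<open>Further identities for the cross product\<close>

lemma cross7_self: "cross7 x x = 0"
  by (simp add: cross7_def Finite_Cartesian_Product.vec_eq_iff)

lemma cross7_orthogonal: "cross7 x y \<bullet> x = 0" "cross7 x y \<bullet> y = 0"
proof -
  have *: "cross7 x y \<bullet> y = 0" for x y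
    using phi7_skew23[of x y y] by (simp add: phi7_def)
  show "cross7 x y \<bullet> y = 0" by (rule *)
  show "cross7 x y \<bullet> x = 0" by (subst cross7_skew) (simp add: *)
qed

lemma inner_cross7_cross7:
  "cross7 x y \<bullet> cross7 x z = (x \<bullet> x) * (y \<bullet> z) - (x \<bullet> y) * (x \<bullet> z)"
proof -
  have "cross7 x y \<bullet> cross7 x z = - (cross7 x (cross7 x y) \<bullet> z)"
    using phi7_cycle[of x z "cross7 x y"] phi7_cycle[of z "cross7 x y" x] phi7_skew12[of "cross7 x y" x z]
    by (simp add: phi7_def inner_commute)
  then show ?thesis
    by (simp add: cross7_cross7 inner_simps)
qed

lemma inner_cross7_polarised:
  "cross7 x y \<bullet> cross7 w z + cross7 w y \<bullet> cross7 x z =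
    2 * (x \<bullet> w) * (y \<bullet> z) - (x \<bullet> y) * (w \<bullet> z) - (w \<bullet> y) * (x \<bullet> z)"
  using inner_cross7_cross7[of "x + w" y z] inner_cross7_cross7[of x y z] inner_cross7_cross7[of w y z]
  by (simp add: cross7_bilinear_simps inner_simps algebra_simps inner_commute)

lemma psi7_skew12: "psi7 x y z w = - psi7 y x z w"
  unfolding psi7_def using cross7_skew[of x y] by simp

lemma psi7_skew34: "psi7 x y z w = - psi7 x y w z"
  unfolding psi7_def using cross7_skew[of z w] by simp

text \<open>The middle exchange is the one that the definition of \<open>psi7\<close> hides; it is
  the polarised norm formula for \<open>cross7\<close>.\<close>

lemma psi7_skew23: "psi7 x y z w = - psi7 x z y w"
proof -
  have "cross7 x y \<bullet> cross7 z w + cross7 x z \<bullet> cross7 y w =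
    - (cross7 y x \<bullet> cross7 z w + cross7 z x \<bullet> cross7 y w)"
    using cross7_skew[of x y] cross7_skew[of x z] by simp
  then show ?thesis
    unfolding psi7_def inner_cross7_polarised by (simp add: inner_commute algebra_simps)
qed

lemma linear_psi7:
  "linear (\<lambda>x. psi7 x y z w)" "linear (\<lambda>y. psi7 x y z w)" "linear (\<lambda>z. psi7 x y z w)" "linear (psi7 x y z)"
  unfolding psi7_def by (auto intro!: linearI simp: cross7_bilinear_simps inner_simps algebra_simps)

lemma linear_phi7: "linear (\<lambda>x. phi7 x y z)" "linear (\<lambda>y. phi7 x y z)" "linear (phi7 x y)"
  unfolding phi7_def by (auto intro!: linearI simp: cross7_bilinear_simps inner_simps algebra_simps)

lemmas phi7_simps = linear_phi7[THEN linear_add] linear_phi7[THEN linear_diff] linear_phi7[THEN linear_scale]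
  linear_phi7[THEN linear_neg] linear_phi7[THEN linear_0]

lemmas psi7_simps = linear_psi7[THEN linear_add] linear_psi7[THEN linear_diff] linear_psi7[THEN linear_scale]
  linear_psi7[THEN linear_neg] linear_psi7[THEN linear_0]

section \<open>Oriented hyperplanes of R^7 and their SU(3)-structure\<close>

locale hyperplane =
  fixes \<sigma> :: "real^6 \<Rightarrow> real^7" and \<nu> :: "real^7"
  assumes linear_\<sigma>: "linear \<sigma>" and inj_\<sigma>: "inj \<sigma>" and \<nu>\<nu>: "\<nu> \<bullet> \<nu> = 1" and \<nu>\<sigma>: "\<nu> \<bullet> \<sigma> x = 0"
begin

lemma \<sigma>\<nu>: "\<sigma> x \<bullet> \<nu> = 0"
  using \<nu>\<sigma>[of x] by (simp add: inner_commute)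

definition G :: "real^6 \<Rightarrow> real^6 \<Rightarrow> real" where "G x y = \<sigma> x \<bullet> \<sigma> y"

lemmas \<sigma>_simps = linear_add[OF linear_\<sigma>] linear_diff[OF linear_\<sigma>] linear_scale[OF linear_\<sigma>]
  linear_neg[OF linear_\<sigma>] linear_0[OF linear_\<sigma>]

lemma \<sigma>_eq_0: "\<sigma> x = 0 \<longleftrightarrow> x = 0"
  using linear_injective_0[OF linear_\<sigma>] inj_\<sigma> \<sigma>_simps(5) by blast

sublocale inner_form G
proof
  show "bilinear G"
    unfolding bilinear_def G_def
    by (intro conjI allI linearI) (simp_all add: \<sigma>_simps inner_simps)
  show "G x y = G y x" for x y by (simp add: G_def inner_commute)
  show "x \<noteq> 0 \<Longrightarrow> G x x > 0" for x by (simp add: G_def \<sigma>_eq_0)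
qed

lemma \<sigma>_surj:
  assumes "\<nu> \<bullet> y = 0"
  obtains x where "\<sigma> x = y"
proof -
  have sub: "range \<sigma> \<subseteq> {y. \<nu> \<bullet> y = 0}" using \<nu>\<sigma> by blast
  have "\<nu> \<noteq> 0" using \<nu>\<nu> by auto
  then have "dim {y. \<nu> \<bullet> y = 0} = 6" by (simp add: dim_hyperplane)
  moreover have "dim (range \<sigma>) = 6"
    using dim_image_eq[OF linear_\<sigma>, of UNIV] inj_\<sigma> by simp
  moreover have "subspace (range \<sigma>)" "subspace {y. \<nu> \<bullet> y = 0}"
    using linear_subspace_image[OF linear_\<sigma> subspace_UNIV] subspace_hyperplane by auto
  ultimately have "range \<sigma> = {y. \<nu> \<bullet> y = 0}"
    using subspace_dim_equal[OF _ _ sub] by simp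
  with assms have "y \<in> range \<sigma>" by blast
  then obtain x where "y = \<sigma> x" ..
  then show ?thesis by (intro that) simp
qed

lemma tangential_part: obtains x where "y = \<sigma> x + (y \<bullet> \<nu>) *\<^sub>R \<nu>"
proof -
  have "\<nu> \<bullet> (y - (y \<bullet> \<nu>) *\<^sub>R \<nu>) = 0" by (simp add: inner_simps \<nu>\<nu> inner_commute)
  then obtain x where "\<sigma> x = y - (y \<bullet> \<nu>) *\<^sub>R \<nu>" by (rule \<sigma>_surj)
  then show ?thesis using that[of x] by simp
qed

text \<open>Parseval in R^7 with the contribution of the missing unit vector \<nu>
  subtracted.\<close>

lemma sum_onb: "(\<Sum>e\<in>onb G. (y \<bullet> \<sigma> e) * (z \<bullet> \<sigma> e)) = y \<bullet> z - (y \<bullet> \<nu>) * (z \<bullet> \<nu>)"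
proof -
  obtain a where a: "y = \<sigma> a + (y \<bullet> \<nu>) *\<^sub>R \<nu>" by (rule tangential_part)
  obtain b where b: "z = \<sigma> b + (z \<bullet> \<nu>) *\<^sub>R \<nu>" by (rule tangential_part)
  have *: "y \<bullet> \<sigma> e = G a e" "z \<bullet> \<sigma> e = G b e" for e
    by (subst a, simp add: G_def inner_simps \<nu>\<sigma>) (subst b, simp add: G_def inner_simps \<nu>\<sigma>)
  have "(\<sigma> a + p *\<^sub>R \<nu>) \<bullet> (\<sigma> b + q *\<^sub>R \<nu>) = G a b + p * q" for p q
    by (simp add: G_def inner_simps \<nu>\<sigma> \<nu>\<nu> inner_commute[of "\<sigma> a" \<nu>])
  from this[of "y \<bullet> \<nu>" "z \<bullet> \<nu>"] have "y \<bullet> z = G a b + (y \<bullet> \<nu>) * (z \<bullet> \<nu>)"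
    unfolding a[symmetric] b[symmetric] .
  then show ?thesis by (simp add: * onb_parseval)
qed

definition J :: "real^6 \<Rightarrow> real^6" where "J x = (THE y. \<sigma> y = cross7 \<nu> (\<sigma> x))"

lemma \<sigma>_J: "\<sigma> (J x) = cross7 \<nu> (\<sigma> x)"
proof -
  have "\<nu> \<bullet> cross7 \<nu> (\<sigma> x) = 0" by (subst inner_commute) (rule cross7_orthogonal)
  then obtain y where "\<sigma> y = cross7 \<nu> (\<sigma> x)" by (rule \<sigma>_surj)
  then have "\<exists>!y. \<sigma> y = cross7 \<nu> (\<sigma> x)" by (auto intro: injD[OF inj_\<sigma>])
  from theI'[OF this] show ?thesis by (simp add: J_def)
qed

definition \<Phi> :: "real^6 \<Rightarrow> real^6 \<Rightarrow> real^6 \<Rightarrow> real" where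
  "\<Phi> x y z = phi7 (\<sigma> x) (\<sigma> y) (\<sigma> z)"

lemma phi7_\<nu>: "phi7 \<nu> (\<sigma> x) (\<sigma> y) = G (J x) y"
  by (simp add: phi7_def G_def \<sigma>_J)

text \<open>Since \<sigma>(J z) is a cross product with \<nu>, \<open>psi7_cross7\<close> applies
  and orthogonality to \<nu> leaves one term. Thus \<phi> and \<nu> contracted with *\<phi> restrict
  to the real and imaginary part of one complex form.\<close>

lemma psi7_\<nu>_J: "psi7 \<nu> (\<sigma> x) (\<sigma> y) (\<sigma> (J z)) = \<Phi> x y z"
  unfolding \<sigma>_J psi7_cross7
  using phi7_cycle[of "\<sigma> z" "\<sigma> x" "\<sigma> y"]
  by (simp add: \<nu>\<nu> \<nu>\<sigma> \<sigma>\<nu> \<Phi>_def phi7_def cross7_self cross7_orthogonal)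

lemma JJ: "J (J x) = - x"
proof -
  have "\<sigma> (J (J x)) = \<sigma> (- x)"
    by (simp add: \<sigma>_J cross7_cross7 \<nu>\<nu> \<nu>\<sigma> \<sigma>_simps)
  then show ?thesis using inj_\<sigma> by (simp add: inj_eq)
qed

lemma linear_J: "linear J"
proof (rule linearI)
  show "J (x + y) = J x + J y" for x y
    using inj_\<sigma> by (rule injD) (simp add: \<sigma>_J \<sigma>_simps cross7_bilinear_simps)
  show "J (r *\<^sub>R x) = r *\<^sub>R J x" for r x
    using inj_\<sigma> by (rule injD) (simp add: \<sigma>_J \<sigma>_simps cross7_bilinear_simps)
qed

lemma psi7_\<nu>: "psi7 \<nu> (\<sigma> x) (\<sigma> y) (\<sigma> z) = - \<Phi> x y (J z)"
  using psi7_\<nu>_J[of x y "J z"] by (simp add: JJ \<sigma>_simps psi7_simps)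

lemma linear_\<Phi>: "linear (\<Phi> x y)"
  unfolding \<Phi>_def by (auto intro!: linearI simp: \<sigma>_simps phi7_simps)

lemma \<Phi>_cycle: "\<Phi> x y z = \<Phi> y z x"
  unfolding \<Phi>_def by (rule phi7_cycle)

lemma \<Phi>_skew: "\<Phi> x y z = - \<Phi> y x z"
  unfolding \<Phi>_def by (rule phi7_skew12)

text \<open>The skewness of \<open>psi7\<close> in its last two slots, read through
  \<open>psi7_\<nu>\<close>.\<close>

lemma \<Phi>_J_swap: "\<Phi> x y (J z) = \<Phi> x (J y) z"
proof -
  have "\<Phi> x y (J z) = - \<Phi> x z (J y)"
    using psi7_skew34[of \<nu> "\<sigma> x" "\<sigma> y" "\<sigma> z"] unfolding psi7_\<nu> by simp
  also have "\<dots> = \<Phi> x (J y) z"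
    unfolding \<Phi>_def by (subst phi7_skew23) (rule minus_minus)
  finally show ?thesis .
qed

lemma GJJ: "G (J x) (J y) = G x y"
  by (simp add: G_def \<sigma>_J inner_cross7_cross7 \<nu>\<nu> \<nu>\<sigma>)

lemma GJ: "G x (J y) = - G (J x) y"
  using GJJ[of x "J y"] by (simp add: JJ simps)

text \<open>Minus one half of \<omega> \<and> \<omega>: the restriction of *\<phi> to the
  hyperplane. Writing \<sigma> w as a cross product with \<nu> reduces it to
  \<open>psi7_cross7\<close>.\<close>

lemma psi7_tangential:
  "psi7 (\<sigma> x) (\<sigma> y) (\<sigma> z) (\<sigma> w) =
    G (J w) x * G (J y) z - G (J w) y * G (J x) z + G (J w) z * G (J x) y"
proof -
  have w: "\<sigma> w = cross7 \<nu> (\<sigma> (- J w))"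
    by (simp add: \<sigma>_J[symmetric] JJ linear_neg[OF linear_J])
  show ?thesis
    unfolding w psi7_cross7
    using phi7_skew12[of "\<sigma> x" \<nu> "\<sigma> z"] phi7_cycle[of "\<sigma> x" "\<sigma> y" \<nu>] phi7_cycle[of "\<sigma> y" \<nu> "\<sigma> x"]
    by (simp add: \<nu>\<sigma> phi7_\<nu> flip: G_def, simp add: simps)
qed

text \<open>The full contraction in R^7 is an inner product of cross products, which
  \<open>psi7\<close> measures. The sum over the hyperplane lacks the normal component, and that is
  a product of two values of \<omega>.\<close>

lemma \<Phi>_contract: "(\<Sum>e\<in>onb G. \<Phi> x y e * \<Phi> z w e) =
    G x z * G y w - G x w * G y z - G x (J z) * G y (J w) + G x (J w) * G y (J z)"
proof -
  have \<nu>: "cross7 (\<sigma> x) (\<sigma> y) \<bullet> \<nu> = G (J x) y" for x y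
    using phi7_cycle[of \<nu> "\<sigma> x" "\<sigma> y"] phi7_\<nu>[of x y] by (simp add: phi7_def)
  have "cross7 (\<sigma> x) (\<sigma> y) \<bullet> cross7 (\<sigma> z) (\<sigma> w) =
      G x z * G y w - G x w * G y z - psi7 (\<sigma> x) (\<sigma> y) (\<sigma> z) (\<sigma> w)"
    by (simp add: psi7_def G_def)
  then have A: "(\<Sum>e\<in>onb G. \<Phi> x y e * \<Phi> z w e) = G x z * G y w - G x w * G y z
      - (G (J w) x * G (J y) z - G (J w) y * G (J x) z + G (J w) z * G (J x) y) - G (J x) y * G (J z) w"
    unfolding \<Phi>_def phi7_def sum_onb \<nu> psi7_tangential by simp
  have *: "G (J x) y = - G x (J y)" for x y by (simp only: GJ minus_minus)
  have **: "G (J z) w = - G (J w) z" unfolding *[of z w] by (simp only: sym)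
  show ?thesis
    using A unfolding ** sym[of "J w" x] *[of y z] sym[of "J w" y] *[of x z] by (simp add: mult.commute)
qed

sublocale H: su3 G J \<Phi>
proof (rule su3.intro[OF inner_form_axioms su3_axioms.intro])
  show "\<Phi> (J x) y z = \<Phi> x (J y) z" for x y z
    using \<Phi>_cycle[of "J x" y z] \<Phi>_J_swap[of y z x] \<Phi>_J_swap[of x y z] \<Phi>_cycle[of x y "J z"] \<Phi>_cycle[of y "J z" x]
    by simp
qed (rule linear_J JJ GJJ linear_\<Phi> \<Phi>_cycle \<Phi>_skew \<Phi>_contract)+

end

text \<open>The second fundamental form is \<open>G (\<beta> x) y\<close>, and \<open>P\<close> is the vector \<open>p\<^sub>\<phi>\<close> of a structure of
  type \<open>\<X>\<^sub>4\<close>.\<close>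

locale X4_hyperplane = hyperplane \<sigma> \<nu> for \<sigma> \<nu> +
  fixes \<beta> :: "real^6 \<Rightarrow> real^6" and P :: "real^7" and \<theta> :: real
    and \<psi> :: "(real^6) tensor" and \<alpha> :: "real^6 \<Rightarrow> real^6 \<Rightarrow> real^6 \<Rightarrow> real"
  assumes linear_\<beta>: "linear \<beta>" and \<beta>_sym: "G (\<beta> x) y = G x (\<beta> y)"
    and \<psi>: "\<psi> [x, y, z] = cos \<theta> * \<Phi> x y z - sin \<theta> * psi7 \<nu> (\<sigma> x) (\<sigma> y) (\<sigma> z)"
    and \<alpha>: "\<alpha> x y z = \<Phi> (\<beta> x) y z + 1 / 12 * psi7 (cross7 P (\<sigma> x)) \<nu> (\<sigma> y) (\<sigma> z)"
begin

text \<open>Normalised so that composing \<tau> with J gives one twelfth of the tangential part of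
  P, see \<open>inner_P\<close>.\<close>

definition \<tau> :: "real^6 \<Rightarrow> real" where "\<tau> z = 1 / 12 * phi7 \<nu> P (\<sigma> z)"

definition h :: real where "h = 1 / 6 * metric_trace G (\<lambda>x y. G (\<beta> x) y)"

lemma linear_\<tau>: "linear \<tau>"
  unfolding \<tau>_def by (auto intro!: linearI simp: \<sigma>_simps phi7_simps algebra_simps)

lemma inner_P: "P \<bullet> \<sigma> z = 12 * \<tau> (J z)"
  by (simp add: \<tau>_def phi7_def \<sigma>_J inner_cross7_cross7 \<nu>\<nu> \<nu>\<sigma>)

text \<open>After the cross product with P is moved to the last slot, \<open>psi7_cross7\<close>
  splits it: the normal component of P multiplies \<Phi>, and its tangential part assembles into a
  form in W4.\<close>

lemma \<alpha>_eq: "\<alpha> x y z = \<Phi> (\<beta> x) y z - (P \<bullet> \<nu>) / 12 * \<Phi> x y z + H.W4_form \<tau> x y z"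
proof -
  have "psi7 (cross7 P (\<sigma> x)) \<nu> (\<sigma> y) (\<sigma> z) = - psi7 \<nu> (\<sigma> y) (\<sigma> z) (cross7 P (\<sigma> x))"
    using psi7_skew12[of "cross7 P (\<sigma> x)" \<nu> "\<sigma> y" "\<sigma> z"] psi7_skew23[of \<nu> "cross7 P (\<sigma> x)" "\<sigma> y" "\<sigma> z"]
      psi7_skew34[of \<nu> "\<sigma> y" "cross7 P (\<sigma> x)" "\<sigma> z"] by linarith
  also have "\<dots> = - ((P \<bullet> \<nu>) * \<Phi> x y z + 12 * \<tau> (J y) * G (J x) z + 12 * \<tau> (J z) * G (J y) x
      - G x y * (12 * \<tau> z) + G x z * (12 * \<tau> y))"
    unfolding psi7_cross7 inner_P \<sigma>\<nu>
    using phi7_skew23[of \<nu> "\<sigma> y" P]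
    by (simp add: phi7_\<nu> \<Phi>_def \<tau>_def G_def)
  also have "\<dots> = 12 * (H.W4_form \<tau> x y z - (P \<bullet> \<nu>) / 12 * \<Phi> x y z)"
    unfolding H.W4_form_def GJ[of x z] sym[of x "J y"] by (simp add: algebra_simps)
  finally show ?thesis unfolding \<alpha> by simp
qed

sublocale T: su3_torsion G J \<Phi> "cos \<theta>" "sin \<theta>" \<psi> \<beta> h "(P \<bullet> \<nu>) / 12" \<tau> \<alpha>
proof (intro su3_torsion.intro su3_angle.intro H.su3_axioms su3_angle_axioms.intro su3_torsion_axioms.intro)
  show "(cos \<theta>)\<^sup>2 + (sin \<theta>)\<^sup>2 = 1" by simp
  show "\<psi> [x, y, z] = \<Phi> (cos \<theta> *\<^sub>R x + sin \<theta> *\<^sub>R J x) y z" for x y z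
    unfolding \<psi> psi7_\<nu> using H.\<Phi>_J13[of x y z] by (simp add: H.\<Phi>_simps)
  show "metric_trace G (\<lambda>x y. G (\<beta> x) y) = 6 * h" by (simp add: h_def)
qed (rule linear_\<beta> \<beta>_sym linear_\<tau> \<alpha>_eq)+

text \<open>The twists of \<Phi> by \<beta> and by the identity are trace-free, so the
  codifferential sees only the W4 part.\<close>

lemma codifferential: "- metric_trace G (\<lambda>e e'. \<alpha> e e' z) = - 4 * \<tau> z"
proof -
  have "\<Phi> e e z = 0" for e
    using \<Phi>_skew[of e e z] by simp
  then show ?thesis
    unfolding metric_trace_def \<alpha>_eq
    by (simp add: sum.distrib sum_subtractf H.sym_trace_zero[OF linear_\<beta> \<beta>_sym] H.W4_form_trace[OF linear_\<tau>])
qed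

lemma P_normal_iff: "P - (P \<bullet> \<nu>) *\<^sub>R \<nu> = 0 \<longleftrightarrow> (\<forall>z. \<tau> z = 0)"
proof
  assume "P - (P \<bullet> \<nu>) *\<^sub>R \<nu> = 0"
  then have "P = (P \<bullet> \<nu>) *\<^sub>R \<nu>" by simp
  then show "\<forall>z. \<tau> z = 0"
    unfolding \<tau>_def phi7_def by (metis cross7_bilinear_simps(8) cross7_self inner_zero_left mult_zero_right scaleR_zero_right)
next
  assume *: "\<forall>z. \<tau> z = 0"
  obtain a where a: "P = \<sigma> a + (P \<bullet> \<nu>) *\<^sub>R \<nu>" by (rule tangential_part)
  have "(\<sigma> a + q *\<^sub>R \<nu>) \<bullet> \<sigma> a = G a a" for q
    by (simp add: G_def inner_simps \<nu>\<sigma>)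
  from this[of "P \<bullet> \<nu>"] have "G a a = 0"
    unfolding a[symmetric] by (simp add: inner_P *)
  then have "\<sigma> a = 0" by (simp add: eq_zero_iff \<sigma>_simps)
  with a show "P - (P \<bullet> \<nu>) *\<^sub>R \<nu> = 0" by simp
qed

end

section \<open>Contractions over an orthonormal basis of R^7\<close>

lemma cross7_cross7_left: "cross7 (cross7 y x) x = (x \<bullet> y) *\<^sub>R x - (x \<bullet> x) *\<^sub>R y"
  using cross7_cross7[of x y] cross7_skew[of y x] cross7_skew[of "cross7 x y" x]
  by (simp add: cross7_bilinear_simps)

lemma inner_cross7_same: "cross7 a j \<bullet> cross7 b j = (j \<bullet> j) * (a \<bullet> b) - (a \<bullet> j) * (b \<bullet> j)"
  using inner_cross7_cross7[of j a b] cross7_skew[of a j] cross7_skew[of b j]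
  by (simp add: inner_commute)

locale parseval_basis =
  fixes E :: "(real^7) set"
  assumes parseval: "(\<Sum>e\<in>E. (x \<bullet> e) * (y \<bullet> e)) = x \<bullet> y" and norms: "(\<Sum>e\<in>E. e \<bullet> e) = 7"
    and expansion: "(\<Sum>e\<in>E. (x \<bullet> e) *\<^sub>R e) = x"
begin

lemma linear_sum_E:
  assumes "linear f"
  shows "(\<Sum>e\<in>E. (x \<bullet> e) * f e) = (f x :: real)"
proof -
  have "f x = f (\<Sum>e\<in>E. (x \<bullet> e) *\<^sub>R e)" by (simp add: expansion)
  then show ?thesis using assms by (simp add: linear_sum linear_scale)
qed

lemma psi7_contract1:
  "(\<Sum>k\<in>E. psi7 t i j k * psi7 y i j k) =
    (t \<bullet> j) * (y \<bullet> j) * (i \<bullet> i) - (t \<bullet> j) * (i \<bullet> j) * (i \<bullet> y) - (t \<bullet> j) * (cross7 (cross7 y i) j \<bullet> i)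
    - (i \<bullet> j) * (y \<bullet> j) * (i \<bullet> t) + (i \<bullet> j) * (i \<bullet> j) * (t \<bullet> y) + (i \<bullet> j) * (cross7 (cross7 y i) j \<bullet> t)
    - (y \<bullet> j) * (cross7 (cross7 t i) j \<bullet> i) + (i \<bullet> j) * (cross7 (cross7 t i) j \<bullet> y)
    + (j \<bullet> j) * (cross7 t i \<bullet> cross7 y i) - (cross7 t i \<bullet> j) * (cross7 y i \<bullet> j)"
proof -
  \<comment> \<open>As a function of k this is the inner product with a vector, so the sum over k is
    Parseval.\<close>
  have vec: "psi7 x i j k = ((x \<bullet> j) *\<^sub>R i - (i \<bullet> j) *\<^sub>R x - cross7 (cross7 x i) j) \<bullet> k" for x k
    using phi7_cycle[of "cross7 x i" j k]
    by (simp add: psi7_def phi7_def inner_simps inner_commute[of "cross7 x i"])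
  show ?thesis
    unfolding vec parseval
    by (simp only: inner_diff_left inner_diff_right inner_scaleR_left inner_scaleR_right inner_cross7_same)
       (simp add: inner_commute algebra_simps)
qed

lemma psi7_contract2:
  "(\<Sum>j\<in>E. \<Sum>k\<in>E. psi7 t i j k * psi7 y i j k) = 4 * ((i \<bullet> i) * (t \<bullet> y) - (t \<bullet> i) * (y \<bullet> i))"
proof -
  have L: "linear (\<lambda>j. cross7 a j \<bullet> b)" for a b
    by (intro linearI) (simp_all add: cross7_bilinear_simps inner_simps)
  have S: "(\<Sum>j\<in>E. (a \<bullet> j) * (cross7 b j \<bullet> d)) = cross7 b a \<bullet> d" for a b d
    by (rule linear_sum_E[OF L])
  have Q: "cross7 (cross7 a i) b \<bullet> i = cross7 a i \<bullet> cross7 b i" for a b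
    using phi7_cycle[of "cross7 a i" b i] by (simp add: phi7_def inner_commute)
  have "(\<Sum>j\<in>E. \<Sum>k\<in>E. psi7 t i j k * psi7 y i j k) =
    (t \<bullet> y) * (i \<bullet> i) - (t \<bullet> i) * (i \<bullet> y) - cross7 (cross7 y i) t \<bullet> i
    - (i \<bullet> y) * (i \<bullet> t) + (i \<bullet> i) * (t \<bullet> y) + cross7 (cross7 y i) i \<bullet> t
    - cross7 (cross7 t i) y \<bullet> i + cross7 (cross7 t i) i \<bullet> y
    + 7 * (cross7 t i \<bullet> cross7 y i) - cross7 t i \<bullet> cross7 y i"
    unfolding psi7_contract1
    by (simp only: sum.distrib sum_subtractf sum_distrib_right[symmetric] parseval S norms)
  also have "\<dots> = 4 * ((i \<bullet> i) * (t \<bullet> y) - (t \<bullet> i) * (y \<bullet> i))"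
    unfolding Q cross7_cross7_left inner_cross7_same by (simp add: inner_simps inner_commute algebra_simps)
  finally show ?thesis .
qed

text \<open>Here 24 = 4 (7 - 1). Divided by 3!, it says that contracting *\<phi> with t and with y
  gives three-forms of inner product 4 (t \<bullet> y).\<close>

lemma psi7_contract3: "(\<Sum>i\<in>E. \<Sum>j\<in>E. \<Sum>k\<in>E. psi7 t i j k * psi7 y i j k) = 24 * (t \<bullet> y)"
  unfolding psi7_contract2
  by (simp add: sum_subtractf parseval norms flip: sum_distrib_left sum_distrib_right)

text \<open>A skew \<kappa> is half the sum of the elementary rotations given by e and \<kappa> e.
  By \<open>psi7_cross7\<close> it moves \<phi> through half the sum of the vectors
  \<open>cross7 e (\<kappa> e)\<close>; the minus sign of the witness comes from moving that vector
  from the last slot to the first.\<close>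

lemma skew_phi7:
  assumes \<kappa>: "linear \<kappa>" and skew: "\<And>x y. \<kappa> x \<bullet> y = - (x \<bullet> \<kappa> y)"
  shows "\<exists>t. \<forall>a b c. phi7 (\<kappa> a) b c + phi7 a (\<kappa> b) c + phi7 a b (\<kappa> c) = psi7 t a b c"
proof (intro exI allI)
  fix a b c
  have lin: "linear (\<lambda>e. phi7 (\<kappa> e) b c)" "linear (\<lambda>e. phi7 a (\<kappa> e) c)" "linear (\<lambda>e. phi7 a b (\<kappa> e))"
    for a b c
    by (intro linearI; simp add: linear_add[OF \<kappa>] linear_scale[OF \<kappa>] phi7_simps)+
  have "psi7 a b c (\<Sum>e\<in>E. cross7 e (\<kappa> e)) = (\<Sum>e\<in>E. psi7 a b c (cross7 e (\<kappa> e)))"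
    by (rule linear_sum[OF linear_psi7(4)])
  also have "\<dots> = (\<Sum>e\<in>E. (a \<bullet> e) * phi7 (\<kappa> e) b c + (b \<bullet> e) * phi7 a (\<kappa> e) c + (c \<bullet> e) * phi7 a b (\<kappa> e)
    + (\<kappa> a \<bullet> e) * phi7 e b c + (\<kappa> b \<bullet> e) * phi7 a e c + (\<kappa> c \<bullet> e) * phi7 a b e)"
  proof (intro sum.cong refl)
    fix e
    have sk: "\<kappa> e \<bullet> u = - (\<kappa> u \<bullet> e)" for u
      using skew[of e u] inner_commute[of e "\<kappa> u"] by simp
    show "psi7 a b c (cross7 e (\<kappa> e)) =
      (a \<bullet> e) * phi7 (\<kappa> e) b c + (b \<bullet> e) * phi7 a (\<kappa> e) c + (c \<bullet> e) * phi7 a b (\<kappa> e)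
      + (\<kappa> a \<bullet> e) * phi7 e b c + (\<kappa> b \<bullet> e) * phi7 a e c + (\<kappa> c \<bullet> e) * phi7 a b e"
      unfolding psi7_cross7 sk[of a] sk[of b] sk[of c] inner_commute[of e a] inner_commute[of e b] inner_commute[of e c]
      by simp
  qed
  also have "\<dots> = 2 * (phi7 (\<kappa> a) b c + phi7 a (\<kappa> b) c + phi7 a b (\<kappa> c))"
    by (simp only: sum.distrib linear_sum_E[OF lin(1)] linear_sum_E[OF lin(2)] linear_sum_E[OF lin(3)]
        linear_sum_E[OF linear_phi7(1)] linear_sum_E[OF linear_phi7(2)] linear_sum_E[OF linear_phi7(3)]) simp
  finally have "phi7 (\<kappa> a) b c + phi7 a (\<kappa> b) c + phi7 a b (\<kappa> c) = 1/2 * psi7 a b c (\<Sum>e\<in>E. cross7 e (\<kappa> e))"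
    by simp
  also have "psi7 a b c s = - psi7 s a b c" for s
    using psi7_skew34[of a b c s] psi7_skew23[of a b s c] psi7_skew12[of a s b c] by linarith
  finally show "phi7 (\<kappa> a) b c + phi7 a (\<kappa> b) c + phi7 a b (\<kappa> c) =
      psi7 ((- 1/2) *\<^sub>R (\<Sum>e\<in>E. cross7 e (\<kappa> e))) a b c"
    unfolding psi7_simps by simp
qed

text \<open>The factor 1/24 is the 1/4 of \<open>r_bar\<close> times the 1/3! of
  \<open>form_inner\<close>, and it cancels the 24 of \<open>psi7_contract3\<close>. So r determines
  the vector t of \<open>skew_phi7\<close>, and with it the whole derivative of \<phi>.\<close>

lemma X4_skew_phi7:
  assumes \<kappa>: "linear \<kappa>" "\<And>x y. \<kappa> x \<bullet> y = - (x \<bullet> \<kappa> y)"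
    and r: "\<And>y. 1 / 24 * (\<Sum>i\<in>E. \<Sum>j\<in>E. \<Sum>k\<in>E.
      (phi7 (\<kappa> i) j k + phi7 i (\<kappa> j) k + phi7 i j (\<kappa> k)) * psi7 y i j k) = - 1 / 12 * phi7 P X y"
  shows "phi7 (\<kappa> a) b c + phi7 a (\<kappa> b) c + phi7 a b (\<kappa> c) = - 1 / 12 * psi7 (cross7 P X) a b c"
proof -
  obtain t where t: "\<And>a b c. phi7 (\<kappa> a) b c + phi7 a (\<kappa> b) c + phi7 a b (\<kappa> c) = psi7 t a b c"
    using skew_phi7[OF \<kappa>] by (elim exE) simp
  have "t \<bullet> y = ((- 1 / 12) *\<^sub>R cross7 P X) \<bullet> y" for y
    using r[of y] unfolding t psi7_contract3 by (simp add: phi7_def)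
  then have "t = (- 1 / 12) *\<^sub>R cross7 P X" by (rule vector_eq_rdot[THEN iffD1, OF allI])
  then show ?thesis unfolding t by (simp add: psi7_simps)
qed

end

section \<open>The pairing of \<nabla>\<psi>_+ with \<psi>_-\<close>

context su3 begin

lemma sum_cycle3: "(\<Sum>e\<in>S. \<Sum>f\<in>S. \<Sum>k\<in>S. F f k e) = (\<Sum>e\<in>S. \<Sum>f\<in>S. \<Sum>k\<in>S. F e f k :: real)"
proof -
  have "(\<Sum>e\<in>S. \<Sum>f\<in>S. \<Sum>k\<in>S. F f k e) = (\<Sum>f\<in>S. \<Sum>e\<in>S. \<Sum>k\<in>S. F f k e)"
    by (rule sum.swap)
  also have "\<dots> = (\<Sum>f\<in>S. \<Sum>k\<in>S. \<Sum>e\<in>S. F f k e)"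
    by (intro sum.cong refl sum.swap)
  finally show ?thesis .
qed

text \<open>The first factor is a multiple of \<psi>_-, plus the action of A on \<psi>_+, plus the
  wedge of \<mu> with \<omega> up to sign. Against \<psi>_- the first part gives 24 = 6 * 4, the
  three slots of the second contribute equally, and the last vanishes; c and s drop out of the
  result.\<close>

lemma rotated_pairing:
  assumes A: "linear A" and cs: "c\<^sup>2 + s\<^sup>2 = 1"
  shows "(\<Sum>e\<in>onb G. \<Sum>f\<in>onb G. \<Sum>k\<in>onb G.
      (t * \<Phi> (s *\<^sub>R e - c *\<^sub>R J e) f k
        + (\<Phi> (c *\<^sub>R A e + s *\<^sub>R J (A e)) f k + \<Phi> (c *\<^sub>R e + s *\<^sub>R J e) (A f) k + \<Phi> (c *\<^sub>R e + s *\<^sub>R J e) f (A k))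
        + (\<mu> e * G (J f) k + \<mu> f * G (J k) e + \<mu> k * G (J e) f))
      * \<Phi> (s *\<^sub>R e - c *\<^sub>R J e) f k) = 24 * t - 12 * (\<Sum>e\<in>onb G. G (A e) (J e))"
proof -
  define R where "R x = c *\<^sub>R x + s *\<^sub>R J x" for x
  define m where "m x y z = \<Phi> (s *\<^sub>R x - c *\<^sub>R J x) y z" for x y z
  let ?S = "\<lambda>F. \<Sum>e\<in>onb G. \<Sum>f\<in>onb G. \<Sum>k\<in>onb G. F e f k :: real"
  have cyc: "\<Phi> (a *\<^sub>R x + b *\<^sub>R J x) y z = \<Phi> (a *\<^sub>R y + b *\<^sub>R J y) z x" for a b x y z
    using \<Phi>_cycle[of x y z] \<Phi>_J[of x y z] \<Phi>_cycle[of x "J y" z] by (simp add: \<Phi>_simps)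
  have m_cyc: "m x y z = m y z x" for x y z
    unfolding m_def using cyc[of s x "- c" y z] by simp
  have R_cyc: "\<Phi> (R x) y z = \<Phi> (R y) z x" for x y z
    unfolding R_def by (rule cyc)
  have norm: "G e e = 1" if "e \<in> onb G" for e
    using onb(1) that by (auto simp: orthonormal_def)
  have mm: "?S (\<lambda>e f k. m e f k * m e f k) = 24"
  proof -
    have "G (s *\<^sub>R e - c *\<^sub>R J e) (s *\<^sub>R e - c *\<^sub>R J e) = (c\<^sup>2 + s\<^sup>2) * G e e" for e
      using GJ_self[of e] sym[of e "J e"] by (simp add: simps GJJ algebra_simps power2_eq_square)
    then show ?thesis unfolding m_def \<Phi>_contract2 by (simp add: cs norm onb)
  qed
  have 1: "?S (\<lambda>e f k. \<Phi> (R (A e)) f k * m e f k) = - 4 * (\<Sum>e\<in>onb G. G (A e) (J e))"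
  proof -
    have "G (R (A e)) (s *\<^sub>R e - c *\<^sub>R J e) = - ((c\<^sup>2 + s\<^sup>2) * G (A e) (J e))" for e
      using GJ[of "A e" e] by (simp add: R_def simps GJJ algebra_simps power2_eq_square)
    then show ?thesis unfolding m_def \<Phi>_contract2 by (simp add: cs sum_negf flip: sum_distrib_left)
  qed
  have cycle: "?S F2 = ?S F1 \<and> ?S F3 = ?S F1"
    if "\<And>e f k. F2 e f k = F1 f k e" "\<And>e f k. F3 e f k = F1 k e f" for F1 F2 F3
    using sum_cycle3[of F1 "onb G"] sum_cycle3[of "\<lambda>e f k. F1 f k e" "onb G"] by (simp only: that)
  have 2: "?S (\<lambda>e f k. \<Phi> (R e) (A f) k * m e f k) = ?S (\<lambda>e f k. \<Phi> (R (A e)) f k * m e f k) \<and>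
    ?S (\<lambda>e f k. \<Phi> (R e) f (A k) * m e f k) = ?S (\<lambda>e f k. \<Phi> (R (A e)) f k * m e f k)"
  proof (rule cycle)
    fix e f k
    show "\<Phi> (R e) (A f) k * m e f k = \<Phi> (R (A f)) k e * m f k e"
      by (simp only: R_cyc[of e "A f" k] m_cyc[of e f k])
    show "\<Phi> (R e) f (A k) * m e f k = \<Phi> (R (A k)) e f * m k e f"
      by (simp only: R_cyc[of "A k" e f] m_cyc[of k e f])
  qed
  \<comment> \<open>Summing over k puts J f into that slot. The value at (f, J f) is zero, since
    moving J from one slot to the other preserves it and exchanging the slots changes its
    sign.\<close>
  have 4: "?S (\<lambda>e f k. \<mu> e * G (J f) k * m e f k) = 0"
  proof -
    have "(\<Sum>k\<in>onb G. \<mu> e * G (J f) k * m e f k) = 0" for e f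
    proof -
      have "(\<Sum>k\<in>onb G. G (J f) k * m e f k) = m e f (J f)"
        unfolding m_def by (rule linear_onb_sum[OF linear_\<Phi>])
      also have "\<dots> = 0"
        using \<Phi>_J13[of "s *\<^sub>R e - c *\<^sub>R J e" f f] \<Phi>_J[of "s *\<^sub>R e - c *\<^sub>R J e" f f]
          \<Phi>_skew23[of "s *\<^sub>R e - c *\<^sub>R J e" f "J f"] unfolding m_def by linarith
      finally show ?thesis by (simp add: mult.assoc flip: sum_distrib_left)
    qed
    then show ?thesis by simp
  qed
  have 5: "?S (\<lambda>e f k. \<mu> f * G (J k) e * m e f k) = ?S (\<lambda>e f k. \<mu> e * G (J f) k * m e f k) \<and>
    ?S (\<lambda>e f k. \<mu> k * G (J e) f * m e f k) = ?S (\<lambda>e f k. \<mu> e * G (J f) k * m e f k)"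
  proof (rule cycle)
    fix e f k
    show "\<mu> f * G (J k) e * m e f k = \<mu> f * G (J k) e * m f k e" by (simp only: m_cyc[of e f k])
    show "\<mu> k * G (J e) f * m e f k = \<mu> k * G (J e) f * m k e f" by (simp only: m_cyc[of k e f])
  qed
  have "?S (\<lambda>e f k. (t * m e f k + (\<Phi> (R (A e)) f k + \<Phi> (R e) (A f) k + \<Phi> (R e) f (A k))
        + (\<mu> e * G (J f) k + \<mu> f * G (J k) e + \<mu> k * G (J e) f)) * m e f k) =
    t * ?S (\<lambda>e f k. m e f k * m e f k)
    + (?S (\<lambda>e f k. \<Phi> (R (A e)) f k * m e f k) + ?S (\<lambda>e f k. \<Phi> (R e) (A f) k * m e f k)
       + ?S (\<lambda>e f k. \<Phi> (R e) f (A k) * m e f k))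
    + (?S (\<lambda>e f k. \<mu> e * G (J f) k * m e f k) + ?S (\<lambda>e f k. \<mu> f * G (J k) e * m e f k)
       + ?S (\<lambda>e f k. \<mu> k * G (J e) f * m e f k))"
    by (simp only: distrib_right sum.distrib sum_distrib_left mult.assoc)
  also have "\<dots> = 24 * t - 12 * (\<Sum>e\<in>onb G. G (A e) (J e))"
    using 2 5 by (simp only: mm 1 4)
  finally show ?thesis unfolding m_def R_def .
qed

end

context X4_hyperplane begin

lemma psi7_\<sigma>_1: "psi7 (\<sigma> m) (\<sigma> x) (\<sigma> y) (\<sigma> z) =
    - (G (J m) x * G (J y) z + G (J m) y * G (J z) x + G (J m) z * G (J x) y)"
proof -
  have "psi7 (\<sigma> m) (\<sigma> x) (\<sigma> y) (\<sigma> z) = - psi7 (\<sigma> x) (\<sigma> y) (\<sigma> z) (\<sigma> m)"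
    using psi7_skew12[of "\<sigma> m" "\<sigma> x" "\<sigma> y" "\<sigma> z"] psi7_skew23[of "\<sigma> x" "\<sigma> m" "\<sigma> y" "\<sigma> z"]
      psi7_skew34[of "\<sigma> x" "\<sigma> y" "\<sigma> m" "\<sigma> z"] by linarith
  moreover have "G (J x) z = - G (J z) x"
    using GJ[of x z] sym[of x "J z"] GJ[of z x] sym[of z "J x"] by linarith
  ultimately show ?thesis unfolding psi7_tangential by simp
qed

text \<open>K and N are the connection parts of the derivatives of \<sigma> and \<nu>. The normal
  component of K and the tangential vector N contribute only wedges of one-forms with \<omega>,
  which the pairing kills; \<beta> disappears with them, and the tangential block A of \<kappa>
  remains.\<close>

lemma covariant_pairing:
  fixes \<kappa> :: "real^7 \<Rightarrow> real^7"
  assumes \<kappa>: "linear \<kappa>" "\<And>x y. \<kappa> x \<bullet> y = - (x \<bullet> \<kappa> y)"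
    and \<kappa>\<phi>: "\<And>a b c. phi7 (\<kappa> a) b c + phi7 a (\<kappa> b) c + phi7 a b (\<kappa> c) = - 1 / 12 * psi7 (cross7 P (\<sigma> u)) a b c"
    and K: "\<And>v. K v = \<kappa> (\<sigma> v) + G (\<beta> u) v *\<^sub>R \<nu>" and N: "N = \<kappa> \<nu> - \<sigma> (\<beta> u)"
    and D: "\<And>x y z. D x y z =
      cos \<theta> * (phi7 (K x) (\<sigma> y) (\<sigma> z) + phi7 (\<sigma> x) (K y) (\<sigma> z) + phi7 (\<sigma> x) (\<sigma> y) (K z))
      - sin \<theta> * (psi7 N (\<sigma> x) (\<sigma> y) (\<sigma> z) + psi7 \<nu> (K x) (\<sigma> y) (\<sigma> z)
          + psi7 \<nu> (\<sigma> x) (K y) (\<sigma> z) + psi7 \<nu> (\<sigma> x) (\<sigma> y) (K z)) - d * M x y z"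
    and M: "\<And>x y z. M x y z = sin \<theta> * \<Phi> x y z + cos \<theta> * psi7 \<nu> (\<sigma> x) (\<sigma> y) (\<sigma> z)"
  shows "(\<Sum>e\<in>onb G. \<Sum>f\<in>onb G. \<Sum>k\<in>onb G. D e f k * M e f k) = - 24 * d - 24 * \<tau> u"
proof -
  define a where "a v = \<nu> \<bullet> \<kappa> (\<sigma> v)" for v
  have "\<exists>w. \<sigma> w = \<kappa> (\<sigma> v) - a v *\<^sub>R \<nu>" for v
  proof -
    have "\<nu> \<bullet> (\<kappa> (\<sigma> v) - a v *\<^sub>R \<nu>) = 0" by (simp add: a_def inner_simps \<nu>\<nu>)
    then show ?thesis by (metis \<sigma>_surj)
  qed
  then obtain A where A: "\<And>v. \<sigma> (A v) = \<kappa> (\<sigma> v) - a v *\<^sub>R \<nu>" by metis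
  have linear_A: "linear A"
    by (rule linearI; rule injD[OF inj_\<sigma>])
       (simp_all add: A \<sigma>_simps a_def linear_add[OF \<kappa>(1)] linear_scale[OF \<kappa>(1)] inner_simps algebra_simps)
  have "\<nu> \<bullet> \<kappa> \<nu> = 0" using \<kappa>(2)[of \<nu> \<nu>] inner_commute[of \<nu> "\<kappa> \<nu>"] by simp
  then obtain q where q: "\<sigma> q = \<kappa> \<nu>" by (rule \<sigma>_surj)
  have \<kappa>\<sigma>: "\<kappa> (\<sigma> v) = \<sigma> (A v) + a v *\<^sub>R \<nu>" for v by (simp add: A)
  have phi_\<nu>: "phi7 \<nu> (\<sigma> x) (\<sigma> y) = G (J x) y" "phi7 (\<sigma> y) \<nu> (\<sigma> x) = G (J x) y" "phi7 (\<sigma> x) (\<sigma> y) \<nu> = G (J x) y" for x y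
    using phi7_\<nu>[of x y] phi7_cycle[of \<nu> "\<sigma> x" "\<sigma> y"] phi7_cycle[of "\<sigma> y" \<nu> "\<sigma> x"] by simp_all
  have psi_\<nu>\<nu>: "psi7 \<nu> \<nu> x y = 0" "psi7 \<nu> x \<nu> y = 0" "psi7 \<nu> x y \<nu> = 0" for x y
    using psi7_skew12[of \<nu> \<nu> x y] psi7_skew23[of \<nu> x \<nu> y] psi7_skew34[of \<nu> x y \<nu>]
      psi7_skew12[of \<nu> \<nu> y x] psi7_skew12[of \<nu> \<nu> x y] psi7_skew23[of \<nu> x \<nu> y] psi7_skew12[of \<nu> \<nu> x y] by linarith+
  have psi_\<nu>: "psi7 \<nu> (\<sigma> x) (\<sigma> y) (\<sigma> z) = - \<Phi> (J x) y z" for x y z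
    unfolding psi7_\<nu> using H.\<Phi>_J13[of x y z] by simp
  obtain r where r: "cross7 P (\<sigma> u) = \<sigma> r + (cross7 P (\<sigma> u) \<bullet> \<nu>) *\<^sub>R \<nu>" by (rule tangential_part)
  have c: "cross7 P (\<sigma> u) \<bullet> \<nu> = 12 * \<tau> u"
    using phi7_cycle[of P "\<sigma> u" \<nu>] phi7_cycle[of "\<sigma> u" \<nu> P] by (simp add: \<tau>_def phi7_def)
  \<comment> \<open>For c = 1 and s = 0 the equation for \<phi> on tangent vectors says that the
    form in \<open>rotated_pairing\<close> with t = \<tau> u is zero; hence 24 \<tau>(u) is 12 times
    the trace.\<close>
  have trace_A: "(\<Sum>e\<in>onb G. G (A e) (J e)) = 2 * \<tau> u"
  proof -
    define \<mu> where "\<mu> v = a v - 1 / 12 * G (J r) v" for v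
    have "\<tau> u * \<Phi> (0 *\<^sub>R x - 1 *\<^sub>R J x) y z
        + (\<Phi> (1 *\<^sub>R A x + 0 *\<^sub>R J (A x)) y z + \<Phi> (1 *\<^sub>R x + 0 *\<^sub>R J x) (A y) z + \<Phi> (1 *\<^sub>R x + 0 *\<^sub>R J x) y (A z))
        + (\<mu> x * G (J y) z + \<mu> y * G (J z) x + \<mu> z * G (J x) y) = 0" for x y z
    proof -
      have "psi7 (cross7 P (\<sigma> u)) (\<sigma> x) (\<sigma> y) (\<sigma> z) =
        - (G (J r) x * G (J y) z + G (J r) y * G (J z) x + G (J r) z * G (J x) y) - 12 * \<tau> u * \<Phi> (J x) y z"
        by (subst r) (simp add: c psi7_simps psi7_\<sigma>_1 psi_\<nu>)
      then show ?thesis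
        using \<kappa>\<phi>[of "\<sigma> x" "\<sigma> y" "\<sigma> z"] unfolding \<kappa>\<sigma>
        by (simp add: phi7_simps phi_\<nu> H.\<Phi>_simps \<mu>_def algebra_simps flip: \<Phi>_def)
    qed
    then show ?thesis
      using H.rotated_pairing[OF linear_A, of 1 0 "\<tau> u" \<mu>] by simp
  qed
  define \<mu> where "\<mu> v = cos \<theta> * (a v + G (\<beta> u) v) + sin \<theta> * G (J (q - \<beta> u)) v" for v
  have M': "M x y z = \<Phi> (sin \<theta> *\<^sub>R x - cos \<theta> *\<^sub>R J x) y z" for x y z
    unfolding M psi_\<nu> by (simp add: H.\<Phi>_simps)
  have K': "K v = \<sigma> (A v) + (a v + G (\<beta> u) v) *\<^sub>R \<nu>" for v
    unfolding K \<kappa>\<sigma> by (simp add: algebra_simps)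
  have N': "N = \<sigma> (q - \<beta> u)" unfolding N by (simp add: \<sigma>_simps q)
  have phi_K: "phi7 (K x) (\<sigma> y) (\<sigma> z) = \<Phi> (A x) y z + (a x + G (\<beta> u) x) * G (J y) z"
    "phi7 (\<sigma> x) (K y) (\<sigma> z) = \<Phi> x (A y) z + (a y + G (\<beta> u) y) * G (J z) x"
    "phi7 (\<sigma> x) (\<sigma> y) (K z) = \<Phi> x y (A z) + (a z + G (\<beta> u) z) * G (J x) y" for x y z
    unfolding K' by (simp_all add: phi7_simps phi_\<nu> flip: \<Phi>_def)
  have psi_K: "psi7 \<nu> (K x) (\<sigma> y) (\<sigma> z) = - \<Phi> (J (A x)) y z"
    "psi7 \<nu> (\<sigma> x) (K y) (\<sigma> z) = - \<Phi> (J x) (A y) z"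
    "psi7 \<nu> (\<sigma> x) (\<sigma> y) (K z) = - \<Phi> (J x) y (A z)" for x y z
    unfolding K' by (simp_all add: psi7_simps psi_\<nu>\<nu> psi_\<nu>)
  have "D x y z = (- d) * \<Phi> (sin \<theta> *\<^sub>R x - cos \<theta> *\<^sub>R J x) y z
        + (\<Phi> (cos \<theta> *\<^sub>R A x + sin \<theta> *\<^sub>R J (A x)) y z + \<Phi> (cos \<theta> *\<^sub>R x + sin \<theta> *\<^sub>R J x) (A y) z
           + \<Phi> (cos \<theta> *\<^sub>R x + sin \<theta> *\<^sub>R J x) y (A z))
        + (\<mu> x * G (J y) z + \<mu> y * G (J z) x + \<mu> z * G (J x) y)" for x y z
    unfolding D M' N' psi7_\<sigma>_1 phi_K psi_K \<mu>_def H.\<Phi>_simps by (simp add: algebra_simps)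
  then show ?thesis
    unfolding M' using H.rotated_pairing[OF linear_A, of "cos \<theta>" "sin \<theta>" "- d" \<mu>] trace_A by simp
qed

end

section \<open>Calculus in charts\<close>

lemma smooth_on_differentiable: "smooth_on S f \<Longrightarrow> x \<in> S \<Longrightarrow> f differentiable (at x)"
proof -
  assume "smooth_on S f" "x \<in> S"
  moreover from this have "Ck_on (Suc 0) S f" unfolding smooth_on_def by blast
  ultimately show ?thesis by simp
qed

lemma smooth_on_partial:
  assumes "smooth_on S f" "b \<in> Basis"
  shows "smooth_on S (\<lambda>x. frechet_derivative f (at x) b)"
  unfolding smooth_on_def
proof
  fix k
  have "Ck_on (Suc k) S f" using assms(1) unfolding smooth_on_def by blast
  then show "Ck_on k S (\<lambda>x. frechet_derivative f (at x) b)" using assms(2) by simp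
qed

lemma smooth_on_continuous: "smooth_on S f \<Longrightarrow> continuous_on S f"
proof -
  assume "smooth_on S f"
  then have "Ck_on 0 S f" unfolding smooth_on_def by blast
  then show ?thesis by simp
qed

lemma frechet_derivative_linear: "f differentiable (at x) \<Longrightarrow> linear (frechet_derivative f (at x))"
  by (rule linear_frechet_derivative)

lemma linear_Basis_expansion:
  fixes f :: "'a::euclidean_space \<Rightarrow> 'b::real_vector"
  assumes "linear f"
  shows "f x = (\<Sum>b\<in>Basis. (x \<bullet> b) *\<^sub>R f b)"
proof -
  have "f x = f (\<Sum>b\<in>Basis. (x \<bullet> b) *\<^sub>R b)" by (simp add: euclidean_representation)
  then show ?thesis using assms by (simp add: linear_sum linear_scale)
qed

section \<open>Symmetry of second partial derivatives\<close>

lemma has_derivative_along_line: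
  fixes f :: "'a::euclidean_space \<Rightarrow> real"
  assumes "f differentiable (at (p + t *\<^sub>R u))"
  shows "((\<lambda>s. f (p + s *\<^sub>R u)) has_real_derivative frechet_derivative f (at (p + t *\<^sub>R u)) u) (at t)"
proof -
  have f: "(f has_derivative frechet_derivative f (at (p + t *\<^sub>R u))) (at (p + t *\<^sub>R u))"
    using assms frechet_derivative_works by blast
  have "((\<lambda>s. p + s *\<^sub>R u) has_derivative (\<lambda>s. s *\<^sub>R u)) (at t)"
    by (auto intro!: derivative_eq_intros)
  from has_derivative_compose[OF this f]
  have "((\<lambda>s. f (p + s *\<^sub>R u)) has_derivative (\<lambda>s. frechet_derivative f (at (p + t *\<^sub>R u)) (s *\<^sub>R u))) (at t)" .
  moreover have "frechet_derivative f (at (p + t *\<^sub>R u)) (s *\<^sub>R u)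
      = frechet_derivative f (at (p + t *\<^sub>R u)) u * s" for s
    using linear_scale[OF frechet_derivative_linear[OF assms]] by simp
  ultimately show ?thesis unfolding has_field_derivative_def by (simp add: fun_eq_iff)
qed

text \<open>The mean value theorem along u and then along v turns the difference over a
  parallelogram into a mixed derivative at an inner point.\<close>

lemma second_difference:
  fixes f :: "'a::euclidean_space \<Rightarrow> real"
  assumes W: "\<And>s t. 0 \<le> s \<Longrightarrow> s \<le> h \<Longrightarrow> 0 \<le> t \<Longrightarrow> t \<le> h \<Longrightarrow> z + s *\<^sub>R u + t *\<^sub>R v \<in> W"
    and f: "\<And>x. x \<in> W \<Longrightarrow> f differentiable (at x)"
    and fu: "\<And>x. x \<in> W \<Longrightarrow> (\<lambda>x. frechet_derivative f (at x) u) differentiable (at x)"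
    and "0 < h"
  shows "\<exists>s t. 0 < s \<and> s < h \<and> 0 < t \<and> t < h \<and>
    f (z + h *\<^sub>R u + h *\<^sub>R v) - f (z + h *\<^sub>R u) - f (z + h *\<^sub>R v) + f z =
    h * h * frechet_derivative (\<lambda>x. frechet_derivative f (at x) u) (at (z + s *\<^sub>R u + t *\<^sub>R v)) v"
proof -
  let ?fu = "\<lambda>x. frechet_derivative f (at x) u"
  define G where "G s = f (z + h *\<^sub>R v + s *\<^sub>R u) - f (z + s *\<^sub>R u)" for s
  have "(G has_real_derivative ?fu (z + h *\<^sub>R v + s *\<^sub>R u) - ?fu (z + s *\<^sub>R u)) (at s)"
    if "0 \<le> s" "s \<le> h" for s
    unfolding G_def
    using that W[of s h] W[of s 0] \<open>0 < h\<close>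
    by (intro DERIV_diff has_derivative_along_line f) (simp_all add: algebra_simps)
  from MVT2[OF \<open>0 < h\<close> this] obtain s where s: "0 < s" "s < h"
    and G: "G h - G 0 = h * (?fu (z + h *\<^sub>R v + s *\<^sub>R u) - ?fu (z + s *\<^sub>R u))"
    by auto
  have "((\<lambda>t. ?fu (z + s *\<^sub>R u + t *\<^sub>R v)) has_real_derivative
      frechet_derivative ?fu (at (z + s *\<^sub>R u + t *\<^sub>R v)) v) (at t)" if "0 \<le> t" "t \<le> h" for t
    using that s W[of s t] by (intro has_derivative_along_line fu) simp_all
  from MVT2[OF \<open>0 < h\<close> this] obtain t where t: "0 < t" "t < h"
    and "?fu (z + s *\<^sub>R u + h *\<^sub>R v) - ?fu (z + s *\<^sub>R u + 0 *\<^sub>R v)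
      = h * frechet_derivative ?fu (at (z + s *\<^sub>R u + t *\<^sub>R v)) v"
    by auto
  then have "G h - G 0 = h * h * frechet_derivative ?fu (at (z + s *\<^sub>R u + t *\<^sub>R v)) v"
    unfolding G by (simp add: add_ac)
  moreover have "G h - G 0 = f (z + h *\<^sub>R u + h *\<^sub>R v) - f (z + h *\<^sub>R u) - f (z + h *\<^sub>R v) + f z"
    by (simp add: G_def add_ac)
  ultimately show ?thesis using s t by (intro exI[of _ s] exI[of _ t]) auto
qed

text \<open>The second difference is symmetric in u and v, so each mixed derivative takes the same
  value at some point of a small parallelogram; continuity excludes a gap at z.\<close>

lemma mixed_partials_real:
  fixes f :: "'a::euclidean_space \<Rightarrow> real"
  assumes W: "open W" "z \<in> W"
    and f: "\<And>x. x \<in> W \<Longrightarrow> f differentiable (at x)"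
    and fu: "\<And>x. x \<in> W \<Longrightarrow> (\<lambda>x. frechet_derivative f (at x) u) differentiable (at x)"
    and fv: "\<And>x. x \<in> W \<Longrightarrow> (\<lambda>x. frechet_derivative f (at x) v) differentiable (at x)"
    and fuv: "continuous_on W (\<lambda>x. frechet_derivative (\<lambda>x. frechet_derivative f (at x) u) (at x) v)"
    and fvu: "continuous_on W (\<lambda>x. frechet_derivative (\<lambda>x. frechet_derivative f (at x) v) (at x) u)"
  shows "frechet_derivative (\<lambda>x. frechet_derivative f (at x) u) (at z) v =
    frechet_derivative (\<lambda>x. frechet_derivative f (at x) v) (at z) u"
proof -
  define A where "A = (\<lambda>x. frechet_derivative (\<lambda>x. frechet_derivative f (at x) u) (at x) v)"
  define B where "B = (\<lambda>x. frechet_derivative (\<lambda>x. frechet_derivative f (at x) v) (at x) u)"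
  have "A z = B z"
  proof (rule ccontr)
  assume ne: "A z \<noteq> B z"
  define r where "r = \<bar>A z - B z\<bar> / 2"
  have "r > 0" using ne by (simp add: r_def)
  have "isCont A z" "isCont B z"
    using continuous_on_eq_continuous_at[OF W(1), THEN iffD1, rule_format, OF fuv W(2)]
      continuous_on_eq_continuous_at[OF W(1), THEN iffD1, rule_format, OF fvu W(2)]
    unfolding A_def B_def by auto
  note cont = this[unfolded continuous_at_eps_delta, rule_format, OF \<open>r > 0\<close>]
  obtain d1 where d1: "d1 > 0" "\<forall>x. dist x z < d1 \<longrightarrow> dist (A x) (A z) < r"
    using cont(1) by blast
  obtain d2 where d2: "d2 > 0" "\<forall>x. dist x z < d2 \<longrightarrow> dist (B x) (B z) < r"
    using cont(2) by blast
  obtain d3 where d3: "d3 > 0" "\<forall>x. dist x z < d3 \<longrightarrow> x \<in> W"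
    using W(1)[unfolded open_dist, rule_format, OF W(2)] by blast
  define d where "d = min d1 (min d2 d3)"
  have d: "d > 0" "\<And>x. dist x z < d \<Longrightarrow> dist (A x) (A z) < r \<and> dist (B x) (B z) < r \<and> x \<in> W"
    using d1 d2 d3 by (simp_all add: d_def)
  define N where "N = norm u + norm v + 1"
  \<comment> \<open>Keeps the parallelogram spanned by h u and h v within distance d of z; the 1 in
    N avoids dividing by zero.\<close>
  define h where "h = d / 2 / N"
  have "N > 0" unfolding N_def using norm_ge_zero[of u] norm_ge_zero[of v] by linarith
  then have "0 < h" "h * N = d / 2" using d(1) by (simp_all add: h_def)
  then have h: "0 < h" "h * (norm u + norm v + 1) = d / 2" unfolding N_def by simp_all
  have near: "dist (z + s *\<^sub>R u + t *\<^sub>R v) z < d" if "0 \<le> s" "s \<le> h" "0 \<le> t" "t \<le> h" for s t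
  proof -
    have "dist (z + s *\<^sub>R u + t *\<^sub>R v) z \<le> norm (s *\<^sub>R u) + norm (t *\<^sub>R v)"
      using norm_triangle_ineq[of "s *\<^sub>R u" "t *\<^sub>R v"] by (simp add: dist_norm add.assoc)
    also have "\<dots> = s * norm u + t * norm v" using that by simp
    also have "\<dots> \<le> h * norm u + h * norm v" using that by (intro add_mono mult_right_mono) auto
    also have "\<dots> < d" using h d(1) by (simp add: algebra_simps)
    finally show ?thesis .
  qed
  have "\<exists>s t. 0 < s \<and> s < h \<and> 0 < t \<and> t < h \<and>
    f (z + h *\<^sub>R u + h *\<^sub>R v) - f (z + h *\<^sub>R u) - f (z + h *\<^sub>R v) + f z = h * h * A (z + s *\<^sub>R u + t *\<^sub>R v)"
    unfolding A_def by (rule second_difference[of h z u v W f, OF _ f fu h(1)]) (use near d(2) in auto)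
  then obtain s t where 1: "0 < s" "s < h" "0 < t" "t < h"
    "f (z + h *\<^sub>R u + h *\<^sub>R v) - f (z + h *\<^sub>R u) - f (z + h *\<^sub>R v) + f z = h * h * A (z + s *\<^sub>R u + t *\<^sub>R v)"
    by (elim exE conjE) (erule (4) that)
  have near': "dist (z + s *\<^sub>R v + t *\<^sub>R u) z < d" if "0 \<le> s" "s \<le> h" "0 \<le> t" "t \<le> h" for s t
    using near[of t s] that by (simp add: add_ac)
  have "\<exists>s t. 0 < s \<and> s < h \<and> 0 < t \<and> t < h \<and>
    f (z + h *\<^sub>R v + h *\<^sub>R u) - f (z + h *\<^sub>R v) - f (z + h *\<^sub>R u) + f z = h * h * B (z + s *\<^sub>R v + t *\<^sub>R u)"
    unfolding B_def by (rule second_difference[of h z v u W f, OF _ f fv h(1)]) (use near' d(2) in auto)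
  then obtain s' t' where 2: "0 < s'" "s' < h" "0 < t'" "t' < h"
    "f (z + h *\<^sub>R v + h *\<^sub>R u) - f (z + h *\<^sub>R v) - f (z + h *\<^sub>R u) + f z = h * h * B (z + s' *\<^sub>R v + t' *\<^sub>R u)"
    by (elim exE conjE) (erule (4) that)
  have "h * h * A (z + s *\<^sub>R u + t *\<^sub>R v) = h * h * B (z + s' *\<^sub>R v + t' *\<^sub>R u)"
    using 1(5) 2(5) unfolding add.assoc add.commute[of "h *\<^sub>R v" "h *\<^sub>R u"] by linarith
  then have eq: "A (z + s *\<^sub>R u + t *\<^sub>R v) = B (z + s' *\<^sub>R v + t' *\<^sub>R u)" using h(1) by simp
  have "\<bar>A (z + s *\<^sub>R u + t *\<^sub>R v) - A z\<bar> < r" "\<bar>B (z + s' *\<^sub>R v + t' *\<^sub>R u) - B z\<bar> < r"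
    using d(2) near[of s t] near'[of s' t'] 1 2 by (simp_all add: dist_real_def)
  moreover have "A z - B z = (B (z + s' *\<^sub>R v + t' *\<^sub>R u) - B z) - (A (z + s *\<^sub>R u + t *\<^sub>R v) - A z)"
    using eq by simp
  then have "\<bar>A z - B z\<bar> \<le> \<bar>B (z + s' *\<^sub>R v + t' *\<^sub>R u) - B z\<bar> + \<bar>A (z + s *\<^sub>R u + t *\<^sub>R v) - A z\<bar>"
    by (metis abs_triangle_ineq4)
  moreover have "2 * r = \<bar>A z - B z\<bar>" by (simp add: r_def)
  ultimately show False by linarith
  qed
  then show ?thesis unfolding A_def B_def .
qed

lemma frechet_derivative_inner:
  fixes f :: "'a::euclidean_space \<Rightarrow> 'b::euclidean_space"
  assumes "f differentiable (at x)"
  shows "(\<lambda>x. f x \<bullet> k) differentiable (at x)"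
    "frechet_derivative (\<lambda>x. f x \<bullet> k) (at x) u = frechet_derivative f (at x) u \<bullet> k"
proof -
  have "(f has_derivative frechet_derivative f (at x)) (at x)"
    using assms frechet_derivative_works by blast
  then have *: "((\<lambda>x. f x \<bullet> k) has_derivative (\<lambda>u. frechet_derivative f (at x) u \<bullet> k)) (at x)"
    by (rule has_derivative_inner_left)
  then show "(\<lambda>x. f x \<bullet> k) differentiable (at x)" by (rule differentiableI)
  show "frechet_derivative (\<lambda>x. f x \<bullet> k) (at x) u = frechet_derivative f (at x) u \<bullet> k"
    using frechet_derivative_at[OF *] by metis
qed

lemma frechet_derivative_cong_open:
  assumes "open W" "x \<in> W" "\<And>y. y \<in> W \<Longrightarrow> f y = g y"
  shows "frechet_derivative f (at x) = frechet_derivative g (at x)"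
proof -
  have "(f has_derivative D) (at x) \<longleftrightarrow> (g has_derivative D) (at x)" for D
    using has_derivative_transform_within_open[OF _ assms(1,2), of f D UNIV g]
      has_derivative_transform_within_open[OF _ assms(1,2), of g D UNIV f] assms(3) by auto
  then show ?thesis unfolding frechet_derivative_def by simp
qed

text \<open>Taken component by component because the mean value theorem is real-valued, and for
  basis directions because these are the ones that \<open>Ck_on\<close> controls.\<close>

lemma mixed_partials:
  fixes f :: "'a::euclidean_space \<Rightarrow> 'b::euclidean_space"
  assumes W: "open W" "z \<in> W" and f: "smooth_on W f" and uv: "u \<in> Basis" "v \<in> Basis"
  shows "frechet_derivative (\<lambda>x. frechet_derivative f (at x) u) (at z) v =
    frechet_derivative (\<lambda>x. frechet_derivative f (at x) v) (at z) u"
proof (rule euclidean_eqI)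
  fix k :: 'b assume "k \<in> Basis"
  note d0 = smooth_on_differentiable[OF f]
  note d1 = smooth_on_differentiable[OF smooth_on_partial[OF f]]
  note 0 = frechet_derivative_inner[OF d0]
  have 1: "frechet_derivative (\<lambda>x. frechet_derivative (\<lambda>x. f x \<bullet> k) (at x) a) (at x) =
      frechet_derivative (\<lambda>x. frechet_derivative f (at x) a \<bullet> k) (at x)" if "x \<in> W" for x a
    by (rule frechet_derivative_cong_open[OF W(1) that]) (rule 0(2))
  have 2: "(\<lambda>x. frechet_derivative (\<lambda>x. f x \<bullet> k) (at x) a) differentiable (at x)"
    if "x \<in> W" "a \<in> Basis" for x a
  proof -
    have "(\<lambda>x. frechet_derivative f (at x) a \<bullet> k) differentiable (at x)"
      by (rule frechet_derivative_inner(1)[OF d1[OF that(2,1)]])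
    then obtain D where "((\<lambda>x. frechet_derivative f (at x) a \<bullet> k) has_derivative D) (at x)"
      unfolding differentiable_def by blast
    then have "((\<lambda>x. frechet_derivative (\<lambda>x. f x \<bullet> k) (at x) a) has_derivative D) (at x)"
      by (rule has_derivative_transform_within_open[OF _ W(1) that(1)]) (simp add: 0(2))
    then show ?thesis by (rule differentiableI)
  qed
  have 3: "frechet_derivative (\<lambda>x. frechet_derivative (\<lambda>x. f x \<bullet> k) (at x) a) (at x) b =
      frechet_derivative (\<lambda>x. frechet_derivative f (at x) a) (at x) b \<bullet> k"
    if "x \<in> W" "a \<in> Basis" for x a b
    unfolding 1[OF that(1)] by (rule frechet_derivative_inner(2)[OF d1[OF that(2,1)]])
  have 4: "continuous_on W (\<lambda>x. frechet_derivative (\<lambda>x. frechet_derivative (\<lambda>x. f x \<bullet> k) (at x) a) (at x) b)"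
    if "a \<in> Basis" "b \<in> Basis" for a b
  proof -
    have "continuous_on W (\<lambda>x. frechet_derivative (\<lambda>x. frechet_derivative f (at x) a) (at x) b \<bullet> k)"
      by (intro continuous_intros smooth_on_continuous smooth_on_partial f that)
    then show ?thesis by (rule continuous_on_eq) (simp add: 3 that)
  qed
  show "frechet_derivative (\<lambda>x. frechet_derivative f (at x) u) (at z) v \<bullet> k =
    frechet_derivative (\<lambda>x. frechet_derivative f (at x) v) (at z) u \<bullet> k"
    using mixed_partials_real[OF W, of "\<lambda>x. f x \<bullet> k" u v] 0(1) 2 4 uv W(2) 3 by simp
qed

lemma frechet_derivative_chain:
  assumes W: "open W" "z \<in> W" and f: "f differentiable (at z)" and g: "g differentiable (at (f z))"
    and h: "\<And>y. y \<in> W \<Longrightarrow> h y = g (f y)"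
  shows "(h has_derivative (\<lambda>u. frechet_derivative g (at (f z)) (frechet_derivative f (at z) u))) (at z)"
    "frechet_derivative h (at z) u = frechet_derivative g (at (f z)) (frechet_derivative f (at z) u)"
proof -
  have "((\<lambda>y. g (f y)) has_derivative (\<lambda>u. frechet_derivative g (at (f z)) (frechet_derivative f (at z) u))) (at z)"
    using f g unfolding frechet_derivative_works by (rule has_derivative_compose)
  then show *: "(h has_derivative (\<lambda>u. frechet_derivative g (at (f z)) (frechet_derivative f (at z) u))) (at z)"
    by (rule has_derivative_transform_within_open[OF _ W]) (simp add: h)
  show "frechet_derivative h (at z) u = frechet_derivative g (at (f z)) (frechet_derivative f (at z) u)"
    using frechet_derivative_at[OF *] by metis
qed

section \<open>Charts, transition maps and tangent maps\<close>

lemma smooth_manifoldD: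
  assumes "smooth_manifold A" "c \<in> A"
  shows "open (fst c)" "open (snd c ` fst c)" "p \<in> fst c \<Longrightarrow> chart_inv c (snd c p) = p"
    "z \<in> snd c ` fst c \<Longrightarrow> chart_inv c z \<in> fst c" "z \<in> snd c ` fst c \<Longrightarrow> snd c (chart_inv c z) = z"
    "continuous_on (snd c ` fst c) (chart_inv c)"
proof -
  have h: "open (fst c)" "open (snd c ` fst c)" "homeomorphism (fst c) (snd c ` fst c) (snd c) (chart_inv c)"
    using assms unfolding smooth_manifold_def by blast+
  then show "open (fst c)" "open (snd c ` fst c)" by blast+
  show "p \<in> fst c \<Longrightarrow> chart_inv c (snd c p) = p" "z \<in> snd c ` fst c \<Longrightarrow> chart_inv c z \<in> fst c"
    "z \<in> snd c ` fst c \<Longrightarrow> snd c (chart_inv c z) = z" "continuous_on (snd c ` fst c) (chart_inv c)"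
    using h(3) unfolding homeomorphism_def by auto
qed

lemma chart_at:
  assumes "smooth_manifold A"
  shows "chart_at A p \<in> A" "p \<in> fst (chart_at A p)"
proof -
  have "p \<in> (\<Union>c\<in>A. fst c)" using assms unfolding smooth_manifold_def by simp
  then have "\<exists>c. c \<in> A \<and> p \<in> fst c" by blast
  from someI_ex[OF this] show "chart_at A p \<in> A" "p \<in> fst (chart_at A p)"
    unfolding chart_at_def by blast+
qed

lemma chart_image_open:
  assumes "smooth_manifold A" "c \<in> A" "open S"
  shows "open (snd c ` (fst c \<inter> S))"
proof -
  note m = smooth_manifoldD[OF assms(1,2)]
  have "snd c ` (fst c \<inter> S) = snd c ` fst c \<inter> chart_inv c -` S"
    using m(3) by force
  moreover have "open (snd c ` fst c \<inter> chart_inv c -` S)"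
    using continuous_open_preimage[OF m(6,2) assms(3)] .
  ultimately show ?thesis by simp
qed

lemma smooth_manifold_transition:
  assumes "smooth_manifold A" "c \<in> A" "c' \<in> A"
  shows "smooth_on (snd c ` (fst c \<inter> fst c')) (snd c' \<circ> chart_inv c)"
  using assms unfolding smooth_manifold_def by blast

lemma transition_differentiable:
  assumes "smooth_manifold A" "c \<in> A" "c' \<in> A" "q \<in> fst c" "q \<in> fst c'"
  shows "(snd c' \<circ> chart_inv c) differentiable (at (snd c q))"
  by (rule smooth_on_differentiable[OF smooth_manifold_transition[OF assms(1-3)]]) (use assms in auto)

definition chart_map :: "('m, 'e) chart \<Rightarrow> ('n, 'f) chart \<Rightarrow> ('m \<Rightarrow> 'n) \<Rightarrow> 'e \<Rightarrow> 'f" where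
  "chart_map c c' F = snd c' \<circ> F \<circ> chart_inv c"

lemma chart_map_smooth:
  assumes "smooth_map A A' F" "c \<in> A" "c' \<in> A'"
  shows "smooth_on (snd c ` (fst c \<inter> F -` fst c')) (chart_map c c' F)"
  using assms unfolding smooth_map_def chart_map_def by blast

lemma smooth_map_vimage_open:
  assumes "smooth_map A A' F" "open S"
  shows "open (F -` S)"
  using assms continuous_on_open_vimage[of UNIV F] unfolding smooth_map_def by simp

locale smooth_map_between =
  fixes A :: "('m::{t2_space,second_countable_topology}, 'e::euclidean_space) chart set"
    and A' :: "('n::{t2_space,second_countable_topology}, 'f::euclidean_space) chart set" and F :: "'m \<Rightarrow> 'n"
  assumes M: "smooth_manifold A" and M': "smooth_manifold A'" and F: "smooth_map A A' F"
begin

lemma chart_map_differentiable: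
  assumes "c \<in> A" "c' \<in> A'" "q \<in> fst c" "F q \<in> fst c'"
  shows "chart_map c c' F differentiable (at (snd c q))"
  by (rule smooth_on_differentiable[OF chart_map_smooth[OF F assms(1,2)]]) (use assms in auto)

lemma chart_map_change_source:
  assumes c: "c1 \<in> A" "c2 \<in> A" "q \<in> fst c1" "q \<in> fst c2" and c': "c' \<in> A'" "F q \<in> fst c'"
  shows "frechet_derivative (chart_map c1 c' F) (at (snd c1 q)) v =
    frechet_derivative (chart_map c2 c' F) (at (snd c2 q))
      (frechet_derivative (snd c2 \<circ> chart_inv c1) (at (snd c1 q)) v)"
proof -
  note m1 = smooth_manifoldD[OF M c(1)] and m2 = smooth_manifoldD[OF M c(2)]
  have q: "(snd c2 \<circ> chart_inv c1) (snd c1 q) = snd c2 q" using m1(3) c by simp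
  have "frechet_derivative (chart_map c1 c' F) (at (snd c1 q)) v =
    frechet_derivative (chart_map c2 c' F) (at ((snd c2 \<circ> chart_inv c1) (snd c1 q)))
      (frechet_derivative (snd c2 \<circ> chart_inv c1) (at (snd c1 q)) v)"
  proof (rule frechet_derivative_chain(2))
    show "open (snd c1 ` (fst c1 \<inter> fst c2))" by (rule chart_image_open[OF M c(1) m2(1)])
    show "snd c1 q \<in> snd c1 ` (fst c1 \<inter> fst c2)" using c by blast
    show "(snd c2 \<circ> chart_inv c1) differentiable (at (snd c1 q))"
      by (rule transition_differentiable[OF M c])
    show "chart_map c2 c' F differentiable (at ((snd c2 \<circ> chart_inv c1) (snd c1 q)))"
      unfolding q by (rule chart_map_differentiable[OF c(2) c'(1) c(4) c'(2)])
    show "chart_map c1 c' F y = chart_map c2 c' F ((snd c2 \<circ> chart_inv c1) y)"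
      if "y \<in> snd c1 ` (fst c1 \<inter> fst c2)" for y
      using that m1(3) m2(3) by (auto simp: chart_map_def)
  qed
  then show ?thesis unfolding q .
qed

lemma chart_map_change_target:
  assumes c: "c \<in> A" "q \<in> fst c" and c': "c1 \<in> A'" "c2 \<in> A'" "F q \<in> fst c1" "F q \<in> fst c2"
  shows "frechet_derivative (chart_map c c2 F) (at (snd c q)) v =
    frechet_derivative (snd c2 \<circ> chart_inv c1) (at (snd c1 (F q)))
      (frechet_derivative (chart_map c c1 F) (at (snd c q)) v)"
proof -
  note m = smooth_manifoldD[OF M c(1)] and m1 = smooth_manifoldD[OF M' c'(1)] and m2 = smooth_manifoldD[OF M' c'(2)]
  have q: "chart_map c c1 F (snd c q) = snd c1 (F q)" using m(3) c by (simp add: chart_map_def)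
  have "frechet_derivative (chart_map c c2 F) (at (snd c q)) v =
    frechet_derivative (snd c2 \<circ> chart_inv c1) (at (chart_map c c1 F (snd c q)))
      (frechet_derivative (chart_map c c1 F) (at (snd c q)) v)"
  proof (rule frechet_derivative_chain(2))
    show "open (snd c ` (fst c \<inter> F -` (fst c1 \<inter> fst c2)))"
      by (rule chart_image_open[OF M c(1) smooth_map_vimage_open[OF F]]) (use m1(1) m2(1) in blast)
    show "snd c q \<in> snd c ` (fst c \<inter> F -` (fst c1 \<inter> fst c2))" using c c' by blast
    show "chart_map c c1 F differentiable (at (snd c q))"
      by (rule chart_map_differentiable[OF c(1) c'(1) c(2) c'(3)])
    show "(snd c2 \<circ> chart_inv c1) differentiable (at (chart_map c c1 F (snd c q)))"
      unfolding q by (rule transition_differentiable[OF M' c'])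
    show "chart_map c c2 F y = (snd c2 \<circ> chart_inv c1) (chart_map c c1 F y)"
      if "y \<in> snd c ` (fst c \<inter> F -` (fst c1 \<inter> fst c2))" for y
      using that m(3) m1(3) by (auto simp: chart_map_def)
  qed
  then show ?thesis unfolding q .
qed

text \<open>Replaces the preferred charts, which jump from point to point, by one fixed pair of
  charts in which differentiation makes sense.\<close>

lemma tangent_map_to_tangent:
  assumes "c \<in> A" "q \<in> fst c" "c' \<in> A'" "F q \<in> fst c'"
  shows "tangent_map A A' F q (to_tangent A c q v) =
    to_tangent A' c' (F q) (frechet_derivative (chart_map c c' F) (at (snd c q)) v)"
proof -
  note x = chart_at[OF M, of q] and y = chart_at[OF M', of "F q"]
  have "tangent_map A A' F q (to_tangent A c q v) =
      frechet_derivative (chart_map c (chart_at A' (F q)) F) (at (snd c q)) v"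
    unfolding tangent_map_def to_tangent_def local_rep_def chart_map_def[symmetric]
    by (rule chart_map_change_source[symmetric]) (use assms x y in auto)
  also have "\<dots> = to_tangent A' c' (F q) (frechet_derivative (chart_map c c' F) (at (snd c q)) v)"
    unfolding to_tangent_def by (rule chart_map_change_target) (use assms x y in auto)
  finally show ?thesis .
qed

end

lemma smooth_map_id:
  assumes "smooth_manifold A"
  shows "smooth_map A A (\<lambda>x. x)"
  unfolding smooth_map_def
proof (intro conjI ballI)
  show "smooth_on (snd c ` (fst c \<inter> (\<lambda>x. x) -` fst c')) (snd c' \<circ> (\<lambda>x. x) \<circ> chart_inv c)"
    if "c \<in> A" "c' \<in> A" for c c'
    using smooth_manifold_transition[OF assms that] by (simp add: o_def)
qed simp

lemma frechet_derivative_transition_self: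
  assumes "smooth_manifold A" "c \<in> A" "q \<in> fst c"
  shows "frechet_derivative (snd c \<circ> chart_inv c) (at (snd c q)) v = v"
proof -
  note m = smooth_manifoldD[OF assms(1,2)]
  have "((snd c \<circ> chart_inv c) has_derivative (\<lambda>x. x)) (at (snd c q))"
    by (rule has_derivative_transform_within_open[OF has_derivative_ident m(2)]) (use assms m(5) in auto)
  from frechet_derivative_at[OF this] show ?thesis by metis
qed

lemma to_tangent_at:
  assumes "smooth_manifold A"
  shows "to_tangent A (chart_at A q) q v = v"
  unfolding to_tangent_def using frechet_derivative_transition_self[OF assms] chart_at[OF assms] by blast

text \<open>The chain rule for the identity map, seen in two charts.\<close>

lemma to_tangent_from_tangent:
  assumes A: "smooth_manifold A" and c: "c \<in> A" "q \<in> fst c"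
  shows "to_tangent A c q (from_tangent A c q v) = v"
proof -
  interpret smooth_map_between A A "\<lambda>x. x" by unfold_locales (rule A A smooth_map_id[OF A])+
  note q = chart_at[OF A, of q]
  have chart_map_id: "chart_map c1 c2 (\<lambda>x. x) = snd c2 \<circ> chart_inv c1" for c1 c2 :: "('a, 'b) chart"
    by (simp add: chart_map_def o_def)
  have "frechet_derivative (snd (chart_at A q) \<circ> chart_inv (chart_at A q)) (at (snd (chart_at A q) q)) v =
    to_tangent A c q (from_tangent A c q v)"
    unfolding to_tangent_def from_tangent_def
    using chart_map_change_source[OF q(1) c(1) q(2) c(2) q] unfolding chart_map_id .
  then show ?thesis using frechet_derivative_transition_self[OF A q] by simp
qed

lemma linear_to_tangent:
  assumes A: "smooth_manifold A" and c: "c \<in> A" "q \<in> fst c"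
  shows "linear (to_tangent A c q)"
  unfolding to_tangent_def
  by (rule frechet_derivative_linear, rule transition_differentiable[OF A c(1) chart_at(1)[OF A] c(2) chart_at(2)[OF A]])

section \<open>The Levi-Civita connection\<close>

text \<open>The difference of two candidates, lowered with the metric, is symmetric in the first two
  slots and skew in the last two, hence zero.\<close>

lemma christoffel_eq:
  fixes \<Gamma> :: "'e::euclidean_space \<Rightarrow> 'e \<Rightarrow> 'e"
  assumes "inner_form (g p)" and \<Gamma>: "bilinear \<Gamma>" "\<And>u v. \<Gamma> u v = \<Gamma> v u"
    "\<And>u v w. component_deriv A (tensor2 g) p u [v, w] = g p (\<Gamma> u v) w + g p v (\<Gamma> u w)"
  shows "christoffel A g p = \<Gamma>"
  unfolding christoffel_def
proof (rule the_equality)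
  interpret inner_form "g p" by fact
  fix \<Delta> assume \<Delta>: "bilinear \<Delta> \<and> (\<forall>u v. \<Delta> u v = \<Delta> v u) \<and>
     (\<forall>u v w. component_deriv A (tensor2 g) p u [v, w] = g p (\<Delta> u v) w + g p v (\<Delta> u w))"
  define T where "T u v w = g p (\<Delta> u v - \<Gamma> u v) w" for u v w
  have T1: "T u v w = T v u w" for u v w
    using \<Delta> \<Gamma>(2)[of u v] unfolding T_def by metis
  have T2: "T u v w = - T u w v" for u v w
  proof -
    have "g p (\<Delta> u v) w + g p v (\<Delta> u w) = g p (\<Gamma> u v) w + g p v (\<Gamma> u w)"
      using \<Delta> \<Gamma>(3)[of u v w] by metis
    then show ?thesis unfolding T_def simps sym[of "\<Delta> u w" v] sym[of "\<Gamma> u w" v] by linarith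
  qed
  have "T u v w = 0" for u v w
    using T1[of u v w] T1[of v w u] T1[of w u v] T2[of u v w] T2[of v w u] T2[of w u v] by linarith
  then have "g p (\<Delta> u v) w = g p (\<Gamma> u v) w" for u v w
    unfolding T_def simps by (metis eq_iff_diff_eq_0)
  then show "\<Delta> = \<Gamma>" by (intro ext eqI)
qed (use \<Gamma> in blast)

text \<open>Koszul's formula for coordinate fields, whose brackets vanish; C stands for the first
  derivatives of the metric coefficients.\<close>

lemma (in inner_form) koszul:
  assumes lin: "\<And>v w. linear (\<lambda>u. C u v w)" "\<And>u w. linear (\<lambda>v. C u v w)" "\<And>u v. linear (C u v)"
    and C_sym: "\<And>u v w. C u v w = C u w v"
  shows "\<exists>\<Gamma>. bilinear \<Gamma> \<and> (\<forall>u v. \<Gamma> u v = \<Gamma> v u) \<and> (\<forall>u v w. C u v w = g (\<Gamma> u v) w + g v (\<Gamma> u w))"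
proof -
  define K where "K u v w = (C u v w + C v u w - C w u v) / 2" for u v w
  define \<Gamma> where "\<Gamma> u v = sharp g (K u v)" for u v
  note lin_simps = lin[THEN linear_add] lin[THEN linear_scale]
  have K1: "K (u + u') v w = K u v w + K u' v w" "K (r *\<^sub>R u) v w = r * K u v w"
    "K u (v + v') w = K u v w + K u v' w" "K u (r *\<^sub>R v) w = r * K u v w"
    "K u v (w + w') = K u v w + K u v w'" "K u v (r *\<^sub>R w) = r * K u v w" for u u' v v' w w' r
    unfolding K_def by (simp_all add: lin_simps add_divide_distrib diff_divide_distrib algebra_simps)
  have \<Gamma>: "g (\<Gamma> u v) w = K u v w" for u v w
    unfolding \<Gamma>_def by (rule sharp) (rule linearI; simp add: K1)
  have "\<Gamma> u v = \<Gamma> v u" for u v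
    by (rule eqI) (simp add: \<Gamma> K_def C_sym[of _ u v])
  moreover have "bilinear \<Gamma>"
    unfolding bilinear_def by (intro conjI allI linearI; rule eqI; simp add: \<Gamma> simps K1)
  moreover have "C u v w = g (\<Gamma> u v) w + g v (\<Gamma> u w)" for u v w
    unfolding sym[of v] \<Gamma> K_def using C_sym[of u v w] C_sym[of v u w] C_sym[of w u v] by (simp add: field_simps)
  ultimately show ?thesis by blast
qed

lemma riemannian_metric_inner_form:
  assumes "riemannian_metric A g"
  shows "inner_form (g p)"
  using assms unfolding riemannian_metric_def by unfold_locales blast+

lemma has_derivative_phi7:
  assumes "(a has_derivative a') (at z)" "(b has_derivative b') (at z)" "(c has_derivative c') (at z)"
  shows "((\<lambda>z. phi7 (a z) (b z) (c z)) has_derivative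
    (\<lambda>h. phi7 (a' h) (b z) (c z) + phi7 (a z) (b' h) (c z) + phi7 (a z) (b z) (c' h))) (at z)"
proof -
  have "((\<lambda>z. cross7 (a z) (b z)) has_derivative (\<lambda>h. cross7 (a z) (b' h) + cross7 (a' h) (b z))) (at z)"
    by (rule bounded_bilinear.FDERIV[OF bounded_bilinear_cross7 assms(1,2)])
  from has_derivative_inner[OF this assms(3)] show ?thesis
    unfolding phi7_def by (rule has_derivative_eq_rhs) (simp add: fun_eq_iff inner_simps)
qed

lemma has_derivative_psi7:
  assumes "(a has_derivative a') (at z)" "(b has_derivative b') (at z)" "(c has_derivative c') (at z)"
    "(d has_derivative d') (at z)"
  shows "((\<lambda>z. psi7 (a z) (b z) (c z) (d z)) has_derivative
    (\<lambda>h. psi7 (a' h) (b z) (c z) (d z) + psi7 (a z) (b' h) (c z) (d z)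
      + psi7 (a z) (b z) (c' h) (d z) + psi7 (a z) (b z) (c z) (d' h))) (at z)"
proof -
  have "((\<lambda>z. cross7 (a z) (b z)) has_derivative (\<lambda>h. cross7 (a z) (b' h) + cross7 (a' h) (b z))) (at z)"
    "((\<lambda>z. cross7 (c z) (d z)) has_derivative (\<lambda>h. cross7 (c z) (d' h) + cross7 (c' h) (d z))) (at z)"
    by (rule bounded_bilinear.FDERIV[OF bounded_bilinear_cross7] assms)+
  note cross = has_derivative_inner[OF this]
  have "((\<lambda>z. (a z \<bullet> c z) * (b z \<bullet> d z) - (a z \<bullet> d z) * (b z \<bullet> c z)) has_derivative
    (\<lambda>h. ((a z \<bullet> c z) * (b z \<bullet> d' h + b' h \<bullet> d z) + (a z \<bullet> c' h + a' h \<bullet> c z) * (b z \<bullet> d z))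
     - ((a z \<bullet> d z) * (b z \<bullet> c' h + b' h \<bullet> c z) + (a z \<bullet> d' h + a' h \<bullet> d z) * (b z \<bullet> c z)))) (at z)"
    by (intro has_derivative_diff has_derivative_mult has_derivative_inner assms)
  from has_derivative_diff[OF this cross] show ?thesis
    unfolding psi7_def by (rule has_derivative_eq_rhs) (simp add: fun_eq_iff inner_simps algebra_simps)
qed

lemma linear_cmult: "linear f \<Longrightarrow> linear (\<lambda>x. k * f x :: real)"
  using linear_compose_scale_right[of f k] by simp

lemma linear_wedge1_last:
  assumes "length \<mu>s = Suc (length vs)" "\<And>\<mu>. \<mu> \<in> set \<mu>s \<Longrightarrow> linear \<mu>"
  shows "linear (\<lambda>x. wedge1 \<mu>s (vs @ [x]))"
  using assms
proof (induction vs arbitrary: \<mu>s)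
  case Nil
  then obtain \<mu> where "\<mu>s = [\<mu>]" "linear \<mu>" by (auto simp: length_Suc_conv)
  then show ?case by (simp add: wedge1_Cons wedge1_Nil)
next
  case (Cons v vs)
  have "\<mu>s \<noteq> []" using Cons.prems(1) by auto
  have "linear (\<lambda>x. wedge1 (take i \<mu>s @ drop (Suc i) \<mu>s) (vs @ [x]))" if "i < length \<mu>s" for i
  proof (rule Cons.IH)
    show "length (take i \<mu>s @ drop (Suc i) \<mu>s) = Suc (length vs)" using that Cons.prems(1) by simp
    show "linear \<mu>" if "\<mu> \<in> set (take i \<mu>s @ drop (Suc i) \<mu>s)" for \<mu>
      using that Cons.prems(2) by (auto dest: in_set_takeD in_set_dropD)
  qed
  then have "linear (\<lambda>x. \<Sum>i<length \<mu>s. (- 1) ^ i * (\<mu>s ! i) v * wedge1 (take i \<mu>s @ drop (Suc i) \<mu>s) (vs @ [x]))"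
    by (intro linear_compose_sum ballI linear_cmult) simp
  then show ?case by (simp add: wedge1_Cons[OF \<open>\<mu>s \<noteq> []\<close>])
qed

text \<open>Ensures that \<open>sharp\<close> in \<open>p_vec\<close> really represents
  \<open>pd_star\<close>.\<close>

lemma linear_star_6:
  assumes "inner_form g"
  shows "linear (\<lambda>x. star g \<phi> 6 \<alpha> [x])"
proof -
  interpret inner_form g by fact
  define e where "e = (SOME e. adapted_frame g \<phi> e)"
  have "linear (\<lambda>x. wedge1 (map (\<lambda>i. g (e i)) [0, 1, 2, 3, 4, 5, 6]) (map e is @ [x]))" if "length is = 6" for "is"
    by (rule linear_wedge1_last) (use that linear_right in auto)
  then have "linear (\<lambda>x. \<Sum>is | length is = 6. \<alpha> (map e is) *
        wedge1 (map (\<lambda>i. g (e i)) [0, 1, 2, 3, 4, 5, 6]) (map e is @ [x]))"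
    by (intro linear_compose_sum ballI linear_cmult) simp
  from linear_cmult[OF this, of "1 / fact 6"] show ?thesis
    unfolding star_def e_def[symmetric] Let_def by (simp add: mult.commute)
qed

lemma frechet_derivative_apply: "(f has_derivative D) (at x) \<Longrightarrow> frechet_derivative f (at x) u = D u"
  using frechet_derivative_at[of f D x] by simp

section \<open>Adapted coframes in a chart\<close>

locale g2_manifold =
  fixes A :: "('n::{t2_space,second_countable_topology}, real^7) chart set"
    and g :: "'n \<Rightarrow> real^7 \<Rightarrow> real^7 \<Rightarrow> real" and \<phi> :: "'n \<Rightarrow> (real^7) tensor"
  assumes manifold: "smooth_manifold A" and metric: "riemannian_metric A g"
    and G2: "G2_structure A g \<phi>" and X4: "type_X4 A g \<phi>"
begin

lemma inner_form_g: "inner_form (g p)"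
  by (rule riemannian_metric_inner_form[OF metric])

lemma g_p_vec: "g p (p_vec A g \<phi> p) x = pd_star A g \<phi> p x"
  unfolding p_vec_def
  by (rule inner_form.sharp[OF inner_form_g]) (unfold pd_star_def, rule linear_star_6[OF inner_form_g])

end

text \<open>A point with one adapted frame around it. Frames exist only locally, so identities are
  proved at a point and the frame is discarded afterwards.\<close>

locale g2_point = g2_manifold A g \<phi> for A :: "('n::{t2_space,second_countable_topology}, real^7) chart set" and g \<phi> +
  fixes p :: 'n and V :: "'n set" and e :: "7 \<Rightarrow> 'n \<Rightarrow> real^7"
  assumes V: "open V" "p \<in> V" and e_smooth: "\<And>i. smooth_along A A V id (e i)"
    and e_adapted: "\<And>q. q \<in> V \<Longrightarrow> adapted_frame (g q) (\<phi> q) (\<lambda>i. e i q)"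
begin

definition c where "c = chart_at A p"

definition y0 where "y0 = snd c p"

definition U where "U = snd c ` (fst c \<inter> V)"

text \<open>\<open>eps y v\<close> lists the adapted-frame components, at the point with coordinates \<open>y\<close>, of the vector
  with components \<open>v\<close> in the chart \<open>c\<close>.\<close>

definition eps :: "real^7 \<Rightarrow> real^7 \<Rightarrow> real^7" where
  "eps y v = (\<chi> i. g (chart_inv c y) (e i (chart_inv c y)) (to_tangent A c (chart_inv c y) v))"

definition coords :: "real^7 \<Rightarrow> real^7" where
  "coords v = (\<chi> i. g p (e i p) v)"

lemma c: "c \<in> A" "p \<in> fst c"
  unfolding c_def by (rule chart_at[OF manifold])+

lemmas chart = smooth_manifoldD[OF manifold c(1)]

lemma U: "open U" "y0 \<in> U"
  unfolding U_def y0_def using chart_image_open[OF manifold c(1) V(1)] c(2) V(2) by auto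

lemma chart_inv_U: "y \<in> U \<Longrightarrow> chart_inv c y \<in> fst c" "y \<in> U \<Longrightarrow> chart_inv c y \<in> V"
  "y \<in> U \<Longrightarrow> snd c (chart_inv c y) = y"
  unfolding U_def using chart(3,5) by auto

lemma chart_inv_y0: "chart_inv c y0 = p"
  unfolding y0_def by (rule chart(3)[OF c(2)])

lemma frame_at: "q \<in> V \<Longrightarrow> frame (g q) (\<phi> q) (\<lambda>i. e i q)"
  by (intro frame.intro inner_form_g frame_axioms.intro e_adapted)

sublocale F: frame "g p" "\<phi> p" "\<lambda>i. e i p"
  by (rule frame_at[OF V(2)])

lemma coords_eq: "coords = F.coords"
  by (simp add: coords_def F.coords_def fun_eq_iff)

lemma eps_coords:
  "y \<in> U \<Longrightarrow> eps y v = frame.coords (g (chart_inv c y)) (\<lambda>i. e i (chart_inv c y)) (to_tangent A c (chart_inv c y) v)"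
  by (simp add: eps_def frame.coords_def[OF frame_at[OF chart_inv_U(2)]])

lemma eps_y0: "eps y0 = coords"
  unfolding eps_def coords_def chart_inv_y0 unfolding c_def to_tangent_at[OF manifold] ..

lemma linear_eps:
  assumes y: "y \<in> U"
  shows "linear (eps y)"
proof -
  interpret q: frame "g (chart_inv c y)" "\<phi> (chart_inv c y)" "\<lambda>i. e i (chart_inv c y)"
    by (rule frame_at[OF chart_inv_U(2)[OF y]])
  have "eps y = q.coords \<circ> to_tangent A c (chart_inv c y)"
    by (simp add: fun_eq_iff eps_coords[OF y])
  then show ?thesis
    using linear_compose[OF linear_to_tangent[OF manifold c(1) chart_inv_U(1)[OF y]] q.linear_coords] by simp
qed

lemma chart_rep_g: "y \<in> U \<Longrightarrow> chart_rep A (tensor2 g) c y [u, v] = eps y u \<bullet> eps y v"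
  by (simp add: chart_rep_def tensor2_def eps_coords frame.inner_coords[OF frame_at[OF chart_inv_U(2)]])

lemma chart_rep_phi: "y \<in> U \<Longrightarrow> chart_rep A \<phi> c y [u, v, w] = phi7 (eps y u) (eps y v) (eps y w)"
  by (simp add: chart_rep_def eps_coords frame.phi_coords[OF frame_at[OF chart_inv_U(2)]])

text \<open>Smoothness is given for the frame vectors, while \<open>eps\<close> uses the dual
  coframe. Lowering with the metric expresses it by products of frame components and metric
  coefficients.\<close>

lemma eps_differentiable: "(\<lambda>y. eps y v) differentiable (at y0)"
proof -
  define E where "E i y = from_tangent A c (chart_inv c y) (e i (chart_inv c y))" for i y
  have "smooth_on (snd c ` (fst c \<inter> V \<inter> id -` fst c)) (E i)" for i
    using e_smooth[of i] c(1) unfolding smooth_along_def E_def by simp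
  then have "smooth_on U (E i)" for i
    unfolding U_def by (simp add: Int_ac)
  then have E: "E i differentiable (at y0)" for i
    using smooth_on_differentiable U(2) by blast
  have "smooth_on (snd c ` fst c) (\<lambda>y. chart_rep A (tensor2 g) c y [b, v])" for b
    using metric c(1) unfolding riemannian_metric_def smooth_tensor_def by simp
  then have R: "(\<lambda>y. chart_rep A (tensor2 g) c y [b, v]) differentiable (at y0)" for b
    using smooth_on_differentiable c(2) unfolding y0_def by blast
  have eps: "eps y v = (\<Sum>i\<in>UNIV. (\<Sum>b\<in>Basis. (E i y \<bullet> b) * chart_rep A (tensor2 g) c y [b, v]) *\<^sub>R axis i 1)"
    if "y \<in> U" for y
  proof -
    let ?q = "chart_inv c y"
    interpret q: inner_form "g ?q" by (rule inner_form_g)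
    have lin: "linear (\<lambda>x. g ?q (to_tangent A c ?q x) (to_tangent A c ?q v))"
      using linear_compose[OF linear_to_tangent[OF manifold c(1) chart_inv_U(1)[OF that]] q.linear_left]
      by (simp add: o_def)
    have "eps y v $ i = (\<Sum>b\<in>Basis. (E i y \<bullet> b) * chart_rep A (tensor2 g) c y [b, v])" for i
      using linear_Basis_expansion[OF lin, of "E i y"]
        to_tangent_from_tangent[OF manifold c(1) chart_inv_U(1)[OF that], of "e i ?q"]
      by (simp add: eps_def E_def chart_rep_def tensor2_def)
    then have "eps y v = (\<chi> i. \<Sum>b\<in>Basis. (E i y \<bullet> b) * chart_rep A (tensor2 g) c y [b, v])"
      by (simp add: Finite_Cartesian_Product.vec_eq_iff)
    also have "\<dots> = (\<Sum>i\<in>UNIV. (\<Sum>b\<in>Basis. (E i y \<bullet> b) * chart_rep A (tensor2 g) c y [b, v]) *\<^sub>R axis i 1)"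
      by (simp add: Finite_Cartesian_Product.vec_eq_iff axis_def if_distrib cong: if_cong)
    finally show ?thesis .
  qed
  note E' = E[unfolded frechet_derivative_works] and R' = R[unfolded frechet_derivative_works]
  have "((\<lambda>y. \<Sum>i\<in>UNIV. (\<Sum>b\<in>Basis. (E i y \<bullet> b) * chart_rep A (tensor2 g) c y [b, v]) *\<^sub>R axis i (1::real))
    has_derivative (\<lambda>X. \<Sum>i\<in>UNIV. (\<Sum>b\<in>Basis.
      (E i y0 \<bullet> b) * frechet_derivative (\<lambda>y. chart_rep A (tensor2 g) c y [b, v]) (at y0) X
      + (frechet_derivative (E i) (at y0) X \<bullet> b) * chart_rep A (tensor2 g) c y0 [b, v]) *\<^sub>R axis i 1)) (at y0)"
    by (intro has_derivative_sum has_derivative_scaleR_left has_derivative_mult has_derivative_inner_left E' R')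
  from has_derivative_transform_within_open[OF this U]
  have "((\<lambda>y. eps y v) has_derivative (\<lambda>X. \<Sum>i\<in>UNIV. (\<Sum>b\<in>Basis.
      (E i y0 \<bullet> b) * frechet_derivative (\<lambda>y. chart_rep A (tensor2 g) c y [b, v]) (at y0) X
      + (frechet_derivative (E i) (at y0) X \<bullet> b) * chart_rep A (tensor2 g) c y0 [b, v]) *\<^sub>R axis i 1)) (at y0)"
    by (simp add: eps)
  then show ?thesis by (rule differentiableI)
qed

text \<open>Expanding v in the basis builds in linearity in v;
  \<open>has_derivative_eps_const\<close> shows that this is the derivative of \<open>eps\<close> in
  direction X.\<close>

definition Deps :: "real^7 \<Rightarrow> real^7 \<Rightarrow> real^7" where
  "Deps X v = (\<Sum>b\<in>Basis. (v \<bullet> b) *\<^sub>R frechet_derivative (\<lambda>y. eps y b) (at y0) X)"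

lemma linear_Deps: "linear (\<lambda>X. Deps X v)" "linear (Deps X)"
proof -
  show "linear (Deps X)"
    unfolding Deps_def by (intro linearI) (simp_all add: inner_simps scaleR_add_left sum.distrib scaleR_sum_right)
  have "linear (\<lambda>X. frechet_derivative (\<lambda>y. eps y b) (at y0) X)" for b
    by (intro frechet_derivative_linear eps_differentiable)
  note s = linear_add[OF this] linear_scale[OF this]
  show "linear (\<lambda>X. Deps X v)"
    unfolding Deps_def by (intro linearI) (simp_all add: s scaleR_add_right sum.distrib scaleR_sum_right mult.commute)
qed

text \<open>The product rule for \<open>eps y v\<close>, which is linear in \<open>v\<close>.\<close>

lemma has_derivative_eps:
  fixes f :: "'a::euclidean_space \<Rightarrow> real^7"
  assumes W: "open W" "z \<in> W" "\<And>y. y \<in> W \<Longrightarrow> f y \<in> U" and z: "f z = y0"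
    and f: "(f has_derivative f') (at z)" and w: "(w has_derivative w') (at z)"
  shows "((\<lambda>y. eps (f y) (w y)) has_derivative (\<lambda>u. coords (w' u) + Deps (f' u) (w z))) (at z)"
proof -
  let ?D = "\<lambda>b. frechet_derivative (\<lambda>y. eps y b) (at y0)"
  have 1: "((\<lambda>y. eps (f y) b) has_derivative (\<lambda>u. ?D b (f' u))) (at z)" for b
    using has_derivative_compose[OF f, of "\<lambda>y. eps y b" "?D b"] eps_differentiable[of b]
    unfolding z frechet_derivative_works by blast
  have "((\<lambda>y. \<Sum>b\<in>Basis. (w y \<bullet> b) *\<^sub>R eps (f y) b) has_derivative
    (\<lambda>u. \<Sum>b\<in>Basis. (w z \<bullet> b) *\<^sub>R ?D b (f' u) + (w' u \<bullet> b) *\<^sub>R eps (f z) b)) (at z)"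
    by (intro has_derivative_sum has_derivative_scaleR has_derivative_inner_left w 1)
  then have "((\<lambda>y. eps (f y) (w y)) has_derivative
    (\<lambda>u. \<Sum>b\<in>Basis. (w z \<bullet> b) *\<^sub>R ?D b (f' u) + (w' u \<bullet> b) *\<^sub>R eps (f z) b)) (at z)"
    by (rule has_derivative_transform_within_open[OF _ W(1,2)])
       (simp add: linear_Basis_expansion[OF linear_eps[OF W(3)], symmetric])
  then show ?thesis
    by (rule has_derivative_eq_rhs)
       (simp add: fun_eq_iff sum.distrib Deps_def z eps_y0 linear_Basis_expansion[OF F.linear_coords, folded coords_eq, symmetric])
qed

lemma has_derivative_eps_const: "((\<lambda>y. eps y v) has_derivative (\<lambda>X. Deps X v)) (at y0)"
  using has_derivative_eps[OF U, of "\<lambda>y. y" "\<lambda>X. X" "\<lambda>_. v" "\<lambda>_. 0"]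
  by (simp add: linear_0[OF F.linear_coords] coords_eq)

lemma component_deriv_g: "component_deriv A (tensor2 g) p X [u, v] = Deps X u \<bullet> coords v + coords u \<bullet> Deps X v"
proof -
  have "((\<lambda>y. eps y u \<bullet> eps y v) has_derivative (\<lambda>X. eps y0 u \<bullet> Deps X v + Deps X u \<bullet> eps y0 v)) (at y0)"
    by (intro has_derivative_inner has_derivative_eps_const)
  then have "((\<lambda>y. chart_rep A (tensor2 g) c y [u, v]) has_derivative (\<lambda>X. eps y0 u \<bullet> Deps X v + Deps X u \<bullet> eps y0 v)) (at y0)"
    by (rule has_derivative_transform_within_open[OF _ U]) (simp add: chart_rep_g)
  from frechet_derivative_apply[OF this, of X] show ?thesis
    unfolding component_deriv_def c_def[symmetric] y0_def[symmetric] eps_y0 by simp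
qed

lemma component_deriv_phi: "component_deriv A \<phi> p X [u, v, w] =
  phi7 (Deps X u) (coords v) (coords w) + phi7 (coords u) (Deps X v) (coords w) + phi7 (coords u) (coords v) (Deps X w)"
proof -
  have "((\<lambda>y. chart_rep A \<phi> c y [u, v, w]) has_derivative (\<lambda>X. phi7 (Deps X u) (eps y0 v) (eps y0 w)
    + phi7 (eps y0 u) (Deps X v) (eps y0 w) + phi7 (eps y0 u) (eps y0 v) (Deps X w))) (at y0)"
    by (rule has_derivative_transform_within_open[OF
          has_derivative_phi7[OF has_derivative_eps_const has_derivative_eps_const has_derivative_eps_const] U])
       (simp add: chart_rep_phi)
  from frechet_derivative_apply[OF this, of X] show ?thesis
    unfolding component_deriv_def c_def[symmetric] y0_def[symmetric] eps_y0 .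
qed

section \<open>The connection form of the frame and type X4\<close>

definition \<Gamma> where "\<Gamma> = christoffel A g p"

lemma \<Gamma>: "bilinear \<Gamma>" "\<Gamma> u v = \<Gamma> v u"
  "Deps u v \<bullet> coords w + coords v \<bullet> Deps u w = coords (\<Gamma> u v) \<bullet> coords w + coords v \<bullet> coords (\<Gamma> u w)"
proof -
  let ?C = "\<lambda>u v w. Deps u v \<bullet> coords w + coords v \<bullet> Deps u w"
  note s = linear_Deps[THEN linear_add] linear_Deps[THEN linear_scale]
    linear_add[OF F.linear_coords, folded coords_eq] linear_scale[OF F.linear_coords, folded coords_eq]
  have "\<exists>\<Gamma>. bilinear \<Gamma> \<and> (\<forall>u v. \<Gamma> u v = \<Gamma> v u) \<and> (\<forall>u v w. ?C u v w = g p (\<Gamma> u v) w + g p v (\<Gamma> u w))"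
    by (rule F.koszul) (auto intro!: linearI simp: s inner_simps algebra_simps inner_commute)
  then obtain \<Delta> where \<Delta>: "bilinear \<Delta>" "\<And>u v. \<Delta> u v = \<Delta> v u"
    "\<And>u v w. ?C u v w = g p (\<Delta> u v) w + g p v (\<Delta> u w)" by auto
  have "\<Gamma> = \<Delta>"
    unfolding \<Gamma>_def by (rule christoffel_eq[OF inner_form_g \<Delta>(1,2)]) (simp add: component_deriv_g \<Delta>(3))
  then show "bilinear \<Gamma>" "\<Gamma> u v = \<Gamma> v u"
    "?C u v w = coords (\<Gamma> u v) \<bullet> coords w + coords v \<bullet> coords (\<Gamma> u w)"
    using \<Delta> by (auto simp: coords_eq F.inner_coords)
qed

lemma linear_coords: "linear coords" and inj_coords: "inj coords" and surj_coords: "surj coords"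
  and inner_coords: "coords x \<bullet> coords y = g p x y"
  unfolding coords_eq by (rule F.linear_coords F.inj_coords F.surj_coords F.inner_coords)+

lemmas coords_simps = linear_add[OF linear_coords] linear_diff[OF linear_coords] linear_scale[OF linear_coords]

text \<open>The inverse of \<open>coords\<close> makes this an endomorphism of frame components, so
  that it can be inserted into \<open>phi7\<close> and \<open>psi7\<close>.\<close>

definition \<kappa> :: "real^7 \<Rightarrow> real^7 \<Rightarrow> real^7" where
  "\<kappa> X a = Deps X (inv_into UNIV coords a) - coords (\<Gamma> X (inv_into UNIV coords a))"

lemma \<kappa>_coords: "\<kappa> X (coords v) = Deps X v - coords (\<Gamma> X v)"
  by (simp add: \<kappa>_def inv_f_f[OF inj_coords])

lemma linear_\<Gamma>: "linear (\<Gamma> X)" "linear (\<lambda>X. \<Gamma> X v)"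
  using \<Gamma>(1) by (auto simp: bilinear_def)

lemma linear_\<kappa>: "linear (\<kappa> X)"
proof (rule linearI)
  fix a b :: "real^7" and r :: real
  obtain v where a: "a = coords v" using surjD[OF surj_coords] by blast
  obtain w where b: "b = coords w" using surjD[OF surj_coords] by blast
  show "\<kappa> X (a + b) = \<kappa> X a + \<kappa> X b"
    unfolding a b coords_simps(1)[symmetric] \<kappa>_coords
    by (simp add: linear_add[OF linear_Deps(2)] linear_add[OF linear_\<Gamma>(1)] coords_simps)
  show "\<kappa> X (r *\<^sub>R a) = r *\<^sub>R \<kappa> X a"
    unfolding a coords_simps(3)[symmetric] \<kappa>_coords
    by (simp add: linear_scale[OF linear_Deps(2)] linear_scale[OF linear_\<Gamma>(1)] coords_simps scaleR_diff_right)
qed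

text \<open>Metric compatibility of the connection, in an orthonormal frame.\<close>

lemma \<kappa>_skew: "\<kappa> X a \<bullet> b = - (a \<bullet> \<kappa> X b)"
proof -
  obtain v where a: "a = coords v" using surjD[OF surj_coords] by blast
  obtain w where b: "b = coords w" using surjD[OF surj_coords] by blast
  show ?thesis
    unfolding a b \<kappa>_coords using \<Gamma>(3)[of X v w] by (simp add: inner_simps)
qed

text \<open>In the frame \<phi> has constant coefficients, so differentiation acts on the arguments
  alone and combines with the Christoffel terms to \<kappa>.\<close>

lemma covd_phi: "covd A g \<phi> p X [u, v, w] =
  phi7 (\<kappa> X (coords u)) (coords v) (coords w) + phi7 (coords u) (\<kappa> X (coords v)) (coords w)
    + phi7 (coords u) (coords v) (\<kappa> X (coords w))"
  unfolding covd_def component_deriv_phi \<kappa>_coords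
  by (simp add: lessThan_Suc F.phi_coords coords_eq[symmetric] \<Gamma>_def[symmetric] phi7_simps)

lemma star_phi_coords: "star_phi g \<phi> p [x, y, z, w] = psi7 (coords x) (coords y) (coords z) (coords w)"
  by (simp add: star_phi_def F.star_coords coords_eq)

lemma coords_cross: "coords (sharp (g p) (\<lambda>z. \<phi> p [x, y, z])) = cross7 (coords x) (coords y)"
  unfolding coords_eq by (rule F.coords_cross)

definition P where "P = coords (p_vec A g \<phi> p)"

lemma P: "P \<bullet> coords v = pd_star A g \<phi> p v"
  by (simp add: P_def inner_coords g_p_vec)

sublocale E: parseval_basis "coords ` onb (g p)"
proof
  have s: "sum F (coords ` onb (g p)) = (\<Sum>e\<in>onb (g p). F (coords e))" for F :: "real^7 \<Rightarrow> 'z::comm_monoid_add"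
    by (rule sum.reindex_cong[OF inj_on_subset[OF inj_coords]]) auto
  fix x y :: "real^7"
  obtain v where x: "x = coords v" using surjD[OF surj_coords] by blast
  obtain w where y: "y = coords w" using surjD[OF surj_coords] by blast
  show "(\<Sum>e\<in>coords ` onb (g p). (x \<bullet> e) * (y \<bullet> e)) = x \<bullet> y"
    unfolding s x y inner_coords by (rule F.onb_parseval)
  have "g p e e = 1" if "e \<in> onb (g p)" for e
    using F.onb(1) that by (auto simp: F.orthonormal_def)
  then show "(\<Sum>e\<in>coords ` onb (g p). e \<bullet> e) = 7"
    unfolding s inner_coords by (simp add: F.onb)
  have "(\<Sum>e\<in>onb (g p). (coords v \<bullet> coords e) *\<^sub>R coords e) = coords (\<Sum>e\<in>onb (g p). g p v e *\<^sub>R e)"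
    unfolding inner_coords by (simp add: linear_sum[OF linear_coords] coords_simps)
  then show "(\<Sum>e\<in>coords ` onb (g p). (x \<bullet> e) *\<^sub>R e) = x"
    unfolding s x F.onb_expansion .
qed

text \<open>The basis used by \<open>r_bar\<close> is carried by \<open>coords\<close> to an
  orthonormal basis of R^7, where \<open>X4_skew_phi7\<close> applies.\<close>

lemma \<kappa>_X4: "phi7 (\<kappa> X u) v w + phi7 u (\<kappa> X v) w + phi7 u v (\<kappa> X w) =
  - 1 / 12 * psi7 (cross7 P (coords X)) u v w"
proof (rule E.X4_skew_phi7[OF linear_\<kappa> \<kappa>_skew])
  fix y
  obtain w where y: "y = coords w" using surjD[OF surj_coords] by blast
  have s: "sum F (coords ` onb (g p)) = (\<Sum>e\<in>onb (g p). F (coords e))" for F :: "real^7 \<Rightarrow> real"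
    by (rule sum.reindex_cong[OF inj_on_subset[OF inj_coords]]) auto
  have "r_bar A g \<phi> p X w = - 1 / 12 * interior (p_vec A g \<phi> p) (\<phi> p) [X, w]"
    using X4 unfolding type_X4_def by blast
  then have "1 / 4 * ((\<Sum>i\<in>onb (g p). \<Sum>j\<in>onb (g p). \<Sum>k\<in>onb (g p).
      covd A g \<phi> p X [i, j, k] * star_phi g \<phi> p [w, i, j, k]) / 6) = - 1 / 12 * \<phi> p [p_vec A g \<phi> p, X, w]"
    unfolding r_bar_def form_inner_3[OF F.finite_onb] interior_def .
  then show "1 / 24 * (\<Sum>i\<in>coords ` onb (g p). \<Sum>j\<in>coords ` onb (g p). \<Sum>k\<in>coords ` onb (g p).
      (phi7 (\<kappa> X i) j k + phi7 i (\<kappa> X j) k + phi7 i j (\<kappa> X k)) * psi7 y i j k) = - 1 / 12 * phi7 P (coords X) y"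
    unfolding s y covd_phi star_phi_coords F.phi_coords coords_eq[symmetric] P_def by simp
qed

end

section \<open>Hypersurfaces\<close>

locale hypersurface = g2_manifold A' g \<phi>
  for A' :: "('n::{t2_space,second_countable_topology}, real^7) chart set" and g \<phi> +
  fixes A :: "('m::{t2_space,second_countable_topology}, real^6) chart set" and \<iota> :: "'m \<Rightarrow> 'n"
    and n :: "'m \<Rightarrow> real^7"
  assumes M: "smooth_manifold A" and hyp: "hypersurface_with_normal A A' g \<iota> n"
begin

lemma smooth_\<iota>: "smooth_map A A' \<iota>" and inj_T: "inj (tangent_map A A' \<iota> x)"
  and smooth_n: "smooth_along A A' UNIV \<iota> n" and n_unit: "g (\<iota> x) (n x) (n x) = 1"
  and n_normal: "g (\<iota> x) (n x) (tangent_map A A' \<iota> x u) = 0"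
  using hyp unfolding hypersurface_with_normal_def by blast+

sublocale \<iota>: smooth_map_between A A' \<iota>
  by unfold_locales (rule M manifold smooth_\<iota>)+

lemma linear_T: "linear (tangent_map A A' \<iota> x)"
  unfolding tangent_map_def local_rep_def chart_map_def[symmetric]
  by (intro frechet_derivative_linear \<iota>.chart_map_differentiable chart_at[OF M] chart_at[OF manifold])

lemma g2_point_exists: "\<exists>V e. g2_point A' g \<phi> p V e"
proof -
  have "\<exists>V e. open V \<and> p \<in> V \<and> (\<forall>i. smooth_along A' A' V id (e i)) \<and>
        (\<forall>q\<in>V. adapted_frame (g q) (\<phi> q) (\<lambda>i. e i q))"
    using G2 unfolding G2_structure_def by blast
  then obtain V e where "open V" "p \<in> V" "\<forall>i. smooth_along A' A' V id (e i)"
    "\<forall>q\<in>V. adapted_frame (g q) (\<phi> q) (\<lambda>i. e i q)" by (elim exE conjE)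
  then have "g2_point A' g \<phi> p V e"
    by (intro g2_point.intro g2_manifold_axioms g2_point_axioms.intro) simp_all
  then show ?thesis by blast
qed

lemma hyperplane_at:
  assumes "g2_point A' g \<phi> (\<iota> x) V e"
  shows "hyperplane (\<lambda>u. g2_point.coords g (\<iota> x) e (tangent_map A A' \<iota> x u)) (g2_point.coords g (\<iota> x) e (n x))"
proof -
  interpret g2_point A' g \<phi> "\<iota> x" V e by fact
  show ?thesis
  proof (rule hyperplane.intro)
    show "linear (\<lambda>u. coords (tangent_map A A' \<iota> x u))"
      using linear_compose[OF linear_T linear_coords] by (simp add: o_def)
    show "inj (\<lambda>u. coords (tangent_map A A' \<iota> x u))"
      using inj_compose[OF inj_coords inj_T] by (simp add: o_def)
  qed (simp_all add: inner_coords n_unit n_normal)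
qed

text \<open>The cross product with n is orthogonal to n and therefore tangent; injectivity of the
  tangent map makes the description of I well defined.\<close>

lemma T_induced_I:
  "tangent_map A A' \<iota> x (induced_I A A' g \<phi> \<iota> n x u) = cross g \<phi> (\<iota> x) (n x) (tangent_map A A' \<iota> x u)"
proof -
  obtain V e where pt: "g2_point A' g \<phi> (\<iota> x) V e" using g2_point_exists by blast
  interpret g2_point A' g \<phi> "\<iota> x" V e by (rule pt)
  interpret h: hyperplane "\<lambda>u. coords (tangent_map A A' \<iota> x u)" "coords (n x)"
    by (rule hyperplane_at[OF pt])
  have "coords (tangent_map A A' \<iota> x (h.J u)) = coords (cross g \<phi> (\<iota> x) (n x) (tangent_map A A' \<iota> x u))"
    unfolding h.\<sigma>_J cross_def coords_cross ..
  then have *: "tangent_map A A' \<iota> x (h.J u) = cross g \<phi> (\<iota> x) (n x) (tangent_map A A' \<iota> x u)"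
    by (rule injD[OF inj_coords])
  have "\<exists>!v. tangent_map A A' \<iota> x v = cross g \<phi> (\<iota> x) (n x) (tangent_map A A' \<iota> x u)"
  proof (rule ex1I)
    fix v assume "tangent_map A A' \<iota> x v = cross g \<phi> (\<iota> x) (n x) (tangent_map A A' \<iota> x u)"
    then show "v = h.J u" unfolding *[symmetric] by (rule injD[OF inj_T])
  qed (rule *)
  from theI'[OF this] show ?thesis unfolding induced_I_def .
qed

end

section \<open>A hypersurface near one point, in ambient frame components\<close>

locale hypersurface_point = hypersurface A' g \<phi> A \<iota> n + pt: g2_point A' g \<phi> "\<iota> x" V e
  for A' :: "('n::{t2_space,second_countable_topology}, real^7) chart set" and g \<phi>
    and A :: "('m::{t2_space,second_countable_topology}, real^6) chart set" and \<iota> n x V e +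
  fixes \<theta> :: "'m \<Rightarrow> real"
  assumes \<theta>: "smooth_function A \<theta>"
begin

definition d where "d = chart_at A x"

definition z0 where "z0 = snd d x"

definition f where "f = chart_map d pt.c \<iota>"

definition W where "W = snd d ` (fst d \<inter> \<iota> -` (fst pt.c \<inter> V))"

text \<open>Frame components of the tangent map; with \<open>nu\<close> for the normal, the induced
  metric and \<omega> become constant-coefficient expressions in these functions, and \<psi>_+ needs
  only the factors cos \<theta> and sin \<theta> besides.\<close>

definition sig where "sig z u = pt.eps (f z) (frechet_derivative f (at z) u)"

definition nu where "nu z = pt.eps (f z) (from_tangent A' pt.c (\<iota> (chart_inv d z)) (n (chart_inv d z)))"

definition T where "T = tangent_map A A' \<iota> x"

abbreviation \<sigma> where "\<sigma> u \<equiv> pt.coords (T u)"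

abbreviation \<nu> where "\<nu> \<equiv> pt.coords (n x)"

lemma d: "d \<in> A" "x \<in> fst d"
  unfolding d_def by (rule chart_at[OF M])+

lemmas chart = smooth_manifoldD[OF M d(1)]

lemma W: "open W" "z0 \<in> W"
proof -
  have "open (fst pt.c \<inter> V)" using pt.chart(1) pt.V(1) by (rule open_Int)
  then show "open W"
    unfolding W_def by (intro chart_image_open[OF M d(1)] smooth_map_vimage_open[OF smooth_\<iota>])
  show "z0 \<in> W" unfolding W_def z0_def using d(2) pt.c(2) pt.V(2) by blast
qed

lemma in_W:
  assumes "z \<in> W"
  shows "chart_inv d z \<in> fst d" "\<iota> (chart_inv d z) \<in> fst pt.c" "\<iota> (chart_inv d z) \<in> V"
    "snd d (chart_inv d z) = z" "f z \<in> pt.U" "chart_inv pt.c (f z) = \<iota> (chart_inv d z)"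
proof -
  obtain q where q: "z = snd d q" "q \<in> fst d" "\<iota> q \<in> fst pt.c" "\<iota> q \<in> V"
    using assms unfolding W_def by blast
  then have *: "chart_inv d z = q" using chart(3) by simp
  show "chart_inv d z \<in> fst d" "\<iota> (chart_inv d z) \<in> fst pt.c" "\<iota> (chart_inv d z) \<in> V" "snd d (chart_inv d z) = z"
    unfolding * using q by simp_all
  have "f z = snd pt.c (\<iota> q)" by (simp add: f_def chart_map_def *)
  then show "f z \<in> pt.U" "chart_inv pt.c (f z) = \<iota> (chart_inv d z)"
    unfolding * pt.U_def using q pt.chart(3) by auto
qed

lemma at_z0: "chart_inv d z0 = x" "f z0 = pt.y0"
  unfolding z0_def pt.y0_def f_def chart_map_def using chart(3)[OF d(2)] by simp_all

lemma f_smooth: "smooth_on (snd d ` (fst d \<inter> \<iota> -` fst pt.c)) f"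
  unfolding f_def by (rule chart_map_smooth[OF smooth_\<iota> d(1) pt.c(1)])

lemma smooth_on_subset: "smooth_on S F \<Longrightarrow> R \<subseteq> S \<Longrightarrow> smooth_on R F"
proof -
  have "Ck_on k S F \<Longrightarrow> R \<subseteq> S \<Longrightarrow> Ck_on k R F" for k and F :: "'a::euclidean_space \<Rightarrow> 'b::real_normed_vector" and R S
    by (induction k arbitrary: F) (auto intro: continuous_on_subset)
  then show "smooth_on S F \<Longrightarrow> R \<subseteq> S \<Longrightarrow> smooth_on R F" unfolding smooth_on_def by blast
qed

lemma f_smooth_W: "smooth_on W f"
  by (rule smooth_on_subset[OF f_smooth]) (auto simp: W_def)

lemma f_differentiable: "z \<in> W \<Longrightarrow> f differentiable (at z)"
  by (rule smooth_on_differentiable[OF f_smooth_W])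

lemma T_eq: "T = frechet_derivative f (at z0)"
  unfolding T_def tangent_map_def local_rep_def f_def chart_map_def z0_def d_def pt.c_def ..

lemma f_has_derivative: "(f has_derivative T) (at z0)"
  unfolding T_eq using f_differentiable[OF W(2)] frechet_derivative_works by blast

lemma coords_T:
  assumes "z \<in> W"
  shows "frame.coords (g (\<iota> (chart_inv d z))) (\<lambda>i. e i (\<iota> (chart_inv d z)))
    (tangent_map A A' \<iota> (chart_inv d z) (to_tangent A d (chart_inv d z) u)) = sig z u"
  unfolding \<iota>.tangent_map_to_tangent[OF d(1) in_W(1)[OF assms] pt.c(1) in_W(2)[OF assms]]
  unfolding sig_def pt.eps_coords[OF in_W(5)[OF assms]] in_W(6)[OF assms] in_W(4)[OF assms] f_def[symmetric] ..

lemma coords_n: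
  assumes "z \<in> W"
  shows "frame.coords (g (\<iota> (chart_inv d z))) (\<lambda>i. e i (\<iota> (chart_inv d z))) (n (chart_inv d z)) = nu z"
  unfolding nu_def pt.eps_coords[OF in_W(5)[OF assms]] in_W(6)[OF assms]
    to_tangent_from_tangent[OF manifold pt.c(1) in_W(2)[OF assms]] ..

lemma sig_z0: "sig z0 u = \<sigma> u"
  unfolding sig_def at_z0 pt.eps_y0 T_eq ..

lemma nu_z0: "nu z0 = \<nu>"
  using coords_n[OF W(2)] unfolding at_z0 pt.coords_eq by simp

lemma chart_rep_gM: "z \<in> W \<Longrightarrow> chart_rep A (tensor2 (induced_metric A A' g \<iota>)) d z [u, v] = sig z u \<bullet> sig z v"
  unfolding coords_T[symmetric] frame.inner_coords[OF pt.frame_at[OF in_W(3)]]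
  by (simp add: chart_rep_def tensor2_def induced_metric_def)

text \<open>The order of the arguments is reversed because \<omega>(u, v) is the metric applied to u
  and I v, that is, \<phi>(n, v, u).\<close>

lemma chart_rep_omega:
  assumes z: "z \<in> W"
  shows "chart_rep A (tensor2 (omega (induced_metric A A' g \<iota>) (induced_I A A' g \<phi> \<iota> n))) d z [u, v] =
    phi7 (nu z) (sig z v) (sig z u)"
proof -
  interpret q: frame "g (\<iota> (chart_inv d z))" "\<phi> (\<iota> (chart_inv d z))" "\<lambda>i. e i (\<iota> (chart_inv d z))"
    by (rule pt.frame_at[OF in_W(3)[OF z]])
  show ?thesis
    unfolding coords_T[OF z, symmetric] coords_n[OF z, symmetric] q.phi_coords[symmetric]
    by (simp add: chart_rep_def tensor2_def omega_def induced_metric_def T_induced_I cross_def q.sym[of _ "sharp _ _"]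
        q.sharp[OF q.linear_phi])
qed

lemma chart_rep_pullback: "z \<in> W \<Longrightarrow> chart_rep A (pullback A A' \<iota> \<phi>) d z [u, v, w] = phi7 (sig z u) (sig z v) (sig z w)"
  unfolding coords_T[symmetric] frame.phi_coords[OF pt.frame_at[OF in_W(3)], symmetric]
  by (simp add: chart_rep_def pullback_def)

lemma chart_rep_pullback_n:
  "z \<in> W \<Longrightarrow> chart_rep A (pullback_n_star_phi A A' g \<phi> \<iota> n) d z [u, v, w] = psi7 (nu z) (sig z u) (sig z v) (sig z w)"
  unfolding coords_T[symmetric] coords_n[symmetric] frame.star_coords[OF pt.frame_at[OF in_W(3)], symmetric]
  by (simp add: chart_rep_def pullback_n_star_phi_def interior_def star_phi_def)

lemma chart_rep_psi:
  assumes "z \<in> W"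
  shows "chart_rep A (psi_plus A A' g \<phi> \<iota> n \<theta>) d z [u, v, w] =
      cos ((\<theta> \<circ> chart_inv d) z) * phi7 (sig z u) (sig z v) (sig z w)
      - sin ((\<theta> \<circ> chart_inv d) z) * psi7 (nu z) (sig z u) (sig z v) (sig z w)"
  using chart_rep_pullback[OF assms] chart_rep_pullback_n[OF assms]
  by (simp add: chart_rep_def psi_plus_def)

lemma psi_at_x:
  "psi_plus A A' g \<phi> \<iota> n \<theta> x [u, v, w] = cos (\<theta> x) * phi7 (\<sigma> u) (\<sigma> v) (\<sigma> w) - sin (\<theta> x) * psi7 \<nu> (\<sigma> u) (\<sigma> v) (\<sigma> w)"
  "psi_minus A A' g \<phi> \<iota> n \<theta> x [u, v, w] = sin (\<theta> x) * phi7 (\<sigma> u) (\<sigma> v) (\<sigma> w) + cos (\<theta> x) * psi7 \<nu> (\<sigma> u) (\<sigma> v) (\<sigma> w)"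
  unfolding psi_plus_def psi_minus_def pullback_def pullback_n_star_phi_def interior_def T_def[symmetric]
  by (simp_all add: pt.F.phi_coords pt.coords_eq[symmetric] pt.star_phi_coords)

section \<open>The Gauss and Weingarten formulas\<close>

definition D2 where "D2 u v = frechet_derivative (\<lambda>z. frechet_derivative f (at z) v) (at z0) u"

text \<open>Smoothness controls derivatives in basis directions; a general direction v is reached by
  expanding it.\<close>

lemma f_partial_differentiable: "(\<lambda>z. frechet_derivative f (at z) v) differentiable (at z0)"
  and D2_expansion: "D2 u v = (\<Sum>b\<in>Basis. (v \<bullet> b) *\<^sub>R D2 u b)"
proof -
  have "((\<lambda>z. frechet_derivative f (at z) b) has_derivative (\<lambda>u. D2 u b)) (at z0)" if "b \<in> Basis" for b
    unfolding D2_def using smooth_on_differentiable[OF smooth_on_partial[OF f_smooth_W that] W(2)]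
    frechet_derivative_works by blast
  then have "((\<lambda>z. \<Sum>b\<in>Basis. (v \<bullet> b) *\<^sub>R frechet_derivative f (at z) b) has_derivative
      (\<lambda>u. \<Sum>b\<in>Basis. (v \<bullet> b) *\<^sub>R D2 u b)) (at z0)"
    by (intro has_derivative_sum has_derivative_scaleR_right)
  then have *: "((\<lambda>z. frechet_derivative f (at z) v) has_derivative (\<lambda>u. \<Sum>b\<in>Basis. (v \<bullet> b) *\<^sub>R D2 u b)) (at z0)"
    by (rule has_derivative_transform_within_open[OF _ W])
       (rule linear_Basis_expansion[OF frechet_derivative_linear[OF f_differentiable], symmetric])
  then show "(\<lambda>z. frechet_derivative f (at z) v) differentiable (at z0)" by (rule differentiableI)
  show "D2 u v = (\<Sum>b\<in>Basis. (v \<bullet> b) *\<^sub>R D2 u b)"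
    unfolding D2_def[of u v] by (rule frechet_derivative_apply[OF *])
qed

lemma D2_has_derivative: "((\<lambda>z. frechet_derivative f (at z) v) has_derivative (\<lambda>u. D2 u v)) (at z0)"
  unfolding D2_def using f_partial_differentiable frechet_derivative_works by blast

lemma bilinear_D2: "bilinear D2"
proof -
  have 1: "linear (\<lambda>u. D2 u v)" for v
    using D2_has_derivative has_derivative_linear by blast
  have 2: "linear (D2 u)" for u
    by (rule linearI; subst D2_expansion; subst (2) D2_expansion)
       (subst (3) D2_expansion, simp_all add: inner_simps scaleR_add_left sum.distrib scaleR_sum_right)
  show ?thesis unfolding bilinear_def using 1 2 by blast
qed

text \<open>Equality of mixed partials, from which both the second fundamental form and the induced
  connection inherit their symmetry.\<close>

lemma D2_sym: "D2 u v = D2 v u"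
proof -
  have "bilinear (\<lambda>u v. D2 v u)" using bilinear_D2 unfolding bilinear_def by blast
  moreover have "D2 u v = D2 v u" if "u \<in> Basis" "v \<in> Basis" for u v
    unfolding D2_def by (rule mixed_partials[OF W f_smooth_W that(2,1)])
  ultimately have "D2 = (\<lambda>u v. D2 v u)"
    using bilinear_D2 by (intro bilinear_eq_stdbasis)
  then show ?thesis by (rule fun_cong[THEN fun_cong])
qed

abbreviation gM where "gM \<equiv> induced_metric A A' g \<iota>"

abbreviation I where "I \<equiv> induced_I A A' g \<phi> \<iota> n"

abbreviation \<psi>p where "\<psi>p \<equiv> psi_plus A A' g \<phi> \<iota> n \<theta>"

abbreviation \<psi>m where "\<psi>m \<equiv> psi_minus A A' g \<phi> \<iota> n \<theta>"

sublocale H: hyperplane \<sigma> \<nu>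
  unfolding T_def by (rule hyperplane_at) unfold_locales

lemma gM_eq: "gM x = H.G"
  by (simp add: fun_eq_iff induced_metric_def H.G_def pt.inner_coords T_def[symmetric])

lemma I_eq: "I x = H.J"
proof
  fix u
  have "T (I x u) = cross g \<phi> (\<iota> x) (n x) (T u)"
    unfolding T_def by (rule T_induced_I)
  then have "\<sigma> (I x u) = \<sigma> (H.J u)"
    unfolding H.\<sigma>_J by (simp add: cross_def pt.coords_cross)
  then show "I x u = H.J u" by (rule injD[OF H.inj_\<sigma>])
qed

definition B where "B = second_fundamental_form A A' g \<iota> n x"

lemma B_eq: "B u v = pt.coords (D2 u v + pt.\<Gamma> (T u) (T v)) \<bullet> \<nu>"
  unfolding B_def second_fundamental_form_def pt.inner_coords D2_def pt.\<Gamma>_def T_def f_def chart_map_def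
    local_rep_def z0_def d_def pt.c_def ..

lemma T_simps: "T (u + v) = T u + T v" "T (r *\<^sub>R u) = r *\<^sub>R T u"
  using linear_add[OF linear_T] linear_scale[OF linear_T] unfolding T_def by blast+

lemma D2_simps: "D2 (u + u') v = D2 u v + D2 u' v" "D2 (r *\<^sub>R u) v = r *\<^sub>R D2 u v"
  "D2 u (v + v') = D2 u v + D2 u v'" "D2 u (r *\<^sub>R v) = r *\<^sub>R D2 u v"
  using bilinear_D2 bilinear_ladd bilinear_lmul bilinear_radd bilinear_rmul by blast+

lemma \<Gamma>_simps: "pt.\<Gamma> (X + X') Y = pt.\<Gamma> X Y + pt.\<Gamma> X' Y" "pt.\<Gamma> (r *\<^sub>R X) Y = r *\<^sub>R pt.\<Gamma> X Y"
  "pt.\<Gamma> X (Y + Y') = pt.\<Gamma> X Y + pt.\<Gamma> X Y'" "pt.\<Gamma> X (r *\<^sub>R Y) = r *\<^sub>R pt.\<Gamma> X Y"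
  using pt.\<Gamma>(1) bilinear_ladd bilinear_lmul bilinear_radd bilinear_rmul by blast+

lemma B_sym: "B u v = B v u"
  unfolding B_eq D2_sym[of u v] pt.\<Gamma>(2)[of "T u" "T v"] ..

lemma B_simps: "B (u + u') v = B u v + B u' v" "B (r *\<^sub>R u) v = r * B u v"
  "B u (v + v') = B u v + B u v'" "B u (r *\<^sub>R v) = r * B u v"
  unfolding B_eq by (simp_all add: D2_simps \<Gamma>_simps T_simps pt.coords_simps inner_simps algebra_simps)

text \<open>The tangential part of the ambient derivative; \<open>christoffel_M\<close> identifies
  it with the Levi-Civita connection of the induced metric.\<close>

definition \<Gamma>M where
  "\<Gamma>M u v = (SOME w. \<sigma> w = pt.coords (D2 u v + pt.\<Gamma> (T u) (T v)) - B u v *\<^sub>R \<nu>)"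

lemma gauss: "pt.coords (D2 u v + pt.\<Gamma> (T u) (T v)) = \<sigma> (\<Gamma>M u v) + B u v *\<^sub>R \<nu>"
proof -
  have "\<nu> \<bullet> (pt.coords (D2 u v + pt.\<Gamma> (T u) (T v)) - B u v *\<^sub>R \<nu>) = 0"
    unfolding B_eq inner_diff_right inner_scaleR_right H.\<nu>\<nu> by (simp add: inner_commute)
  then obtain w where "\<sigma> w = pt.coords (D2 u v + pt.\<Gamma> (T u) (T v)) - B u v *\<^sub>R \<nu>"
    by (rule H.\<sigma>_surj)
  from someI[of "\<lambda>w. \<sigma> w = pt.coords (D2 u v + pt.\<Gamma> (T u) (T v)) - B u v *\<^sub>R \<nu>", OF this]
  show ?thesis unfolding \<Gamma>M_def[symmetric] by simp
qed

text \<open>Split so that the first summand cancels against the Christoffel terms of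
  \<open>covd\<close>; the bracket is the part \<open>K\<close> that survives.\<close>

definition Dsig where "Dsig u v = \<sigma> (\<Gamma>M u v) + (pt.\<kappa> (T u) (\<sigma> v) + B u v *\<^sub>R \<nu>)"

lemma sig_has_derivative: "((\<lambda>z. sig z v) has_derivative (\<lambda>u. Dsig u v)) (at z0)"
proof -
  have "((\<lambda>z. sig z v) has_derivative (\<lambda>u. pt.coords (D2 u v) + pt.Deps (T u) (frechet_derivative f (at z0) v))) (at z0)"
    unfolding sig_def
    by (rule pt.has_derivative_eps[OF W in_W(5) at_z0(2) f_has_derivative D2_has_derivative])
  then show ?thesis
  proof (rule has_derivative_eq_rhs)
    show "(\<lambda>u. pt.coords (D2 u v) + pt.Deps (T u) (frechet_derivative f (at z0) v)) = (\<lambda>u. Dsig u v)"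
      unfolding T_eq[symmetric]
    proof
      fix u
      have "Dsig u v = pt.coords (D2 u v + pt.\<Gamma> (T u) (T v)) + pt.\<kappa> (T u) (\<sigma> v)"
        unfolding Dsig_def gauss by (simp add: algebra_simps)
      then show "pt.coords (D2 u v) + pt.Deps (T u) (T v) = Dsig u v"
        by (simp add: pt.\<kappa>_coords pt.coords_simps)
    qed
  qed
qed

definition Dnu where "Dnu = frechet_derivative nu (at z0)"

lemma nu_has_derivative: "(nu has_derivative Dnu) (at z0)"
proof -
  let ?N = "\<lambda>z. from_tangent A' pt.c (\<iota> (chart_inv d z)) (n (chart_inv d z))"
  have "smooth_on (snd d ` (fst d \<inter> UNIV \<inter> \<iota> -` fst pt.c)) ?N"
    using smooth_n d(1) pt.c(1) unfolding smooth_along_def by blast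
  then have "?N differentiable (at z0)"
    by (rule smooth_on_differentiable) (use d(2) pt.c(2) in \<open>auto simp: z0_def\<close>)
  then obtain N' where N': "(?N has_derivative N') (at z0)" unfolding differentiable_def by blast
  have "(nu has_derivative (\<lambda>u. pt.coords (N' u) + pt.Deps (T u) (?N z0))) (at z0)"
    unfolding nu_def by (rule pt.has_derivative_eps[OF W in_W(5) at_z0(2) f_has_derivative N'])
  then have "nu differentiable (at z0)" by (rule differentiableI)
  then show ?thesis unfolding Dnu_def frechet_derivative_works .
qed

lemma nu_relations:
  assumes "z \<in> W"
  shows "nu z \<bullet> nu z = 1" "nu z \<bullet> sig z v = 0"
  unfolding coords_T[OF assms, symmetric] coords_n[OF assms, symmetric]
    frame.inner_coords[OF pt.frame_at[OF in_W(3)[OF assms]]] by (rule n_unit n_normal)+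

text \<open>Obtained by differentiating the unit length of the normal and its orthogonality to
  tangent vectors.\<close>

lemma Dnu_relations: "\<nu> \<bullet> Dnu u = 0" "\<sigma> v \<bullet> Dnu u = - (\<nu> \<bullet> Dsig u v)"
proof -
  have const: "D u = 0" if "(F has_derivative D) (at z0)" "\<And>z. z \<in> W \<Longrightarrow> F z = k" for F D and k :: real
  proof -
    have "((\<lambda>z. k) has_derivative D) (at z0)"
      by (rule has_derivative_transform_within_open[OF that(1) W]) (rule that(2))
    from has_derivative_unique[OF this has_derivative_const] show ?thesis by simp
  qed
  have "nu z0 \<bullet> Dnu u + Dnu u \<bullet> nu z0 = 0"
    by (rule const[OF has_derivative_inner[OF nu_has_derivative nu_has_derivative] nu_relations(1)])
  then show "\<nu> \<bullet> Dnu u = 0" unfolding nu_z0 by (simp add: inner_commute)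
  have "nu z0 \<bullet> Dsig u v + Dnu u \<bullet> sig z0 v = 0"
    by (rule const[OF has_derivative_inner[OF nu_has_derivative sig_has_derivative] nu_relations(2)])
  then show "\<sigma> v \<bullet> Dnu u = - (\<nu> \<bullet> Dsig u v)" unfolding nu_z0 sig_z0 by (simp add: inner_commute)
qed

lemma christoffel_M: "christoffel A gM x = \<Gamma>M"
proof (rule christoffel_eq)
  have \<sigma>_\<Gamma>M: "\<sigma> (\<Gamma>M u v) = pt.coords (D2 u v + pt.\<Gamma> (T u) (T v)) - B u v *\<^sub>R \<nu>" for u v
    unfolding gauss by simp
  show "inner_form (gM x)" unfolding gM_eq by (rule H.inner_form_axioms)
  show "bilinear \<Gamma>M"
    unfolding bilinear_def
    by (intro conjI allI linearI; rule injD[OF H.inj_\<sigma>])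
       (simp_all add: \<sigma>_\<Gamma>M H.\<sigma>_simps D2_simps \<Gamma>_simps T_simps B_simps pt.coords_simps algebra_simps)
  show "\<Gamma>M u v = \<Gamma>M v u" for u v
    by (rule injD[OF H.inj_\<sigma>]) (simp only: \<sigma>_\<Gamma>M D2_sym[of u v] pt.\<Gamma>(2)[of "T u" "T v"] B_sym[of u v])
  show "component_deriv A (tensor2 gM) x u [v, w] = gM x (\<Gamma>M u v) w + gM x v (\<Gamma>M u w)" for u v w
  proof -
    have "((\<lambda>z. chart_rep A (tensor2 gM) d z [v, w]) has_derivative
        (\<lambda>u. sig z0 v \<bullet> Dsig u w + Dsig u v \<bullet> sig z0 w)) (at z0)"
      by (rule has_derivative_transform_within_open[OF has_derivative_inner[OF sig_has_derivative sig_has_derivative] W])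
         (simp add: chart_rep_gM)
    from frechet_derivative_apply[OF this, of u]
    have "component_deriv A (tensor2 gM) x u [v, w] = \<sigma> v \<bullet> Dsig u w + Dsig u v \<bullet> \<sigma> w"
      unfolding component_deriv_def d_def[symmetric] z0_def[symmetric] sig_z0 .
    \<comment> \<open>The \<kappa> terms cancel by skewness and the normal terms are orthogonal to
      \<sigma>.\<close>
    also have "\<dots> = \<sigma> v \<bullet> \<sigma> (\<Gamma>M u w) + \<sigma> (\<Gamma>M u v) \<bullet> \<sigma> w"
      using pt.\<kappa>_skew[of "T u" "\<sigma> v" "\<sigma> w"] by (simp add: Dsig_def inner_simps H.\<nu>\<sigma> H.\<sigma>\<nu>)
    finally show ?thesis unfolding gM_eq H.G_def by simp
  qed
qed

definition \<beta> where "\<beta> u = (\<Sum>e\<in>onb H.G. B u e *\<^sub>R e)"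

lemma G_\<beta>: "H.G (\<beta> u) v = B u v"
proof -
  have "linear (B u)" by (intro linearI) (simp_all add: B_simps)
  from H.linear_onb_sum[OF this, of v] show ?thesis
    unfolding \<beta>_def by (simp add: H.simps H.sym[of v] mult.commute)
qed

lemma linear_\<beta>: "linear \<beta>"
  unfolding \<beta>_def by (intro linearI) (simp_all add: B_simps scaleR_add_left sum.distrib scaleR_sum_right)

text \<open>The Weingarten formula in a rotating frame: the difference of the two sides is
  orthogonal to \<nu> and to every tangent vector.\<close>

lemma Dnu_eq: "Dnu u = pt.\<kappa> (T u) \<nu> - \<sigma> (\<beta> u)"
proof -
  define y where "y = Dnu u - (pt.\<kappa> (T u) \<nu> - \<sigma> (\<beta> u))"
  have "\<nu> \<bullet> pt.\<kappa> (T u) \<nu> = 0"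
    using pt.\<kappa>_skew[of "T u" \<nu> \<nu>] inner_commute[of \<nu> "pt.\<kappa> (T u) \<nu>"] by simp
  then have "\<nu> \<bullet> y = 0"
    using Dnu_relations(1)[of u] by (simp add: y_def inner_diff_right H.\<nu>\<sigma>)
  then have y\<nu>: "y \<bullet> \<nu> = 0" by (subst inner_commute)
  have y\<sigma>: "\<sigma> v \<bullet> y = 0" for v
  proof -
    have "\<nu> \<bullet> Dsig u v = \<nu> \<bullet> pt.\<kappa> (T u) (\<sigma> v) + B u v"
      unfolding Dsig_def by (simp add: inner_simps H.\<nu>\<sigma> H.\<nu>\<nu>)
    moreover have "\<sigma> v \<bullet> pt.\<kappa> (T u) \<nu> = - (\<nu> \<bullet> pt.\<kappa> (T u) (\<sigma> v))"
      using pt.\<kappa>_skew[of "T u" "\<sigma> v" \<nu>] inner_commute[of "pt.\<kappa> (T u) (\<sigma> v)" \<nu>] by simp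
    moreover have "\<sigma> v \<bullet> \<sigma> (\<beta> u) = B u v"
      unfolding G_\<beta>[symmetric] H.G_def by (rule inner_commute)
    ultimately show ?thesis
      using Dnu_relations(2)[of v u] unfolding y_def inner_diff_right by linarith
  qed
  obtain a where a: "y = \<sigma> a + (y \<bullet> \<nu>) *\<^sub>R \<nu>" by (rule H.tangential_part)
  then have "y = \<sigma> a" by (simp add: y\<nu>)
  with y\<sigma>[of a] have "y = 0" by simp
  then show ?thesis unfolding y_def by simp
qed

section \<open>Covariant derivatives of \<omega> and \<psi>_+\<close>

definition K where "K u v = pt.\<kappa> (T u) (\<sigma> v) + H.G (\<beta> u) v *\<^sub>R \<nu>"

lemma Dsig_eq: "Dsig u v = \<sigma> (\<Gamma>M u v) + K u v"
  unfolding Dsig_def K_def G_\<beta> ..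

lemma omega_at_x: "omega gM I x u v = phi7 \<nu> (\<sigma> v) (\<sigma> u)"
  by (simp add: omega_def gM_eq I_eq H.phi7_\<nu> H.sym)

text \<open>The \<kappa> terms form the derivative of \<phi> on n and two tangent vectors, to which
  type X4 applies. The normal part of \<open>K\<close> drops out by skewness, and the shape operator
  in \<open>Dnu_eq\<close> supplies the \<Phi> term.\<close>

lemma nabla_omega_eq:
  "nabla_omega A gM I x u v w = H.\<Phi> (\<beta> u) v w + 1 / 12 * psi7 (cross7 pt.P (\<sigma> u)) \<nu> (\<sigma> v) (\<sigma> w)"
proof -
  have "((\<lambda>z. chart_rep A (tensor2 (omega gM I)) d z [v, w]) has_derivative
      (\<lambda>u. phi7 (Dnu u) (sig z0 w) (sig z0 v) + phi7 (nu z0) (Dsig u w) (sig z0 v) + phi7 (nu z0) (sig z0 w) (Dsig u v))) (at z0)"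
    by (rule has_derivative_transform_within_open[OF
          has_derivative_phi7[OF nu_has_derivative sig_has_derivative sig_has_derivative] W])
       (simp add: chart_rep_omega)
  from frechet_derivative_apply[OF this, of u]
  have "component_deriv A (tensor2 (omega gM I)) x u [v, w] =
    phi7 (Dnu u) (\<sigma> w) (\<sigma> v) + phi7 \<nu> (Dsig u w) (\<sigma> v) + phi7 \<nu> (\<sigma> w) (Dsig u v)"
    unfolding component_deriv_def d_def[symmetric] z0_def[symmetric] sig_z0 nu_z0 .
  then have "nabla_omega A gM I x u v w =
    phi7 (Dnu u) (\<sigma> w) (\<sigma> v) + phi7 \<nu> (K u w) (\<sigma> v) + phi7 \<nu> (\<sigma> w) (K u v)"
    unfolding nabla_omega_def covd_def christoffel_M Dsig_eq
    by (simp add: lessThan_Suc tensor2_def omega_at_x phi7_simps)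
  also have "\<dots> = (phi7 (pt.\<kappa> (T u) \<nu>) (\<sigma> w) (\<sigma> v) + phi7 \<nu> (pt.\<kappa> (T u) (\<sigma> w)) (\<sigma> v) + phi7 \<nu> (\<sigma> w) (pt.\<kappa> (T u) (\<sigma> v)))
      - H.\<Phi> (\<beta> u) w v"
  proof -
    have "phi7 \<nu> \<nu> y = 0" "phi7 \<nu> y \<nu> = 0" for y
      by (simp_all add: phi7_def cross7_self cross7_orthogonal)
    then show ?thesis unfolding Dnu_eq K_def H.\<Phi>_def by (simp add: phi7_simps)
  qed
  also have "\<dots> = - 1 / 12 * psi7 (cross7 pt.P (\<sigma> u)) \<nu> (\<sigma> w) (\<sigma> v) + H.\<Phi> (\<beta> u) v w"
    unfolding pt.\<kappa>_X4 using H.H.\<Phi>_skew23[of "\<beta> u" v w] by simp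
  finally show ?thesis
    using psi7_skew34[of "cross7 pt.P (\<sigma> u)" \<nu> "\<sigma> v" "\<sigma> w"] by simp
qed

text \<open>Differentiating cos and sin yields -d\<theta> times \<psi>_-; everything else has the
  shape that \<open>covariant_pairing\<close> takes as input.\<close>

lemma covd_psi:
  "covd A gM \<psi>p x u [a, b, c] =
      cos (\<theta> x) * (phi7 (K u a) (\<sigma> b) (\<sigma> c) + phi7 (\<sigma> a) (K u b) (\<sigma> c) + phi7 (\<sigma> a) (\<sigma> b) (K u c))
      - sin (\<theta> x) * (psi7 (pt.\<kappa> (T u) \<nu> - \<sigma> (\<beta> u)) (\<sigma> a) (\<sigma> b) (\<sigma> c) + psi7 \<nu> (K u a) (\<sigma> b) (\<sigma> c)
          + psi7 \<nu> (\<sigma> a) (K u b) (\<sigma> c) + psi7 \<nu> (\<sigma> a) (\<sigma> b) (K u c)) - differential A \<theta> x u * \<psi>m x [a, b, c]"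
proof -
  let ?t = "\<theta> \<circ> chart_inv d"
  have "?t differentiable (at z0)"
    by (rule smooth_on_differentiable[of "snd d ` fst d"]) (use \<theta> d in \<open>auto simp: smooth_function_def z0_def\<close>)
  then have t: "(?t has_derivative differential A \<theta> x) (at z0)"
    unfolding frechet_derivative_works differential_def d_def z0_def .
  have t0: "?t z0 = \<theta> x" by (simp add: at_z0)
  note s = sig_has_derivative
  have "((\<lambda>z. cos (?t z) * phi7 (sig z a) (sig z b) (sig z c) - sin (?t z) * psi7 (nu z) (sig z a) (sig z b) (sig z c))
    has_derivative (\<lambda>u. (cos (?t z0) * (phi7 (Dsig u a) (sig z0 b) (sig z0 c) + phi7 (sig z0 a) (Dsig u b) (sig z0 c) + phi7 (sig z0 a) (sig z0 b) (Dsig u c))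
        + differential A \<theta> x u * (- sin (?t z0)) * phi7 (sig z0 a) (sig z0 b) (sig z0 c))
      - (sin (?t z0) * (psi7 (Dnu u) (sig z0 a) (sig z0 b) (sig z0 c) + psi7 (nu z0) (Dsig u a) (sig z0 b) (sig z0 c)
          + psi7 (nu z0) (sig z0 a) (Dsig u b) (sig z0 c) + psi7 (nu z0) (sig z0 a) (sig z0 b) (Dsig u c))
        + differential A \<theta> x u * cos (?t z0) * psi7 (nu z0) (sig z0 a) (sig z0 b) (sig z0 c)))) (at z0)"
    by (intro has_derivative_diff has_derivative_mult has_derivative_phi7 has_derivative_psi7 s nu_has_derivative
        has_derivative_cos[OF t, THEN has_derivative_eq_rhs] has_derivative_sin[OF t, THEN has_derivative_eq_rhs] ext) simp_all
  from has_derivative_transform_within_open[OF this W, of "\<lambda>z. chart_rep A \<psi>p d z [a, b, c]"]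
  have "((\<lambda>z. chart_rep A \<psi>p d z [a, b, c]) has_derivative (\<lambda>u. (cos (?t z0) * (phi7 (Dsig u a) (sig z0 b) (sig z0 c) + phi7 (sig z0 a) (Dsig u b) (sig z0 c) + phi7 (sig z0 a) (sig z0 b) (Dsig u c))
        + differential A \<theta> x u * (- sin (?t z0)) * phi7 (sig z0 a) (sig z0 b) (sig z0 c))
      - (sin (?t z0) * (psi7 (Dnu u) (sig z0 a) (sig z0 b) (sig z0 c) + psi7 (nu z0) (Dsig u a) (sig z0 b) (sig z0 c)
          + psi7 (nu z0) (sig z0 a) (Dsig u b) (sig z0 c) + psi7 (nu z0) (sig z0 a) (sig z0 b) (Dsig u c))
        + differential A \<theta> x u * cos (?t z0) * psi7 (nu z0) (sig z0 a) (sig z0 b) (sig z0 c)))) (at z0)"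
    by (simp add: chart_rep_psi)
  from frechet_derivative_apply[OF this, of u]
  have 1: "component_deriv A \<psi>p x u [a, b, c] = (cos (\<theta> x) * (phi7 (Dsig u a) (\<sigma> b) (\<sigma> c) + phi7 (\<sigma> a) (Dsig u b) (\<sigma> c) + phi7 (\<sigma> a) (\<sigma> b) (Dsig u c))
        + differential A \<theta> x u * (- sin (\<theta> x)) * phi7 (\<sigma> a) (\<sigma> b) (\<sigma> c))
      - (sin (\<theta> x) * (psi7 (Dnu u) (\<sigma> a) (\<sigma> b) (\<sigma> c) + psi7 \<nu> (Dsig u a) (\<sigma> b) (\<sigma> c)
          + psi7 \<nu> (\<sigma> a) (Dsig u b) (\<sigma> c) + psi7 \<nu> (\<sigma> a) (\<sigma> b) (Dsig u c))
        + differential A \<theta> x u * cos (\<theta> x) * psi7 \<nu> (\<sigma> a) (\<sigma> b) (\<sigma> c))"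
    unfolding component_deriv_def d_def[symmetric] z0_def[symmetric] sig_z0 nu_z0 t0 .
  have 2: "covd A gM \<psi>p x u [a, b, c] = component_deriv A \<psi>p x u [a, b, c]
    - (\<psi>p x [\<Gamma>M u a, b, c] + \<psi>p x [a, \<Gamma>M u b, c] + \<psi>p x [a, b, \<Gamma>M u c])"
    unfolding covd_def christoffel_M by (simp add: lessThan_Suc)
  show ?thesis
    unfolding 2 1 psi_at_x Dsig_eq Dnu_eq phi7_simps(1,4,7) psi7_simps(1-4) by (simp add: phi7_simps psi7_simps algebra_simps)
qed

sublocale X: X4_hyperplane \<sigma> \<nu> \<beta> pt.P "\<theta> x" "\<psi>p x" "nabla_omega A gM I x"
proof (intro X4_hyperplane.intro X4_hyperplane_axioms.intro H.hyperplane_axioms)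
  show "H.G (\<beta> u) v = H.G u (\<beta> v)" for u v
    unfolding G_\<beta> H.sym[of u] B_sym[of u v] ..
  show "\<psi>p x [u, v, w] = cos (\<theta> x) * H.\<Phi> u v w - sin (\<theta> x) * psi7 \<nu> (\<sigma> u) (\<sigma> v) (\<sigma> w)" for u v w
    unfolding psi_at_x H.\<Phi>_def ..
qed (rule linear_\<beta> nabla_omega_eq)+

section \<open>From pointwise torsion to conditions on the hypersurface\<close>

lemma mean_curvature: "1 / 6 * metric_trace (gM x) B = X.h"
  unfolding X.h_def gM_eq G_\<beta> ..

lemma codiff_omega_eq: "codiff_omega A gM I x u = - 4 * X.\<tau> u"
  unfolding codiff_omega_def gM_eq by (rule X.codifferential)

lemma pd_tangential: "pd_star A' g \<phi> (\<iota> x) (tangent_map A A' \<iota> x u) = 12 * X.\<tau> (H.J u)"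
  using pt.P[of "T u"] X.inner_P[of u] by (simp add: T_def)

lemma pd_normal: "pd_star A' g \<phi> (\<iota> x) (n x) = pt.P \<bullet> \<nu>"
  by (rule pt.P[symmetric])

lemma linear_differential: "linear (differential A \<theta> x)"
proof -
  have "(\<theta> \<circ> chart_inv d) differentiable (at z0)"
    by (rule smooth_on_differentiable[of "snd d ` fst d"]) (use \<theta> d in \<open>auto simp: smooth_function_def z0_def\<close>)
  then show ?thesis unfolding differential_def d_def z0_def by (rule frechet_derivative_linear)
qed

text \<open>The constant is (-1/12) (1/3!) (-24) = 1/3.\<close>

lemma eta_eq: "eta A gM I \<psi>p \<psi>m x u = (differential A \<theta> x (H.J u) + X.\<tau> (H.J u)) / 3"
proof -
  let ?d = "differential A \<theta> x"
  let ?\<mu> = "\<lambda>u. (?d (H.J u) + X.\<tau> (H.J u)) / 3"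
  have pairing: "(\<Sum>e\<in>onb H.G. \<Sum>f\<in>onb H.G. \<Sum>k\<in>onb H.G. covd A gM \<psi>p x u [e, f, k] * \<psi>m x [e, f, k])
    = - 24 * ?d u - 24 * X.\<tau> u" for u
    by (rule X.covariant_pairing[where D = "\<lambda>e f k. covd A gM \<psi>p x u [e, f, k]" and M = "\<lambda>e f k. \<psi>m x [e, f, k]",
          OF pt.linear_\<kappa> pt.\<kappa>_skew pt.\<kappa>_X4 K_def refl covd_psi])
       (simp add: psi_at_x H.\<Phi>_def)
  have inner: "- 1 / 12 * form_inner (gM x) 3 (covd A gM \<psi>p x u) (\<psi>m x) = (?d u + X.\<tau> u) / 3" for u
    unfolding gM_eq form_inner_3[OF H.finite_onb] pairing by (simp add: field_simps)
  have *: "(\<forall>u. act1 (I x) \<mu> u = - 1 / 12 * form_inner (gM x) 3 (covd A gM \<psi>p x u) (\<psi>m x))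
    \<longleftrightarrow> \<mu> = ?\<mu>" for \<mu>
  proof
    assume "\<forall>u. act1 (I x) \<mu> u = - 1 / 12 * form_inner (gM x) 3 (covd A gM \<psi>p x u) (\<psi>m x)"
    then have *: "- \<mu> (H.J u) = (?d u + X.\<tau> u) / 3" for u
      unfolding inner act1_def I_eq by blast
    show "\<mu> = ?\<mu>"
    proof
      fix u
      show "\<mu> u = ?\<mu> u"
        \<comment> \<open>Substituting -J u for u solves (I\<mu>)(u) = -\<mu>(J u) for
          \<mu>.\<close>
        using *[of "- H.J u"]
        by (simp add: linear_neg[OF H.linear_J] H.JJ linear_neg[OF linear_differential]
            linear_neg[OF X.linear_\<tau>])
    qed
  next
    assume "\<mu> = ?\<mu>"
    then show "\<forall>u. act1 (I x) \<mu> u = - 1 / 12 * form_inner (gM x) 3 (covd A gM \<psi>p x u) (\<psi>m x)"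
      unfolding inner act1_def I_eq
      by (simp add: H.JJ linear_neg[OF linear_differential] linear_neg[OF X.linear_\<tau>] minus_divide_left)
  qed
  show ?thesis unfolding eta_def * by simp
qed

text \<open>All three expressions equal 12 \<tau>(J u): the codifferential contributes 3 * 4, and
  the d\<theta> terms cancel because 36/3 = 12.\<close>

lemma one_form_identities:
  "3 * act1 (I x) (codiff_omega A gM I x) u = pd_star A' g \<phi> (\<iota> x) (tangent_map A A' \<iota> x u)"
  "pd_star A' g \<phi> (\<iota> x) (tangent_map A A' \<iota> x u) =
    12 * act1 (I x) (differential A \<theta> x) u + 36 * eta A gM I \<psi>p \<psi>m x u"
  unfolding pd_tangential eta_eq act1_def codiff_omega_eq I_eq by (simp_all add: field_simps)

lemma p_vec_normal_iff:
  "p_vec A' g \<phi> (\<iota> x) - g (\<iota> x) (p_vec A' g \<phi> (\<iota> x)) (n x) *\<^sub>R n x = 0 \<longleftrightarrow> (\<forall>z. X.\<tau> z = 0)"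
proof -
  let ?v = "p_vec A' g \<phi> (\<iota> x) - g (\<iota> x) (p_vec A' g \<phi> (\<iota> x)) (n x) *\<^sub>R n x"
  have "pt.coords ?v = pt.P - (pt.P \<bullet> \<nu>) *\<^sub>R \<nu>"
    by (simp add: pt.coords_simps pt.P_def pt.inner_coords)
  moreover have "pt.coords ?v = 0 \<longleftrightarrow> ?v = 0"
    using inj_eq[OF pt.inj_coords, of ?v 0] unfolding linear_0[OF pt.linear_coords] .
  ultimately show ?thesis using X.P_normal_iff by simp
qed

abbreviation vanishes where
  "vanishes w \<equiv> \<forall>u v y. torsion_component (gM x) (I x) (\<psi>p x) (nabla_omega A gM I x) w u v y = 0"

lemma vanishes_iff:
  "vanishes W1p \<longleftrightarrow> cos (\<theta> x) * (pd_star A' g \<phi> (\<iota> x) (n x) - 12 * X.h) = 0"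
  "vanishes W1m \<longleftrightarrow> sin (\<theta> x) * (pd_star A' g \<phi> (\<iota> x) (n x) - 12 * X.h) = 0"
  "vanishes W1p \<and> vanishes W1m \<longleftrightarrow> pd_star A' g \<phi> (\<iota> x) (n x) = 12 * X.h"
  "vanishes W2p \<longleftrightarrow> (\<forall>u v. 2 * X.h * cos (\<theta> x) * gM x u v = cos (\<theta> x) * (B u v + act2 (I x) B u v))"
  "vanishes W2m \<longleftrightarrow> (\<forall>u v. 2 * X.h * sin (\<theta> x) * gM x u v = sin (\<theta> x) * (B u v + act2 (I x) B u v))"
  "vanishes W2p \<and> vanishes W2m \<longleftrightarrow> (\<forall>u v. B u v + act2 (I x) B u v = 2 * X.h * gM x u v)"
  "vanishes W3 \<longleftrightarrow> (\<forall>u v. act2 (I x) B u v = B u v)"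
  "vanishes W2p \<and> vanishes W2m \<and> vanishes W3 \<longleftrightarrow> (\<forall>u v. B u v = X.h * gM x u v)"
  "vanishes W4 \<longleftrightarrow> p_vec A' g \<phi> (\<iota> x) - g (\<iota> x) (p_vec A' g \<phi> (\<iota> x)) (n x) *\<^sub>R n x = 0"
proof -
  show "vanishes W1p \<longleftrightarrow> cos (\<theta> x) * (pd_star A' g \<phi> (\<iota> x) (n x) - 12 * X.h) = 0"
    unfolding gM_eq I_eq pd_normal X.T.vanishes_W1p by auto
  show "vanishes W1m \<longleftrightarrow> sin (\<theta> x) * (pd_star A' g \<phi> (\<iota> x) (n x) - 12 * X.h) = 0"
    unfolding gM_eq I_eq pd_normal X.T.vanishes_W1m by auto
  show "vanishes W1p \<and> vanishes W1m \<longleftrightarrow> pd_star A' g \<phi> (\<iota> x) (n x) = 12 * X.h"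
    unfolding gM_eq I_eq pd_normal X.T.vanishes_W1 by auto
  show "vanishes W2p \<longleftrightarrow> (\<forall>u v. 2 * X.h * cos (\<theta> x) * gM x u v = cos (\<theta> x) * (B u v + act2 (I x) B u v))"
    unfolding gM_eq I_eq act2_def G_\<beta>[symmetric] by (rule X.T.vanishes_W2p)
  show "vanishes W2m \<longleftrightarrow> (\<forall>u v. 2 * X.h * sin (\<theta> x) * gM x u v = sin (\<theta> x) * (B u v + act2 (I x) B u v))"
    unfolding gM_eq I_eq act2_def G_\<beta>[symmetric] by (rule X.T.vanishes_W2m)
  show "vanishes W2p \<and> vanishes W2m \<longleftrightarrow> (\<forall>u v. B u v + act2 (I x) B u v = 2 * X.h * gM x u v)"
    unfolding gM_eq I_eq act2_def G_\<beta>[symmetric] by (rule X.T.vanishes_W2)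
  show "vanishes W3 \<longleftrightarrow> (\<forall>u v. act2 (I x) B u v = B u v)"
    unfolding gM_eq I_eq act2_def G_\<beta>[symmetric] by (rule X.T.vanishes_W3)
  show "vanishes W2p \<and> vanishes W2m \<and> vanishes W3 \<longleftrightarrow> (\<forall>u v. B u v = X.h * gM x u v)"
    unfolding gM_eq I_eq G_\<beta>[symmetric] by (rule X.T.vanishes_W2_W3)
  show "vanishes W4 \<longleftrightarrow> p_vec A' g \<phi> (\<iota> x) - g (\<iota> x) (p_vec A' g \<phi> (\<iota> x)) (n x) *\<^sub>R n x = 0"
    unfolding gM_eq I_eq p_vec_normal_iff by (rule X.T.vanishes_W4)
qed

text \<open>Restated through the trace of the second fundamental form, so that the chosen frame no
  longer appears.\<close>

lemmas vanishes_iff_mean_curvature = vanishes_iff[folded mean_curvature, unfolded B_def]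

end

lemma ball_torsion_class:
  "(\<forall>w\<in>-{W5} - U. Q w) \<longleftrightarrow> (W1p \<notin> U \<longrightarrow> Q W1p) \<and> (W1m \<notin> U \<longrightarrow> Q W1m) \<and> (W2p \<notin> U \<longrightarrow> Q W2p)
    \<and> (W2m \<notin> U \<longrightarrow> Q W2m) \<and> (W3 \<notin> U \<longrightarrow> Q W3) \<and> (W4 \<notin> U \<longrightarrow> Q W4)"
proof -
  have "-{W5} = {W1p, W1m, W2p, W2m, W3, W4}" by (auto intro: torsion_class.exhaust)
  then show ?thesis by auto
qed

theorem theorem4p11:
  fixes A :: "('m::{t2_space,second_countable_topology}, real^6) chart set"
    and A' :: "('n::{t2_space,second_countable_topology}, real^7) chart set"
    and g :: "'n \<Rightarrow> real^7 \<Rightarrow> real^7 \<Rightarrow> real"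
    and \<phi> :: "'n \<Rightarrow> (real^7) tensor"
    and \<iota> :: "'m \<Rightarrow> 'n"
    and n :: "'m \<Rightarrow> real^7"
    and \<theta> :: "'m \<Rightarrow> real"
    and gM B :: "'m \<Rightarrow> real^6 \<Rightarrow> real^6 \<Rightarrow> real"
    and I :: "'m \<Rightarrow> real^6 \<Rightarrow> real^6"
    and \<psi>p \<psi>m :: "'m \<Rightarrow> (real^6) tensor"
    and h :: "'m \<Rightarrow> real"
    and pd :: "'n \<Rightarrow> real^7 \<Rightarrow> real"
    and \<pi> :: "'m \<Rightarrow> real^6 \<Rightarrow> real"
  assumes "smooth_manifold A'" and "riemannian_metric A' g"
    and "G2_structure A' g \<phi>" and "type_X4 A' g \<phi>"
    and "smooth_manifold A" and "hypersurface_with_normal A A' g \<iota> n"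
    and "smooth_function A \<theta>"
    and gM_eq: "gM = induced_metric A A' g \<iota>"
    and I_eq: "I = induced_I A A' g \<phi> \<iota> n"
    and psip_eq: "\<psi>p = psi_plus A A' g \<phi> \<iota> n \<theta>"
    and psim_eq: "\<psi>m = psi_minus A A' g \<phi> \<iota> n \<theta>"
    and B_eq: "B = second_fundamental_form A A' g \<iota> n"
    and h_eq: "h = (\<lambda>x. 1 / 6 * metric_trace (gM x) (B x))"
    and pd_eq: "pd = pd_star A' g \<phi>"
    and pull_pd_eq: "\<pi> = (\<lambda>x u. pd (\<iota> x) (tangent_map A A' \<iota> x u))"
  shows
    "(\<forall>x u. 3 * act1 (I x) (codiff_omega A gM I x) u = \<pi> x u \<and>
        \<pi> x u = 12 * act1 (I x) (differential A \<theta> x) u + 36 * eta A gM I \<psi>p \<psi>m x u) \<and>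
     (of_type A gM I \<psi>p \<psi>m {W1p, W1m, W2p, W2m, W3, W4} \<longleftrightarrow>
        (\<forall>x u. \<pi> x u = 12 * act1 (I x) (differential A \<theta> x) u)) \<and>
     (of_type A gM I \<psi>p \<psi>m {W1p, W1m, W2p, W2m, W3, W5} \<longleftrightarrow>
        (\<forall>x. p_vec A' g \<phi> (\<iota> x) - g (\<iota> x) (p_vec A' g \<phi> (\<iota> x)) (n x) *\<^sub>R n x = 0)) \<and>
     (of_type A gM I \<psi>p \<psi>m {W1p, W1m, W2p, W2m, W4, W5} \<longleftrightarrow>
        (\<forall>x u v. act2 (I x) (B x) u v = B x u v)) \<and>
     (of_type A gM I \<psi>p \<psi>m {W1p, W1m, W2p, W3, W4, W5} \<longleftrightarrow>
        (\<forall>x u v. 2 * h x * sin (\<theta> x) * gM x u v =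
           sin (\<theta> x) * (B x u v + act2 (I x) (B x) u v))) \<and>
     (of_type A gM I \<psi>p \<psi>m {W1p, W1m, W2m, W3, W4, W5} \<longleftrightarrow>
        (\<forall>x u v. 2 * h x * cos (\<theta> x) * gM x u v =
           cos (\<theta> x) * (B x u v + act2 (I x) (B x) u v))) \<and>
     (of_type A gM I \<psi>p \<psi>m {W1p, W2p, W2m, W3, W4, W5} \<longleftrightarrow>
        (\<forall>x. sin (\<theta> x) * (pd (\<iota> x) (n x) - 12 * h x) = 0)) \<and>
     (of_type A gM I \<psi>p \<psi>m {W1m, W2p, W2m, W3, W4, W5} \<longleftrightarrow>
        (\<forall>x. cos (\<theta> x) * (pd (\<iota> x) (n x) - 12 * h x) = 0)) \<and>
     (of_type A gM I \<psi>p \<psi>m {W1p, W1m, W3, W4, W5} \<longleftrightarrow>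
        (\<forall>x u v. B x u v + act2 (I x) (B x) u v = 2 * h x * gM x u v)) \<and>
     (of_type A gM I \<psi>p \<psi>m {W2p, W2m, W3, W4, W5} \<longleftrightarrow>
        (\<forall>x. pd (\<iota> x) (n x) = 12 * h x)) \<and>
     (of_type A gM I \<psi>p \<psi>m {W1p, W1m, W4, W5} \<longleftrightarrow>
        (\<forall>x u v. B x u v = h x * gM x u v))"
proof -
  interpret hypersurface A' g \<phi> A \<iota> n
    by (intro hypersurface.intro g2_manifold.intro hypersurface_axioms.intro) fact+
  define van where "van x w \<longleftrightarrow> (\<forall>u v y. torsion_component (gM x) (I x) (\<psi>p x) (nabla_omega A gM I x) w u v y = 0)"
    for x w
  \<comment> \<open>The frame may change from point to point: each conclusion drawn below concerns a
    single x and does not mention it.\<close>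
  have point: "\<exists>V e. hypersurface_point A' g \<phi> A \<iota> n x V e \<theta>" for x
  proof -
    obtain V e where *: "g2_point A' g \<phi> (\<iota> x) V e" using g2_point_exists by blast
    have "hypersurface_point A' g \<phi> A \<iota> n x V e \<theta>"
      by (intro hypersurface_point.intro hypersurface_axioms hypersurface_point_axioms.intro * assms(7))
    then show ?thesis by blast
  qed
  have forms: "3 * act1 (I x) (codiff_omega A gM I x) u = \<pi> x u \<and>
      \<pi> x u = 12 * act1 (I x) (differential A \<theta> x) u + 36 * eta A gM I \<psi>p \<psi>m x u" for x u
  proof -
    obtain V e where "hypersurface_point A' g \<phi> A \<iota> n x V e \<theta>" using point by blast
    from hypersurface_point.one_form_identities[OF this, of u] show ?thesis
      unfolding pull_pd_eq pd_eq gM_eq I_eq psip_eq psim_eq by blast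
  qed
  have van:
    "van x W1p \<longleftrightarrow> cos (\<theta> x) * (pd (\<iota> x) (n x) - 12 * h x) = 0"
    "van x W1m \<longleftrightarrow> sin (\<theta> x) * (pd (\<iota> x) (n x) - 12 * h x) = 0"
    "van x W1p \<and> van x W1m \<longleftrightarrow> pd (\<iota> x) (n x) = 12 * h x"
    "van x W2p \<longleftrightarrow> (\<forall>u v. 2 * h x * cos (\<theta> x) * gM x u v = cos (\<theta> x) * (B x u v + act2 (I x) (B x) u v))"
    "van x W2m \<longleftrightarrow> (\<forall>u v. 2 * h x * sin (\<theta> x) * gM x u v = sin (\<theta> x) * (B x u v + act2 (I x) (B x) u v))"
    "van x W2p \<and> van x W2m \<longleftrightarrow> (\<forall>u v. B x u v + act2 (I x) (B x) u v = 2 * h x * gM x u v)"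
    "van x W3 \<longleftrightarrow> (\<forall>u v. act2 (I x) (B x) u v = B x u v)"
    "van x W2p \<and> van x W2m \<and> van x W3 \<longleftrightarrow> (\<forall>u v. B x u v = h x * gM x u v)"
    "van x W4 \<longleftrightarrow> p_vec A' g \<phi> (\<iota> x) - g (\<iota> x) (p_vec A' g \<phi> (\<iota> x)) (n x) *\<^sub>R n x = 0" for x
  proof -
    obtain V e where "hypersurface_point A' g \<phi> A \<iota> n x V e \<theta>" using point by blast
    note v = hypersurface_point.vanishes_iff_mean_curvature[OF this, folded gM_eq I_eq psip_eq pd_eq B_eq]
    show "van x W1p \<longleftrightarrow> cos (\<theta> x) * (pd (\<iota> x) (n x) - 12 * h x) = 0"
      unfolding van_def h_eq by (rule v(1))
    show "van x W1m \<longleftrightarrow> sin (\<theta> x) * (pd (\<iota> x) (n x) - 12 * h x) = 0"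
      unfolding van_def h_eq by (rule v(2))
    show "van x W1p \<and> van x W1m \<longleftrightarrow> pd (\<iota> x) (n x) = 12 * h x"
      unfolding van_def h_eq by (rule v(3))
    show "van x W2p \<longleftrightarrow> (\<forall>u v. 2 * h x * cos (\<theta> x) * gM x u v = cos (\<theta> x) * (B x u v + act2 (I x) (B x) u v))"
      unfolding van_def h_eq by (rule v(4))
    show "van x W2m \<longleftrightarrow> (\<forall>u v. 2 * h x * sin (\<theta> x) * gM x u v = sin (\<theta> x) * (B x u v + act2 (I x) (B x) u v))"
      unfolding van_def h_eq by (rule v(5))
    show "van x W2p \<and> van x W2m \<longleftrightarrow> (\<forall>u v. B x u v + act2 (I x) (B x) u v = 2 * h x * gM x u v)"
      unfolding van_def h_eq by (rule v(6))
    show "van x W3 \<longleftrightarrow> (\<forall>u v. act2 (I x) (B x) u v = B x u v)"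
      unfolding van_def h_eq by (rule v(7))
    show "van x W2p \<and> van x W2m \<and> van x W3 \<longleftrightarrow> (\<forall>u v. B x u v = h x * gM x u v)"
      unfolding van_def h_eq by (rule v(8))
    show "van x W4 \<longleftrightarrow> p_vec A' g \<phi> (\<iota> x) - g (\<iota> x) (p_vec A' g \<phi> (\<iota> x)) (n x) *\<^sub>R n x = 0"
      unfolding van_def h_eq by (rule v(9))
  qed
  have type: "of_type A gM I \<psi>p \<psi>m U \<longleftrightarrow>
      (\<forall>x. (W1p \<notin> U \<longrightarrow> van x W1p) \<and> (W1m \<notin> U \<longrightarrow> van x W1m) \<and> (W2p \<notin> U \<longrightarrow> van x W2p)
        \<and> (W2m \<notin> U \<longrightarrow> van x W2m) \<and> (W3 \<notin> U \<longrightarrow> van x W3) \<and> (W4 \<notin> U \<longrightarrow> van x W4)) \<and>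
      (W5 \<notin> U \<longrightarrow> (\<forall>x u. eta A gM I \<psi>p \<psi>m x u = 0))" for U
    unfolding of_type_def van_def ball_torsion_class ..
  \<comment> \<open>By the second identity, 36 \<eta> is exactly the difference of the two sides of
    this condition.\<close>
  have eta: "eta A gM I \<psi>p \<psi>m x u = 0 \<longleftrightarrow> \<pi> x u = 12 * act1 (I x) (differential A \<theta> x) u" for x u
    using forms[of x u] by linarith
  show ?thesis
  proof (intro conjI)
    show "\<forall>x u. 3 * act1 (I x) (codiff_omega A gM I x) u = \<pi> x u \<and>
        \<pi> x u = 12 * act1 (I x) (differential A \<theta> x) u + 36 * eta A gM I \<psi>p \<psi>m x u"
      using forms by blast
  \<comment> \<open>Each geometric condition is first rewritten backwards as the vanishing of the
    omitted components, or of \<eta>; unfolding \<open>type\<close> then makes the two sides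
    coincide.\<close>
  qed (simp_all only: van[symmetric] eta[symmetric], simp_all add: type)
qed

end
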